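(* Let $G=N\rtimes H$, $M$, $\mathcal U$, $D$, $D_0$, $\alpha$ and $D_0\rtimes_\alpha G$ be as in the context, with $\mathcal U$ having finite quotients and $H$ acting effectively on $M$. Then $D\rtimes_\alpha G$ is the enveloping $C^*$-algebra of $D_0\rtimes_\alpha G$.
   Context: $G=N\rtimes H$ is a discrete group which is a semidirect product with normal subgroup $N$ and quotient group $H$ (regarded as a subgroup of $G$, acting on $N$ by conjugation), and $M\neq\{e\}$ is a normal subgroup of $N$. Put $\mathcal U=\{aMa^{-1}:a\in H\}$. Standing assumptions: (filter base) for all $U,V\in\mathcal U$ there is $W\in\mathcal U$ with $W\subseteq U\cap V$; (separating) $\bigcap_{U\in\mathcal U}U=\{e\}$; (finite quotients) $|U/V|<\infty$ whenever $V\subseteq U$ in $\mathcal U$; (effective) for each $a\ne e$ in $H$ there is $s\in M$ with $asa^{-1}\neq s$. For $g=xa\in G$ with $x\in N$, $a\in H$, let $\beta_g:N\to N$, $\beta_g(y)=xaya^{-1}$, and let $\alpha_g(f)=f\circ\beta_{g^{-1}}$ for $f\in\ell^\infty(N)$. Let $\mathcal P=\{\chi_{xU}:x\in N,U\in\mathcal U\}\subseteq\ell^\infty(N)$, let $D=C^*(\mathcal P)\subseteq\ell^\infty(N)$, and let $D_0=\operatorname{span}\mathcal P$, a dense $\alpha$-invariant $*$-subalgebra of $D$. $\alpha$ restricts to an action of $G$ on $D$. $D\rtimes_\alpha G$ is the full $C^*$-crossed product, with canonical maps $i_D:D\to M(D\rtimes_\alpha G)$ and $i_G:G\to UM(D\rtimes_\alpha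 G)$. The algebraic crossed product is the $*$-subalgebra $D_0\rtimes_\alpha G:=\operatorname{span} i_G(G)i_D(D_0)$ of $D\rtimes_\alpha G$. A $C^*$-algebra $B$ containing a $*$-algebra $B_0$ as a dense $*$-subalgebra is the enveloping $C^*$-algebra of $B_0$ if every $*$-homomorphism of $B_0$ into $\mathcal B(X)$, for any Hilbert space $X$, extends (uniquely) to a $*$-homomorphism of $B$. *)

theory Defs
  imports "HOL-Algebra.Module" "HOL-Algebra.Coset" "HOL-Analysis.Analysis"
begin

section \<open>Normed complex vector spaces on a carrier set\<close>

definition complex_ring :: "complex ring"
  where "complex_ring = \<lparr>carrier = UNIV, monoid.mult = (*), one = 1, ring.zero = 0, ring.add = (+)\<rparr>"

definition cspan :: "(complex, 'a, 'm) module_scheme \<Rightarrow> 'a set \<Rightarrow> 'a set"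
  where "cspan V S = \<Inter>{W. submodule W complex_ring V \<and> S \<subseteq> W}"

text \<open>The distance is set to 0 off the carrier because the locale \<open>Metric_space\<close> requires
  symmetry and nonnegativity on the whole type.\<close>

definition norm_dist :: "(complex, 'a, 'm) module_scheme \<Rightarrow> ('a \<Rightarrow> real) \<Rightarrow> 'a \<Rightarrow> 'a \<Rightarrow> real"
  where "norm_dist V nm x y =
    (if x \<in> carrier V \<and> y \<in> carrier V then nm (x \<ominus>\<^bsub>V\<^esub> y) else 0)"

definition norm_closure :: "(complex, 'a, 'm) module_scheme \<Rightarrow> ('a \<Rightarrow> real) \<Rightarrow> 'a set \<Rightarrow> 'a set"
  where "norm_closure V nm S =
    Metric_space.mtopology (carrier V) (norm_dist V nm) closure_of S"

definition norm_complete :: "(complex, 'a, 'm) module_scheme \<Rightarrow> ('a \<Rightarrow> real) \<Rightarrow> bool"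
  where "norm_complete V nm \<longleftrightarrow> Metric_space.mcomplete (carrier V) (norm_dist V nm)"

definition bounded_operators ::
    "(complex, 'a, 'm) module_scheme \<Rightarrow> ('a \<Rightarrow> real) \<Rightarrow> ('a \<Rightarrow> 'a) set"
  where "bounded_operators V nm = {T \<in> carrier V \<rightarrow>\<^sub>E carrier V.
    (\<forall>x\<in>carrier V. \<forall>y\<in>carrier V. T (x \<oplus>\<^bsub>V\<^esub> y) = T x \<oplus>\<^bsub>V\<^esub> T y) \<and>
    (\<forall>c. \<forall>x\<in>carrier V. T (c \<odot>\<^bsub>V\<^esub> x) = c \<odot>\<^bsub>V\<^esub> T x) \<and>
    (\<exists>K. \<forall>x\<in>carrier V. nm (T x) \<le> K * nm x)}"

definition operator_norm ::
    "(complex, 'a, 'm) module_scheme \<Rightarrow> ('a \<Rightarrow> real) \<Rightarrow> ('a \<Rightarrow> 'a) \<Rightarrow> real"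
  where "operator_norm V nm T = (SUP x\<in>{x \<in> carrier V. nm x \<le> 1}. nm (T x))"

text \<open>A family of operators is nondegenerate if its ranges span a dense subspace.\<close>

definition nondegenerate ::
    "(complex, 'a, 'm) module_scheme \<Rightarrow> ('a \<Rightarrow> real) \<Rightarrow> ('a \<Rightarrow> 'a) set \<Rightarrow> bool"
  where "nondegenerate V nm \<T> \<longleftrightarrow>
    norm_closure V nm (cspan V {T x |T x. T \<in> \<T> \<and> x \<in> carrier V}) = carrier V"


section \<open>C*-algebras\<close>

text \<open>As the record extends \<open>ring\<close>, it has a field \<open>one\<close>; its value is irrelevant for
  algebras that are not declared unital.\<close>

record 'a star_alg = "(complex, 'a) module" +
  star :: "'a \<Rightarrow> 'a"
  nrm :: "'a \<Rightarrow> real"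

locale cstar_algebra = Module.module complex_ring A
  for A :: "'a star_alg" (structure) +
  assumes mult_closed: "\<lbrakk>x \<in> carrier A; y \<in> carrier A\<rbrakk> \<Longrightarrow> x \<otimes> y \<in> carrier A"
    and mult_assoc: "\<lbrakk>x \<in> carrier A; y \<in> carrier A; z \<in> carrier A\<rbrakk> \<Longrightarrow>
      (x \<otimes> y) \<otimes> z = x \<otimes> (y \<otimes> z)"
    and distrib_right: "\<lbrakk>x \<in> carrier A; y \<in> carrier A; z \<in> carrier A\<rbrakk> \<Longrightarrow>
      (x \<oplus> y) \<otimes> z = x \<otimes> z \<oplus> y \<otimes> z"
    and distrib_left: "\<lbrakk>x \<in> carrier A; y \<in> carrier A; z \<in> carrier A\<rbrakk> \<Longrightarrow>
      x \<otimes> (y \<oplus> z) = x \<otimes> y \<oplus> x \<otimes> z"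
    and smult_mult_left: "\<lbrakk>x \<in> carrier A; y \<in> carrier A\<rbrakk> \<Longrightarrow> (c \<odot> x) \<otimes> y = c \<odot> (x \<otimes> y)"
    and smult_mult_right: "\<lbrakk>x \<in> carrier A; y \<in> carrier A\<rbrakk> \<Longrightarrow> x \<otimes> (c \<odot> y) = c \<odot> (x \<otimes> y)"
    and star_closed: "x \<in> carrier A \<Longrightarrow> star A x \<in> carrier A"
    and star_star: "x \<in> carrier A \<Longrightarrow> star A (star A x) = x"
    and star_add: "\<lbrakk>x \<in> carrier A; y \<in> carrier A\<rbrakk> \<Longrightarrow> star A (x \<oplus> y) = star A x \<oplus> star A y"
    and star_smult: "x \<in> carrier A \<Longrightarrow> star A (c \<odot> x) = cnj c \<odot> star A x"
    and star_mult: "\<lbrakk>x \<in> carrier A; y \<in> carrier A\<rbrakk> \<Longrightarrow> star A (x \<otimes> y) = star A y \<otimes> star A x"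
    and nrm_nonneg: "x \<in> carrier A \<Longrightarrow> 0 \<le> nrm A x"
    and nrm_eq_0: "x \<in> carrier A \<Longrightarrow> nrm A x = 0 \<longleftrightarrow> x = \<zero>"
    and nrm_triangle: "\<lbrakk>x \<in> carrier A; y \<in> carrier A\<rbrakk> \<Longrightarrow> nrm A (x \<oplus> y) \<le> nrm A x + nrm A y"
    and nrm_smult: "x \<in> carrier A \<Longrightarrow> nrm A (c \<odot> x) = cmod c * nrm A x"
    and nrm_mult: "\<lbrakk>x \<in> carrier A; y \<in> carrier A\<rbrakk> \<Longrightarrow> nrm A (x \<otimes> y) \<le> nrm A x * nrm A y"
    and nrm_star_mult: "x \<in> carrier A \<Longrightarrow> nrm A (star A x \<otimes> x) = (nrm A x)\<^sup>2"
    and complete: "norm_complete A (nrm A)"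

definition star_subalgebra :: "'a set \<Rightarrow> 'a star_alg \<Rightarrow> bool"
  where "star_subalgebra S A \<longleftrightarrow> submodule S complex_ring A \<and>
    (\<forall>x\<in>S. \<forall>y\<in>S. x \<otimes>\<^bsub>A\<^esub> y \<in> S) \<and> (\<forall>x\<in>S. star A x \<in> S)"

definition cstar_generated :: "'a star_alg \<Rightarrow> 'a set \<Rightarrow> 'a set"
  where "cstar_generated A P =
    \<Inter>{S. star_subalgebra S A \<and> norm_closure A (nrm A) S = S \<and> P \<subseteq> S}"

definition star_hom :: "'a star_alg \<Rightarrow> 'b star_alg \<Rightarrow> ('a \<Rightarrow> 'b) \<Rightarrow> bool"
  where "star_hom A B \<phi> \<longleftrightarrow> \<phi> \<in> carrier A \<rightarrow> carrier B \<and>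
    (\<forall>x\<in>carrier A. \<forall>y\<in>carrier A. \<phi> (x \<oplus>\<^bsub>A\<^esub> y) = \<phi> x \<oplus>\<^bsub>B\<^esub> \<phi> y) \<and>
    (\<forall>c. \<forall>x\<in>carrier A. \<phi> (c \<odot>\<^bsub>A\<^esub> x) = c \<odot>\<^bsub>B\<^esub> \<phi> x) \<and>
    (\<forall>x\<in>carrier A. \<forall>y\<in>carrier A. \<phi> (x \<otimes>\<^bsub>A\<^esub> y) = \<phi> x \<otimes>\<^bsub>B\<^esub> \<phi> y) \<and>
    (\<forall>x\<in>carrier A. \<phi> (star A x) = star B (\<phi> x))"

definition unitary_group :: "'a star_alg \<Rightarrow> 'a star_alg"
  where "unitary_group A = A\<lparr>carrier := {u \<in> carrier A.
    star A u \<otimes>\<^bsub>A\<^esub> u = \<one>\<^bsub>A\<^esub> \<and> u \<otimes>\<^bsub>A\<^esub> star A u = \<one>\<^bsub>A\<^esub>}\<rparr>"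


subsection \<open>The multiplier algebra\<close>

text \<open>Multipliers are double centralizers \<open>(L, R)\<close>, thought of as left and right
  multiplication by one element: \<open>L b = m b\<close> and \<open>R b = b m\<close>.\<close>

definition multiplier_algebra :: "'b star_alg \<Rightarrow> (('b \<Rightarrow> 'b) \<times> ('b \<Rightarrow> 'b)) star_alg"
  where "multiplier_algebra B = \<lparr>
    carrier = {(L, R). L \<in> bounded_operators B (nrm B) \<and> R \<in> bounded_operators B (nrm B) \<and>
      (\<forall>a\<in>carrier B. \<forall>b\<in>carrier B.
        L (a \<otimes>\<^bsub>B\<^esub> b) = L a \<otimes>\<^bsub>B\<^esub> b \<and> R (a \<otimes>\<^bsub>B\<^esub> b) = a \<otimes>\<^bsub>B\<^esub> R b \<and>
        R a \<otimes>\<^bsub>B\<^esub> b = a \<otimes>\<^bsub>B\<^esub> L b)},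
    monoid.mult = (\<lambda>(L1, R1) (L2, R2). (compose (carrier B) L1 L2, compose (carrier B) R2 R1)),
    one = (\<lambda>b\<in>carrier B. b, \<lambda>b\<in>carrier B. b),
    ring.zero = (\<lambda>b\<in>carrier B. \<zero>\<^bsub>B\<^esub>, \<lambda>b\<in>carrier B. \<zero>\<^bsub>B\<^esub>),
    ring.add = (\<lambda>(L1, R1) (L2, R2).
      (\<lambda>b\<in>carrier B. L1 b \<oplus>\<^bsub>B\<^esub> L2 b, \<lambda>b\<in>carrier B. R1 b \<oplus>\<^bsub>B\<^esub> R2 b)),
    module.smult = (\<lambda>c (L, R). (\<lambda>b\<in>carrier B. c \<odot>\<^bsub>B\<^esub> L b, \<lambda>b\<in>carrier B. c \<odot>\<^bsub>B\<^esub> R b)),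
    star = (\<lambda>(L, R). (\<lambda>b\<in>carrier B. star B (R (star B b)), \<lambda>b\<in>carrier B. star B (L (star B b)))),
    nrm = (\<lambda>(L, R). operator_norm B (nrm B) L)\<rparr>"

definition multiplier_embedding :: "'b star_alg \<Rightarrow> 'b \<Rightarrow> ('b \<Rightarrow> 'b) \<times> ('b \<Rightarrow> 'b)"
  where "multiplier_embedding B b =
    (\<lambda>x\<in>carrier B. b \<otimes>\<^bsub>B\<^esub> x, \<lambda>x\<in>carrier B. x \<otimes>\<^bsub>B\<^esub> b)"


section \<open>Hilbert spaces and their bounded operators\<close>

text \<open>The inner product is linear in the first variable. The ring fields \<open>mult\<close> and \<open>one\<close>
  inherited from \<open>module\<close> play no role.\<close>

record 'x inner_product_space = "(complex, 'x) module" +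
  ip :: "'x \<Rightarrow> 'x \<Rightarrow> complex"

definition ip_norm :: "'x inner_product_space \<Rightarrow> 'x \<Rightarrow> real"
  where "ip_norm X x = sqrt (Re (ip X x x))"

locale hilbert_space = Module.module complex_ring X
  for X :: "'x inner_product_space" (structure) +
  assumes ip_add: "\<lbrakk>x \<in> carrier X; y \<in> carrier X; z \<in> carrier X\<rbrakk> \<Longrightarrow>
      ip X (x \<oplus> y) z = ip X x z + ip X y z"
    and ip_smult: "\<lbrakk>x \<in> carrier X; y \<in> carrier X\<rbrakk> \<Longrightarrow> ip X (c \<odot> x) y = c * ip X x y"
    and ip_cnj: "\<lbrakk>x \<in> carrier X; y \<in> carrier X\<rbrakk> \<Longrightarrow> ip X y x = cnj (ip X x y)"
    and ip_pos: "\<lbrakk>x \<in> carrier X; x \<noteq> \<zero>\<rbrakk> \<Longrightarrow> 0 < Re (ip X x x)"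
    and complete: "norm_complete X (ip_norm X)"

definition operator_algebra :: "'x inner_product_space \<Rightarrow> ('x \<Rightarrow> 'x) star_alg"
  where "operator_algebra X = \<lparr>
    carrier = bounded_operators X (ip_norm X),
    monoid.mult = compose (carrier X),
    one = (\<lambda>x\<in>carrier X. x),
    ring.zero = (\<lambda>x\<in>carrier X. \<zero>\<^bsub>X\<^esub>),
    ring.add = (\<lambda>S T. \<lambda>x\<in>carrier X. S x \<oplus>\<^bsub>X\<^esub> T x),
    module.smult = (\<lambda>c T. \<lambda>x\<in>carrier X. c \<odot>\<^bsub>X\<^esub> T x),
    star = (\<lambda>T. THE S. S \<in> bounded_operators X (ip_norm X) \<and>
      (\<forall>x\<in>carrier X. \<forall>y\<in>carrier X. ip X (T x) y = ip X x (S y))),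
    nrm = operator_norm X (ip_norm X)\<rparr>"


section \<open>Full crossed products by discrete groups\<close>

definition covariant_representation ::
    "('g, 'm) monoid_scheme \<Rightarrow> 'a star_alg \<Rightarrow> ('g \<Rightarrow> 'a \<Rightarrow> 'a) \<Rightarrow>
     'x inner_product_space \<Rightarrow> ('a \<Rightarrow> 'x \<Rightarrow> 'x) \<Rightarrow> ('g \<Rightarrow> 'x \<Rightarrow> 'x) \<Rightarrow> bool"
  where "covariant_representation G A act X \<pi> U \<longleftrightarrow>
    star_hom A (operator_algebra X) \<pi> \<and>
    nondegenerate X (ip_norm X) (\<pi> ` carrier A) \<and>
    U \<in> hom G (unitary_group (operator_algebra X)) \<and>
    (\<forall>g\<in>carrier G. \<forall>a\<in>carrier A.
      \<pi> (act g a) = U g \<otimes>\<^bsub>operator_algebra X\<^esub> \<pi> a \<otimes>\<^bsub>operator_algebra X\<^esub> star (operator_algebra X) (U g))"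

text \<open>
  The full crossed product \<open>B\<close> of \<open>(A, G, act)\<close>, given (up to isomorphism) by its universal
  property: the canonical maps \<open>iA\<close> and \<open>iG\<close> into the multiplier algebra form a covariant
  homomorphism, the products \<open>iA a iG g\<close> span a dense subspace of \<open>B\<close> (\<open>G\<close> is discrete), and
  every covariant representation \<open>(\<pi>, U)\<close> is \<open>(L \<circ> iA, L \<circ> iG)\<close> for a nondegenerate
  representation \<open>L\<close> of \<open>B\<close>. Here \<open>L\<close> is extended to multipliers by \<open>L m (L b x) = L (m b) x\<close>,
  which by nondegeneracy determines \<open>L m\<close>.

  HOL cannot quantify over the Hilbert spaces of all types within one formula. It is enough to
  consider cyclic covariant representations. Their spaces have a dense subset that is an image of
  the space of finitely supported functions from \<open>G\<close> to \<open>A\<close>, so (choosing for each vector a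
  sequence converging to it) they are isomorphic to Hilbert spaces carried by a set of sequences
  of functions from \<open>G\<close> to \<open>A\<close>.
\<close>

locale full_crossed_product = cstar_algebra B
  for G :: "('g, 'm) monoid_scheme" and A :: "'a star_alg" and act :: "'g \<Rightarrow> 'a \<Rightarrow> 'a"
    and B :: "'b star_alg" and iA :: "'a \<Rightarrow> ('b \<Rightarrow> 'b) \<times> ('b \<Rightarrow> 'b)"
    and iG :: "'g \<Rightarrow> ('b \<Rightarrow> 'b) \<times> ('b \<Rightarrow> 'b)" +
  assumes iA_hom: "star_hom A (multiplier_algebra B) iA"
    and iA_nondegenerate: "nondegenerate B (nrm B) (fst ` iA ` carrier A)"
    and iG_hom: "iG \<in> hom G (unitary_group (multiplier_algebra B))"
    and covariant: "\<lbrakk>g \<in> carrier G; a \<in> carrier A\<rbrakk> \<Longrightarrow>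
      iA (act g a) = iG g \<otimes>\<^bsub>multiplier_algebra B\<^esub> iA a \<otimes>\<^bsub>multiplier_algebra B\<^esub>
        star (multiplier_algebra B) (iG g)"
    and dense: "norm_closure (multiplier_algebra B) (nrm (multiplier_algebra B))
        (cspan (multiplier_algebra B)
          {iA a \<otimes>\<^bsub>multiplier_algebra B\<^esub> iG g |a g. a \<in> carrier A \<and> g \<in> carrier G}) =
      multiplier_embedding B ` carrier B"
    and universal: "\<And>(X :: (nat \<Rightarrow> 'g \<Rightarrow> 'a) inner_product_space) \<pi> U.
      \<lbrakk>hilbert_space X; covariant_representation G A act X \<pi> U\<rbrakk> \<Longrightarrow>
      \<exists>L. star_hom B (operator_algebra X) L \<and>
        nondegenerate X (ip_norm X) (L ` carrier B) \<and>
        (\<forall>a\<in>carrier A. \<forall>b\<in>carrier B. \<pi> a \<otimes>\<^bsub>operator_algebra X\<^esub> L b = L (fst (iA a) b)) \<and>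
        (\<forall>g\<in>carrier G. \<forall>b\<in>carrier B. U g \<otimes>\<^bsub>operator_algebra X\<^esub> L b = L (fst (iG g) b))"

definition algebraic_crossed_product ::
    "('g, 'm) monoid_scheme \<Rightarrow> 'a set \<Rightarrow> 'b star_alg \<Rightarrow> ('a \<Rightarrow> ('b \<Rightarrow> 'b) \<times> ('b \<Rightarrow> 'b)) \<Rightarrow>
     ('g \<Rightarrow> ('b \<Rightarrow> 'b) \<times> ('b \<Rightarrow> 'b)) \<Rightarrow> 'b set"
  where "algebraic_crossed_product G A0 B iA iG = {b \<in> carrier B. multiplier_embedding B b \<in>
    cspan (multiplier_algebra B) {iG g \<otimes>\<^bsub>multiplier_algebra B\<^esub> iA a |g a. g \<in> carrier G \<and> a \<in> A0}}"

text \<open>The type argument is the type of the vectors of the Hilbert spaces considered; a statement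
  with a free type variable in that place is about all Hilbert spaces.\<close>

definition enveloping_cstar_algebra :: "'x itself \<Rightarrow> 'b star_alg \<Rightarrow> 'b set \<Rightarrow> bool"
  where "enveloping_cstar_algebra TYPE('x) B B0 \<longleftrightarrow>
    cstar_algebra B \<and> star_subalgebra B0 B \<and> norm_closure B (nrm B) B0 = carrier B \<and>
    (\<forall>(X :: 'x inner_product_space) \<pi>.
      hilbert_space X \<and> star_hom (B\<lparr>carrier := B0\<rparr>) (operator_algebra X) \<pi> \<longrightarrow>
      (\<exists>!L. L \<in> extensional (carrier B) \<and> star_hom B (operator_algebra X) L \<and>
        (\<forall>b\<in>B0. L b = \<pi> b)))"


section \<open>The action of a semidirect product on functions on its normal subgroup\<close>

text \<open>Functions on \<open>N\<close> are represented by functions on the ambient type vanishing off \<open>N\<close>.\<close>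

definition linf :: "'g set \<Rightarrow> ('g \<Rightarrow> complex) star_alg"
  where "linf N = \<lparr>
    carrier = {f. (\<forall>x. x \<notin> N \<longrightarrow> f x = 0) \<and> bounded (f ` N)},
    monoid.mult = (\<lambda>f h x. f x * h x),
    one = indicator N,
    ring.zero = (\<lambda>x. 0),
    ring.add = (\<lambda>f h x. f x + h x),
    module.smult = (\<lambda>c f x. c * f x),
    star = (\<lambda>f x. cnj (f x)),
    nrm = (\<lambda>f. SUP x\<in>N. cmod (f x))\<rparr>"

definition conjugates :: "('g, 'm) monoid_scheme \<Rightarrow> 'g set \<Rightarrow> 'g set \<Rightarrow> 'g set set"
  where "conjugates G H M = {a <#\<^bsub>G\<^esub> M #>\<^bsub>G\<^esub> inv\<^bsub>G\<^esub> a |a. a \<in> H}"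

definition N_part :: "('g, 'm) monoid_scheme \<Rightarrow> 'g set \<Rightarrow> 'g set \<Rightarrow> 'g \<Rightarrow> 'g"
  where "N_part G N H g = (THE x. x \<in> N \<and> (\<exists>a\<in>H. g = x \<otimes>\<^bsub>G\<^esub> a))"

definition H_part :: "('g, 'm) monoid_scheme \<Rightarrow> 'g set \<Rightarrow> 'g set \<Rightarrow> 'g \<Rightarrow> 'g"
  where "H_part G N H g = (THE a. a \<in> H \<and> (\<exists>x\<in>N. g = x \<otimes>\<^bsub>G\<^esub> a))"

definition beta :: "('g, 'm) monoid_scheme \<Rightarrow> 'g set \<Rightarrow> 'g set \<Rightarrow> 'g \<Rightarrow> 'g \<Rightarrow> 'g"
  where "beta G N H g y =
    N_part G N H g \<otimes>\<^bsub>G\<^esub> H_part G N H g \<otimes>\<^bsub>G\<^esub> y \<otimes>\<^bsub>G\<^esub> inv\<^bsub>G\<^esub> (H_part G N H g)"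

definition alpha ::
    "('g, 'm) monoid_scheme \<Rightarrow> 'g set \<Rightarrow> 'g set \<Rightarrow> 'g \<Rightarrow> ('g \<Rightarrow> complex) \<Rightarrow> 'g \<Rightarrow> complex"
  where "alpha G N H g f = (\<lambda>y. if y \<in> N then f (beta G N H (inv\<^bsub>G\<^esub> g) y) else 0)"

definition coset_projections ::
    "('g, 'm) monoid_scheme \<Rightarrow> 'g set \<Rightarrow> 'g set \<Rightarrow> 'g set \<Rightarrow> ('g \<Rightarrow> complex) set"
  where "coset_projections G N H M = {indicator (x <#\<^bsub>G\<^esub> U) |x U. x \<in> N \<and> U \<in> conjugates G H M}"

definition D_algebra ::
    "('g, 'm) monoid_scheme \<Rightarrow> 'g set \<Rightarrow> 'g set \<Rightarrow> 'g set \<Rightarrow> ('g \<Rightarrow> complex) star_alg"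
  where "D_algebra G N H M =
    (linf N)\<lparr>carrier := cstar_generated (linf N) (coset_projections G N H M)\<rparr>"

definition D0_set ::
    "('g, 'm) monoid_scheme \<Rightarrow> 'g set \<Rightarrow> 'g set \<Rightarrow> 'g set \<Rightarrow> ('g \<Rightarrow> complex) set"
  where "D0_set G N H M = cspan (linf N) (coset_projections G N H M)"

end

theory Submission
  imports Defs
begin

text \<open>
  A *-representation \<open>\<pi>\<close> of the algebraic crossed product on a Hilbert space comes without any
  continuity, while the universal property of the crossed product only produces
  representations from covariant pairs. The point of the proof is that \<open>\<pi>\<close> is nevertheless
  contractive for the norm of the crossed product (\<open>\<pi>_contractive\<close>); then it extends by density
  (\<open>star_hom_extend\<close>), and the extension is unique because *-homomorphisms of C*-algebras are
  continuous.

  Contractivity rests on the structure of \<open>D\<^sub>0\<close>. Since quotients of members of the filter base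
  are finite, \<open>D\<^sub>0\<close> consists of all functions on \<open>N\<close> that are constant on the cosets of some
  member of the filter base and vanish off finitely many of them (\<open>D0_eq_step_functions\<close>). This
  class is closed under every pointwise operation that maps 0 to 0, which has two consequences.
  First, if \<open>f\<close> in \<open>D\<^sub>0\<close> has norm at most 1, then \<open>f\<^sup>* f + q\<^sup>* q = p\<close> for some \<open>q\<close> and some projection
  \<open>p\<close> in \<open>D\<^sub>0\<close>, and so \<open>\<pi>\<close> is automatically contractive on \<open>D\<^sub>0\<close> (\<open>\<pi>_A0_contractive\<close>) and
  yields a representation \<open>\<rho>\<close> of \<open>D\<close>. Secondly, \<open>D\<^sub>0\<close> has local units, that is, every element
  \<open>b\<close> of the algebraic crossed product satisfies \<open>b = b p\<close> for a projection \<open>p\<close> in \<open>D\<^sub>0\<close>.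

  The group representation is recovered on the closure \<open>W\<close> of the orbit of one vector \<open>\<xi>\<close>: left
  multiplication by the multiplier \<open>u\<^sub>g\<close> of \<open>g\<close> preserves the algebraic crossed product, and
  \<open>(u\<^sub>g b)\<^sup>* (u\<^sub>g c) = b\<^sup>* c\<close>, so that \<open>\<pi>(b) \<xi> \<mapsto> \<pi>(u\<^sub>g b) \<xi>\<close> is a well-defined isometry and extends to a
  unitary operator \<open>U\<^sub>g\<close> on \<open>W\<close>. The pair \<open>(\<rho>, U)\<close> is covariant and nondegenerate on \<open>W\<close>. The universal
  property gives a representation \<open>L\<close> of the crossed product on \<open>W\<close> that restricts to \<open>\<pi>\<close>, and \<open>L\<close>
  is contractive; hence \<open>\<parallel>\<pi>(b) w\<parallel> \<le> \<parallel>b\<parallel> \<parallel>w\<parallel>\<close> for \<open>w\<close> in \<open>W\<close> (\<open>\<pi>_bound_on_W\<close>). Applied to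
  \<open>w = \<pi>(p) \<xi>\<close> with \<open>b = b p\<close>, this bounds \<open>\<pi>(b) \<xi> = \<pi>(b) w\<close>.

  The universal property concerns Hilbert spaces whose vectors have one particular type. A vector
  of \<open>W\<close> is determined by its inner products with the vectors \<open>\<pi>(u\<^sub>g \<chi>) \<xi>\<close>, where \<open>\<chi>\<close> runs through the
  coset projections, and these are indexed by the elements of \<open>G\<close>. So \<open>W\<close> is transported to a
  space of functions of that type (\<open>sep_inj\<close>).

  Continuity of *-homomorphisms (\<open>star_hom_contractive\<close>) is obtained without spectral theory: for a
  selfadjoint \<open>h\<close> of norm at most 1 there is a selfadjoint \<open>k\<close>, namely \<open>1 - sqrt (1 - h\<^sup>2)\<close>, with
  \<open>h\<^sup>2 + (1 - k)\<^sup>2 = 1\<close> (\<open>exists_one_minus_sqrt\<close>), an identity that every *-homomorphism preserves.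
\<close>

section \<open>Normed complex spaces on a carrier set\<close>

lemma complex_ring_simps [simp]:
  "carrier complex_ring = UNIV" "a \<otimes>\<^bsub>complex_ring\<^esub> b = a * b" "\<one>\<^bsub>complex_ring\<^esub> = 1"
  "\<zero>\<^bsub>complex_ring\<^esub> = 0" "a \<oplus>\<^bsub>complex_ring\<^esub> b = a + b"
  by (simp_all add: complex_ring_def)

lemma cring_complex_ring: "cring complex_ring"
proof (rule cringI)
  show "abelian_group complex_ring"
  proof (rule abelian_groupI)
    show "\<exists>y\<in>carrier complex_ring. y \<oplus>\<^bsub>complex_ring\<^esub> x = \<zero>\<^bsub>complex_ring\<^esub>" for x
      by (intro bexI[of _ "- x"]) auto
  qed auto
  show "comm_monoid complex_ring"
    by (rule comm_monoidI) auto
qed (simp add: algebra_simps)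

lemma complex_ring_uminus [simp]: "\<ominus>\<^bsub>complex_ring\<^esub> a = - a"
proof -
  interpret cring complex_ring by (rule cring_complex_ring)
  show ?thesis using minus_equality[of "-a" a] by simp
qed

locale cspace = Module.module complex_ring V
  for V :: "(complex, 'a, 'm) module_scheme" (structure)
begin

lemma scale_closed [simp, intro]: "x \<in> carrier V \<Longrightarrow> c \<odot> x \<in> carrier V"
  using smult_closed[of c x] by simp

lemma scale_add_left: "x \<in> carrier V \<Longrightarrow> (a + b) \<odot> x = a \<odot> x \<oplus> b \<odot> x"
  using smult_l_distr[of a b x] by simp

lemma scale_add_right:
  "\<lbrakk>x \<in> carrier V; y \<in> carrier V\<rbrakk> \<Longrightarrow> a \<odot> (x \<oplus> y) = a \<odot> x \<oplus> a \<odot> y"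
  using smult_r_distr[of a x y] by simp

lemma scale_scale: "x \<in> carrier V \<Longrightarrow> a \<odot> (b \<odot> x) = (a * b) \<odot> x"
  using smult_assoc1[of a b x] by simp

lemma scale_one [simp]: "x \<in> carrier V \<Longrightarrow> 1 \<odot> x = x"
  using smult_one[of x] by simp

lemma scale_zero_left [simp]: "x \<in> carrier V \<Longrightarrow> 0 \<odot> x = \<zero>"
  using smult_l_null[of x] by simp

lemma scale_zero_right [simp]: "c \<odot> \<zero> = \<zero>"
  using smult_r_null[of c] by simp

lemma uminus_eq_scale: "x \<in> carrier V \<Longrightarrow> \<ominus> x = (-1) \<odot> x"
  using smult_l_minus[of 1 x] by simp

lemma minus_eq_scale: "\<lbrakk>x \<in> carrier V; y \<in> carrier V\<rbrakk> \<Longrightarrow> x \<ominus> y = x \<oplus> (-1) \<odot> y"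
  by (simp add: a_minus_def uminus_eq_scale)

lemma minus_add_cancel: "\<lbrakk>x \<in> carrier V; y \<in> carrier V\<rbrakk> \<Longrightarrow> (x \<ominus> y) \<oplus> y = x"
  by (simp add: M.minus_eq M.a_assoc M.l_neg)

lemma minus_eq_zero_iff: "\<lbrakk>x \<in> carrier V; y \<in> carrier V\<rbrakk> \<Longrightarrow> x \<ominus> y = \<zero> \<longleftrightarrow> x = y"
  using minus_add_cancel[of x y] by (auto simp: M.minus_eq M.r_neg)

lemma add_minus_add:
  "\<lbrakk>x \<in> carrier V; y \<in> carrier V; v \<in> carrier V; w \<in> carrier V\<rbrakk> \<Longrightarrow>
    (x \<oplus> y) \<ominus> (v \<oplus> w) = (x \<ominus> v) \<oplus> (y \<ominus> w)"
  by (simp add: M.minus_eq M.minus_add M.a_ac)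

lemma submodule_iff:
  "submodule W complex_ring V \<longleftrightarrow> W \<subseteq> carrier V \<and> \<zero> \<in> W \<and>
    (\<forall>x\<in>W. \<forall>y\<in>W. x \<oplus> y \<in> W) \<and> (\<forall>c. \<forall>x\<in>W. c \<odot> x \<in> W)" (is "?l \<longleftrightarrow> ?r")
proof
  assume l: ?l
  then obtain x where "x \<in> W" using submoduleE(2) by blast
  then have "0 \<odot> x \<in> W" "x \<in> carrier V" using submoduleE(4)[OF l, of 0 x] submoduleE(1)[OF l] by auto
  then have "\<zero> \<in> W" by simp
  then show ?r using submoduleE[OF l] by auto
next
  assume r: ?r
  then show ?l by (intro submoduleI) (auto simp: uminus_eq_scale subset_iff)
qed

lemma submodule_minus:
  "\<lbrakk>submodule W complex_ring V; x \<in> W; y \<in> W\<rbrakk> \<Longrightarrow> x \<ominus> y \<in> W"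
  by (auto simp: submodule_iff minus_eq_scale subset_iff)

lemma cspan_submodule:
  assumes "S \<subseteq> carrier V"
  shows "submodule (cspan V S) complex_ring V" "S \<subseteq> cspan V S" "cspan V S \<subseteq> carrier V"
proof -
  have c: "submodule (carrier V) complex_ring V" by (simp add: submodule_iff)
  then show "cspan V S \<subseteq> carrier V" using assms unfolding cspan_def by blast
  then show "submodule (cspan V S) complex_ring V"
    unfolding submodule_iff by (auto simp: cspan_def submodule_iff)
  show "S \<subseteq> cspan V S" by (auto simp: cspan_def)
qed

lemma cspan_minimal: "\<lbrakk>submodule W complex_ring V; S \<subseteq> W\<rbrakk> \<Longrightarrow> cspan V S \<subseteq> W"
  by (auto simp: cspan_def)

lemma cspan_induct [consumes 2, case_names gen zero add scale]:
  assumes x: "x \<in> cspan V S" and S: "S \<subseteq> carrier V"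
    and "\<And>x. x \<in> S \<Longrightarrow> P x" and "P \<zero>"
    and "\<And>x y. \<lbrakk>x \<in> cspan V S; y \<in> cspan V S; P x; P y\<rbrakk> \<Longrightarrow> P (x \<oplus> y)"
    and "\<And>c x. \<lbrakk>x \<in> cspan V S; P x\<rbrakk> \<Longrightarrow> P (c \<odot> x)"
  shows "P x"
proof -
  have "submodule {x \<in> cspan V S. P x} complex_ring V"
    using cspan_submodule[OF S] assms(4-6) unfolding submodule_iff by auto
  moreover have "S \<subseteq> {x \<in> cspan V S. P x}" using cspan_submodule[OF S] assms(3) by auto
  ultimately show ?thesis using cspan_minimal x by blast
qed

end

definition converges ::
    "(complex, 'a, 'm) module_scheme \<Rightarrow> ('a \<Rightarrow> real) \<Rightarrow> (nat \<Rightarrow> 'a) \<Rightarrow> 'a \<Rightarrow> bool"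
  where "converges V nm s v \<longleftrightarrow> (\<forall>n. s n \<in> carrier V) \<and> v \<in> carrier V \<and>
    (\<lambda>n. nm (s n \<ominus>\<^bsub>V\<^esub> v)) \<longlonglongrightarrow> 0"

lemma convergesD:
  assumes "converges V nm s v"
  shows "s n \<in> carrier V" "v \<in> carrier V" "(\<lambda>n. nm (s n \<ominus>\<^bsub>V\<^esub> v)) \<longlonglongrightarrow> 0"
  using assms by (auto simp: converges_def)

locale normed_cspace = cspace V
  for V :: "(complex, 'a, 'm) module_scheme" (structure) +
  fixes nm :: "'a \<Rightarrow> real"
  assumes nm_nonneg: "x \<in> carrier V \<Longrightarrow> 0 \<le> nm x"
    and nm_eq_0: "x \<in> carrier V \<Longrightarrow> nm x = 0 \<longleftrightarrow> x = \<zero>"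
    and nm_triangle: "\<lbrakk>x \<in> carrier V; y \<in> carrier V\<rbrakk> \<Longrightarrow> nm (x \<oplus> y) \<le> nm x + nm y"
    and nm_scale: "x \<in> carrier V \<Longrightarrow> nm (c \<odot> x) = cmod c * nm x"
begin

lemma nm_zero [simp]: "nm \<zero> = 0"
  by (simp add: nm_eq_0)

lemma nm_uminus: "x \<in> carrier V \<Longrightarrow> nm (\<ominus> x) = nm x"
  by (simp add: uminus_eq_scale nm_scale)

lemma nm_minus_commute: "\<lbrakk>x \<in> carrier V; y \<in> carrier V\<rbrakk> \<Longrightarrow> nm (x \<ominus> y) = nm (y \<ominus> x)"
  using nm_uminus[of "x \<ominus> y"] by (simp add: M.minus_eq M.minus_add M.a_comm)

lemma nm_minus_triangle:
  assumes "x \<in> carrier V" "y \<in> carrier V" "z \<in> carrier V"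
  shows "nm (x \<ominus> z) \<le> nm (x \<ominus> y) + nm (y \<ominus> z)"
proof -
  have "x \<ominus> z = (x \<ominus> y) \<oplus> (y \<ominus> z)" using assms by (simp add: M.minus_eq M.a_assoc M.r_neg1)
  then show ?thesis using nm_triangle[of "x \<ominus> y" "y \<ominus> z"] assms by simp
qed

lemma nm_abs_diff_le:
  assumes "x \<in> carrier V" "y \<in> carrier V"
  shows "\<bar>nm x - nm y\<bar> \<le> nm (x \<ominus> y)"
proof -
  have "x = (x \<ominus> y) \<oplus> y" "y = (y \<ominus> x) \<oplus> x" using assms by (simp_all add: minus_add_cancel)
  then have "nm x \<le> nm (x \<ominus> y) + nm y" "nm y \<le> nm (y \<ominus> x) + nm x"
    using nm_triangle[of "x \<ominus> y" y] nm_triangle[of "y \<ominus> x" x] assms by auto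
  then show ?thesis using nm_minus_commute[OF assms] by auto
qed

lemma metric: "Metric_space (carrier V) (norm_dist V nm)"
proof
  show "0 \<le> norm_dist V nm x y" for x y by (simp add: norm_dist_def nm_nonneg)
  show "norm_dist V nm x y = norm_dist V nm y x" for x y
    by (simp add: norm_dist_def nm_minus_commute)
  show "norm_dist V nm x y = 0 \<longleftrightarrow> x = y" if "x \<in> carrier V" "y \<in> carrier V" for x y
    using that by (simp add: norm_dist_def nm_eq_0 minus_eq_zero_iff)
  show "norm_dist V nm x z \<le> norm_dist V nm x y + norm_dist V nm y z"
    if "x \<in> carrier V" "y \<in> carrier V" "z \<in> carrier V" for x y z
    using that nm_minus_triangle by (simp add: norm_dist_def)
qed

lemma norm_closure_iff:
  assumes "S \<subseteq> carrier V"
  shows "x \<in> norm_closure V nm S \<longleftrightarrow> x \<in> carrier V \<and> (\<forall>e>0. \<exists>y\<in>S. nm (y \<ominus> x) < e)"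
proof -
  interpret m: Metric_space "carrier V" "norm_dist V nm" by (rule metric)
  have "y \<in> m.mball x r \<longleftrightarrow> x \<in> carrier V \<and> nm (y \<ominus> x) < r" if "y \<in> S" for x y r
    using that assms by (auto simp: norm_dist_def nm_minus_commute)
  then have "(\<exists>y\<in>S. y \<in> m.mball x r) \<longleftrightarrow> x \<in> carrier V \<and> (\<exists>y\<in>S. nm (y \<ominus> x) < r)" for r by auto
  then show ?thesis unfolding norm_closure_def m.metric_closure_of by auto
qed

lemma norm_closure_subset: "norm_closure V nm S \<subseteq> carrier V"
  unfolding norm_closure_def
  by (metis Metric_space.topspace_mtopology closure_of_subset_topspace metric)

lemma norm_closure_mono: "S \<subseteq> T \<Longrightarrow> norm_closure V nm S \<subseteq> norm_closure V nm T"
  unfolding norm_closure_def by (rule closure_of_mono)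

lemma norm_closure_increasing: "S \<subseteq> carrier V \<Longrightarrow> S \<subseteq> norm_closure V nm S"
  unfolding norm_closure_def
  by (metis Metric_space.topspace_mtopology closure_of_subset metric)

lemma norm_closure_closure: "norm_closure V nm (norm_closure V nm S) = norm_closure V nm S"
  unfolding norm_closure_def by simp

lemma norm_closure_seq:
  assumes S: "S \<subseteq> carrier V"
  shows "x \<in> norm_closure V nm S \<longleftrightarrow> (\<exists>s. (\<forall>n. s n \<in> S) \<and> converges V nm s x)"
proof
  assume "x \<in> norm_closure V nm S"
  then have x: "x \<in> carrier V" and "\<forall>e>0. \<exists>y\<in>S. nm (y \<ominus> x) < e"
    using norm_closure_iff[OF S] by auto
  then have "\<forall>n. \<exists>y\<in>S. nm (y \<ominus> x) < inverse (real (Suc n))" by simp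
  then obtain s where s: "\<And>n. s n \<in> S" "\<And>n. nm (s n \<ominus> x) < inverse (real (Suc n))" by metis
  have "(\<lambda>n. nm (s n \<ominus> x)) \<longlonglongrightarrow> 0"
  proof (rule tendsto_sandwich)
    show "\<forall>\<^sub>F n in sequentially. 0 \<le> nm (s n \<ominus> x)"
      using s S x by (intro always_eventually) (auto intro!: nm_nonneg)
    show "\<forall>\<^sub>F n in sequentially. nm (s n \<ominus> x) \<le> inverse (real (Suc n))"
      using s(2) by (intro always_eventually) (auto intro: less_imp_le)
  qed (rule tendsto_const, rule LIMSEQ_inverse_real_of_nat)
  then show "\<exists>s. (\<forall>n. s n \<in> S) \<and> converges V nm s x"
    using s S x by (intro exI[of _ s]) (auto simp: converges_def)
next
  assume "\<exists>s. (\<forall>n. s n \<in> S) \<and> converges V nm s x"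
  then obtain s where s: "\<And>n. s n \<in> S" "converges V nm s x" by blast
  have "\<exists>y\<in>S. nm (y \<ominus> x) < e" if e: "e > 0" for e
  proof -
    obtain n where "nm (s n \<ominus> x) < e"
      using order_tendstoD(2)[OF convergesD(3)[OF s(2)] e]
      by (auto simp: eventually_sequentially)
    then show ?thesis using s by blast
  qed
  then show "x \<in> norm_closure V nm S" using convergesD(2)[OF s(2)] by (simp add: norm_closure_iff[OF S])
qed

lemma convergesI:
  assumes "\<And>n. s n \<in> carrier V" "v \<in> carrier V" "\<And>n. nm (s n \<ominus> v) \<le> r n" "r \<longlonglongrightarrow> 0"
  shows "converges V nm s v"
  unfolding converges_def
proof (intro conjI allI)
  show "(\<lambda>n. nm (s n \<ominus> v)) \<longlonglongrightarrow> 0"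
    by (rule tendsto_sandwich[OF _ _ tendsto_const assms(4)])
      (use assms in \<open>auto intro!: always_eventually nm_nonneg\<close>)
qed (use assms in auto)

lemma converges_const: "v \<in> carrier V \<Longrightarrow> converges V nm (\<lambda>_. v) v"
  by (simp add: converges_def minus_eq_zero_iff nm_eq_0 a_minus_def M.r_neg)

lemma converges_unique:
  assumes s: "converges V nm s v" and t: "converges V nm s w"
  shows "v = w"
proof -
  note [simp] = convergesD(1,2)[OF s] convergesD(1,2)[OF t]
  have "(\<lambda>n. nm (s n \<ominus> v) + nm (s n \<ominus> w)) \<longlonglongrightarrow> 0 + 0"
    by (intro tendsto_add convergesD(3)[OF s] convergesD(3)[OF t])
  moreover have "nm (v \<ominus> w) \<le> nm (s n \<ominus> v) + nm (s n \<ominus> w)" for n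
    using nm_minus_triangle[of v "s n" w] nm_minus_commute[of v "s n"] by simp
  ultimately have "nm (v \<ominus> w) \<le> 0" by (intro LIMSEQ_le_const[of _ 0]) auto
  then have "nm (v \<ominus> w) = 0" by (intro antisym nm_nonneg) auto
  then show ?thesis by (simp add: nm_eq_0 minus_eq_zero_iff)
qed

lemma converges_add:
  assumes s: "converges V nm s v" and t: "converges V nm t w"
  shows "converges V nm (\<lambda>n. s n \<oplus> t n) (v \<oplus> w)"
proof (rule convergesI)
  note [simp] = convergesD(1,2)[OF s] convergesD(1,2)[OF t]
  show "s n \<oplus> t n \<in> carrier V" "v \<oplus> w \<in> carrier V" for n by auto
  show "nm ((s n \<oplus> t n) \<ominus> (v \<oplus> w)) \<le> nm (s n \<ominus> v) + nm (t n \<ominus> w)" for n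
    by (simp add: nm_triangle add_minus_add)
  show "(\<lambda>n. nm (s n \<ominus> v) + nm (t n \<ominus> w)) \<longlonglongrightarrow> 0"
    using tendsto_add[OF convergesD(3)[OF s] convergesD(3)[OF t]] by simp
qed

lemma scale_minus: "\<lbrakk>x \<in> carrier V; y \<in> carrier V\<rbrakk> \<Longrightarrow> c \<odot> (x \<ominus> y) = c \<odot> x \<ominus> c \<odot> y"
  by (simp add: minus_eq_scale scale_add_right scale_scale)

lemma converges_scale:
  assumes s: "converges V nm s v"
  shows "converges V nm (\<lambda>n. c \<odot> s n) (c \<odot> v)"
proof (rule convergesI)
  note [simp] = convergesD(1,2)[OF s]
  show "c \<odot> s n \<in> carrier V" "c \<odot> v \<in> carrier V" for n by auto
  show "nm (c \<odot> s n \<ominus> c \<odot> v) \<le> cmod c * nm (s n \<ominus> v)" for n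
    by (simp add: scale_minus[symmetric] nm_scale)
  show "(\<lambda>n. cmod c * nm (s n \<ominus> v)) \<longlonglongrightarrow> 0"
    using tendsto_mult_right_zero[OF convergesD(3)[OF s]] by simp
qed

lemma converges_nm:
  assumes s: "converges V nm s v"
  shows "(\<lambda>n. nm (s n)) \<longlonglongrightarrow> nm v"
proof -
  have "(\<lambda>n. nm (s n) - nm v) \<longlonglongrightarrow> 0"
    by (rule Lim_null_comparison[OF _ convergesD(3)[OF s]])
      (use nm_abs_diff_le convergesD(1,2)[OF s] in auto)
  then show ?thesis by (simp add: LIM_zero_iff)
qed

lemma converges_Cauchy:
  assumes s: "converges V nm s v" and "e > 0"
  shows "\<exists>N. \<forall>m\<ge>N. \<forall>n\<ge>N. nm (s m \<ominus> s n) < e"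
proof -
  note [simp] = convergesD(1,2)[OF s]
  have "\<forall>\<^sub>F n in sequentially. nm (s n \<ominus> v) < e/2"
    using order_tendstoD(2)[OF convergesD(3)[OF s], of "e/2"] \<open>e > 0\<close> by simp
  then obtain N where N: "\<And>n. n \<ge> N \<Longrightarrow> nm (s n \<ominus> v) < e/2"
    by (auto simp: eventually_sequentially)
  have "nm (s m \<ominus> s n) < e" if "m \<ge> N" "n \<ge> N" for m n
    using nm_minus_triangle[of "s m" v "s n"] nm_minus_commute[of v "s n"] N[OF that(1)] N[OF that(2)]
    by simp
  then show ?thesis by blast
qed

lemma norm_complete_iff:
  "norm_complete V nm \<longleftrightarrow> (\<forall>s. (\<forall>n. s n \<in> carrier V) \<and>
    (\<forall>e>0. \<exists>N. \<forall>m\<ge>N. \<forall>n\<ge>N. nm (s m \<ominus> s n) < e) \<longrightarrow> (\<exists>v. converges V nm s v))"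
proof -
  interpret m: Metric_space "carrier V" "norm_dist V nm" by (rule metric)
  have C: "m.MCauchy s \<longleftrightarrow> (\<forall>n. s n \<in> carrier V) \<and>
    (\<forall>e>0. \<exists>N. \<forall>m\<ge>N. \<forall>n\<ge>N. nm (s m \<ominus> s n) < e)" for s
  proof (cases "\<forall>n. s n \<in> carrier V")
    case True
    then have "norm_dist V nm (s m) (s n) = nm (s m \<ominus> s n)" for m n by (simp add: norm_dist_def)
    with True show ?thesis unfolding m.MCauchy_def by (simp add: image_subset_iff)
  qed (auto simp: m.MCauchy_def)
  have L: "limitin m.mtopology s v sequentially \<longleftrightarrow> converges V nm s v" if "\<forall>n. s n \<in> carrier V" for s v
    using that unfolding m.limitin_metric_dist_null converges_def by (auto simp: norm_dist_def)
  show ?thesis unfolding norm_complete_def m.mcomplete_def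
    by (intro all_cong1) (auto simp: C L)
qed

lemma submodule_norm_closure:
  assumes W: "submodule W complex_ring V"
  shows "submodule (norm_closure V nm W) complex_ring V"
proof -
  have Wc: "W \<subseteq> carrier V" using W by (simp add: submodule_iff)
  note seq = norm_closure_seq[OF Wc]
  show ?thesis
    unfolding submodule_iff
  proof (intro conjI ballI allI)
    show "norm_closure V nm W \<subseteq> carrier V" by (rule norm_closure_subset)
    show "\<zero> \<in> norm_closure V nm W" using norm_closure_increasing[OF Wc] W by (auto simp: submodule_iff)
    fix x assume "x \<in> norm_closure V nm W"
    then obtain s where s: "\<And>n. s n \<in> W" "converges V nm s x" using seq by blast
    show "c \<odot> x \<in> norm_closure V nm W" for c
      unfolding seq using converges_scale[OF s(2)] s(1) W
      by (intro exI[of _ "\<lambda>n. c \<odot> s n"]) (auto simp: submodule_iff)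
    fix y assume "y \<in> norm_closure V nm W"
    then obtain t where t: "\<And>n. t n \<in> W" "converges V nm t y" using seq by blast
    show "x \<oplus> y \<in> norm_closure V nm W"
      unfolding seq using converges_add[OF s(2) t(2)] s(1) t(1) W
      by (intro exI[of _ "\<lambda>n. s n \<oplus> t n"]) (auto simp: submodule_iff)
  qed
qed

end

text \<open>
  The bound belongs to the predicate because extension to the closure must keep it: a contractive
  map has a contractive extension.
\<close>

definition bounded_linear_on :: "(complex, 'a, 'm) module_scheme \<Rightarrow> ('a \<Rightarrow> real) \<Rightarrow>
    (complex, 'b, 'n) module_scheme \<Rightarrow> ('b \<Rightarrow> real) \<Rightarrow> 'a set \<Rightarrow> real \<Rightarrow> ('a \<Rightarrow> 'b) \<Rightarrow> bool"
  where "bounded_linear_on V nm X nx S K T \<longleftrightarrow> T \<in> S \<rightarrow> carrier X \<and> 0 \<le> K \<and>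
    (\<forall>x\<in>S. \<forall>y\<in>S. T (x \<oplus>\<^bsub>V\<^esub> y) = T x \<oplus>\<^bsub>X\<^esub> T y) \<and>
    (\<forall>c. \<forall>x\<in>S. T (c \<odot>\<^bsub>V\<^esub> x) = c \<odot>\<^bsub>X\<^esub> T x) \<and>
    (\<forall>x\<in>S. nx (T x) \<le> K * nm x)"

lemma bounded_linear_on_minus:
  assumes "normed_cspace V nm" "normed_cspace X nx" "submodule S complex_ring V"
    and T: "bounded_linear_on V nm X nx S K T" and x: "x \<in> S" "y \<in> S"
  shows "T (x \<ominus>\<^bsub>V\<^esub> y) = T x \<ominus>\<^bsub>X\<^esub> T y"
proof -
  interpret V: normed_cspace V nm by fact
  interpret X: normed_cspace X nx by fact
  have "x \<in> carrier V" "y \<in> carrier V" "(-1) \<odot>\<^bsub>V\<^esub> y \<in> S" "T x \<in> carrier X" "T y \<in> carrier X"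
    using assms(3) x T by (auto simp: V.submodule_iff bounded_linear_on_def)
  then show ?thesis using T x by (simp add: V.minus_eq_scale X.minus_eq_scale bounded_linear_on_def)
qed

lemma converges_bounded_linear_on:
  assumes V: "normed_cspace V nm" and X: "normed_cspace X nx" and S: "submodule S complex_ring V"
    and T: "bounded_linear_on V nm X nx S K T"
    and s: "\<And>n. s n \<in> S" "v \<in> S" "converges V nm s v"
  shows "converges X nx (\<lambda>n. T (s n)) (T v)"
proof -
  interpret V: normed_cspace V nm by fact
  interpret X: normed_cspace X nx by fact
  show ?thesis
  proof (rule X.convergesI)
    show "T (s n) \<in> carrier X" "T v \<in> carrier X" for n using T s by (auto simp: bounded_linear_on_def)
    show "nx (T (s n) \<ominus>\<^bsub>X\<^esub> T v) \<le> K * nm (s n \<ominus>\<^bsub>V\<^esub> v)" for n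
      using T s V.submodule_minus[OF S s(1,2)]
      by (simp add: bounded_linear_on_minus[OF V X S T, symmetric]) (simp add: bounded_linear_on_def)
    show "(\<lambda>n. K * nm (s n \<ominus>\<^bsub>V\<^esub> v)) \<longlonglongrightarrow> 0"
      using tendsto_mult_right_zero[OF convergesD(3)[OF s(3)]] by simp
  qed
qed

text \<open>
  Because of the bound, images of a convergent sequence form a Cauchy sequence, and two
  sequences with the same limit have images with the same limit.
\<close>

lemma bounded_linear_on_extend:
  assumes V: "normed_cspace V nm" and X: "normed_cspace X nx" and complete: "norm_complete X nx"
    and S: "submodule S complex_ring V" and T: "bounded_linear_on V nm X nx S K T"
  shows "\<exists>T'. bounded_linear_on V nm X nx (norm_closure V nm S) K T' \<and> (\<forall>x\<in>S. T' x = T x)"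
proof -
  interpret V: normed_cspace V nm by fact
  interpret X: normed_cspace X nx by fact
  have Sc: "S \<subseteq> carrier V" and S0: "\<And>x y. x \<in> S \<Longrightarrow> y \<in> S \<Longrightarrow> x \<oplus>\<^bsub>V\<^esub> y \<in> S"
    "\<And>c x. x \<in> S \<Longrightarrow> c \<odot>\<^bsub>V\<^esub> x \<in> S"
    using S by (auto simp: V.submodule_iff)
  have Tc: "T x \<in> carrier X" if "x \<in> S" for x using T that by (auto simp: bounded_linear_on_def)
  have Tadd: "T (x \<oplus>\<^bsub>V\<^esub> y) = T x \<oplus>\<^bsub>X\<^esub> T y" if "x \<in> S" "y \<in> S" for x y
    using T that by (simp add: bounded_linear_on_def)
  have Tscale: "T (c \<odot>\<^bsub>V\<^esub> x) = c \<odot>\<^bsub>X\<^esub> T x" if "x \<in> S" for c x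
    using T that by (simp add: bounded_linear_on_def)
  have K: "0 \<le> K" and Tnm: "nx (T x) \<le> K * nm x" if "x \<in> S" for x
    using T that by (auto simp: bounded_linear_on_def)
  note Tminus = bounded_linear_on_minus[OF V X S T, symmetric]
  have lim: "\<exists>w. converges X nx (\<lambda>n. T (s n)) w" if s: "\<And>n. s n \<in> S" "converges V nm s v" for s v
  proof -
    have "\<exists>N. \<forall>m\<ge>N. \<forall>n\<ge>N. nx (T (s m) \<ominus>\<^bsub>X\<^esub> T (s n)) < e" if "e > 0" for e
    proof -
      have K1: "K + 1 > 0" "e / (K + 1) > 0" using T \<open>e > 0\<close> by (auto simp: bounded_linear_on_def)
      obtain N where N: "\<forall>m\<ge>N. \<forall>n\<ge>N. nm (s m \<ominus>\<^bsub>V\<^esub> s n) < e / (K + 1)"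
        using V.converges_Cauchy[OF s(2) K1(2)] by blast
      have "nx (T (s m) \<ominus>\<^bsub>X\<^esub> T (s n)) < e" if "m \<ge> N" "n \<ge> N" for m n
      proof -
        have d: "s m \<ominus>\<^bsub>V\<^esub> s n \<in> S" using V.submodule_minus[OF S s(1) s(1)] .
        then have "0 \<le> nm (s m \<ominus>\<^bsub>V\<^esub> s n)" using Sc V.nm_nonneg by blast
        then have "K * nm (s m \<ominus>\<^bsub>V\<^esub> s n) \<le> (K + 1) * nm (s m \<ominus>\<^bsub>V\<^esub> s n)" by (simp add: mult_right_mono)
        also have "\<dots> < e" using N that K1 by (simp add: pos_less_divide_eq mult.commute)
        finally show ?thesis using Tnm[OF d] by (simp add: Tminus[OF s(1) s(1)])
      qed
      then show ?thesis by blast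
    qed
    moreover have "\<forall>n. T (s n) \<in> carrier X" using s(1) Tc by blast
    ultimately show ?thesis using complete[unfolded X.norm_complete_iff, rule_format, of "\<lambda>n. T (s n)"] by simp
  qed
  define T' where "T' v = (SOME w. \<exists>s. (\<forall>n. s n \<in> S) \<and> converges V nm s v \<and> converges X nx (\<lambda>n. T (s n)) w)" for v
  have T'1: "\<exists>s. (\<forall>n. s n \<in> S) \<and> converges V nm s v \<and> converges X nx (\<lambda>n. T (s n)) (T' v)"
    if "v \<in> norm_closure V nm S" for v
    unfolding T'_def by (rule someI_ex) (use that V.norm_closure_seq[OF Sc] lim in blast)
  have T'2: "T' v = w"
    if s: "\<forall>n. s n \<in> S" "converges V nm s v" "converges X nx (\<lambda>n. T (s n)) w" for s v w
  proof -
    have "v \<in> norm_closure V nm S" using V.norm_closure_seq[OF Sc] s by blast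
    then obtain t where t: "\<forall>n. t n \<in> S" "converges V nm t v" "converges X nx (\<lambda>n. T (t n)) (T' v)"
      using T'1 by blast
    have "converges X nx (\<lambda>n. T (s n) \<oplus>\<^bsub>X\<^esub> (-1) \<odot>\<^bsub>X\<^esub> T (t n)) (w \<oplus>\<^bsub>X\<^esub> (-1) \<odot>\<^bsub>X\<^esub> T' v)"
      by (intro X.converges_add X.converges_scale s(3) t(3))
    moreover have "converges X nx (\<lambda>n. T (s n \<oplus>\<^bsub>V\<^esub> (-1) \<odot>\<^bsub>V\<^esub> t n)) (T \<zero>\<^bsub>V\<^esub>)"
    proof (rule converges_bounded_linear_on[OF V X S T])
      have v: "v \<in> carrier V" using convergesD(2)[OF s(2)] .
      have "converges V nm (\<lambda>n. s n \<oplus>\<^bsub>V\<^esub> (-1) \<odot>\<^bsub>V\<^esub> t n) (v \<oplus>\<^bsub>V\<^esub> (-1) \<odot>\<^bsub>V\<^esub> v)"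
        by (intro V.converges_add V.converges_scale s t)
      then show "converges V nm (\<lambda>n. s n \<oplus>\<^bsub>V\<^esub> (-1) \<odot>\<^bsub>V\<^esub> t n) \<zero>\<^bsub>V\<^esub>"
        using v by (simp add: V.minus_eq_scale[symmetric] a_minus_def V.M.r_neg)
    qed (use s t S in \<open>auto simp: S0 V.submodule_iff\<close>)
    moreover have "T (s n \<oplus>\<^bsub>V\<^esub> (-1) \<odot>\<^bsub>V\<^esub> t n) = T (s n) \<oplus>\<^bsub>X\<^esub> (-1) \<odot>\<^bsub>X\<^esub> T (t n)" for n
      using s t by (simp add: Tadd Tscale S0)
    moreover have "T \<zero>\<^bsub>V\<^esub> = \<zero>\<^bsub>X\<^esub>"
    proof -
      have z: "\<zero>\<^bsub>V\<^esub> \<in> S" using S by (simp add: V.submodule_iff)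
      then show ?thesis using Tscale[OF z, of 0] Tc[OF z] by simp
    qed
    ultimately have "w \<oplus>\<^bsub>X\<^esub> (-1) \<odot>\<^bsub>X\<^esub> T' v = \<zero>\<^bsub>X\<^esub>" by (intro X.converges_unique) simp_all
    then show ?thesis using convergesD(2)[OF s(3)] convergesD(2)[OF t(3)]
      by (simp add: X.minus_eq_scale[symmetric] X.minus_eq_zero_iff)
  qed
  have "bounded_linear_on V nm X nx (norm_closure V nm S) K T'"
    unfolding bounded_linear_on_def
  proof (intro conjI ballI allI funcsetI)
    show "0 \<le> K" using T by (simp add: bounded_linear_on_def)
    fix x assume "x \<in> norm_closure V nm S"
    then obtain s where s: "\<forall>n. s n \<in> S" "converges V nm s x" "converges X nx (\<lambda>n. T (s n)) (T' x)"
      using T'1 by blast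
    show "T' x \<in> carrier X" using convergesD(2)[OF s(3)] .
    show "nx (T' x) \<le> K * nm x"
      by (rule LIMSEQ_le[OF X.converges_nm[OF s(3)] tendsto_mult_left[OF V.converges_nm[OF s(2)]]])
        (use s(1) Tnm in blast)
    show "T' (c \<odot>\<^bsub>V\<^esub> x) = c \<odot>\<^bsub>X\<^esub> T' x" for c
      by (rule T'2[of "\<lambda>n. c \<odot>\<^bsub>V\<^esub> s n"])
        (use s V.converges_scale X.converges_scale in \<open>auto simp: S0 Tscale\<close>)
    fix y assume "y \<in> norm_closure V nm S"
    then obtain t where t: "\<forall>n. t n \<in> S" "converges V nm t y" "converges X nx (\<lambda>n. T (t n)) (T' y)"
      using T'1 by blast
    show "T' (x \<oplus>\<^bsub>V\<^esub> y) = T' x \<oplus>\<^bsub>X\<^esub> T' y"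
      by (rule T'2[of "\<lambda>n. s n \<oplus>\<^bsub>V\<^esub> t n"])
        (use s t V.converges_add X.converges_add in \<open>auto simp: S0 Tadd\<close>)
  qed
  moreover have "T' x = T x" if "x \<in> S" for x
    by (rule T'2[of "\<lambda>_. x"]) (use that Sc Tc in \<open>auto intro!: V.converges_const X.converges_const\<close>)
  ultimately show ?thesis by blast
qed

section \<open>Hilbert spaces\<close>

context hilbert_space
begin

sublocale cspace X ..

abbreviation len :: "'x \<Rightarrow> real" where "len \<equiv> ip_norm X"

lemma ip_add_right:
  assumes "x \<in> carrier X" "y \<in> carrier X" "z \<in> carrier X"
  shows "ip X x (y \<oplus> z) = ip X x y + ip X x z"
proof -
  have "ip X x (y \<oplus> z) = cnj (ip X (y \<oplus> z) x)" using assms by (intro ip_cnj) auto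
  also have "\<dots> = ip X x y + ip X x z" using assms by (simp add: ip_add ip_cnj[of _ x])
  finally show ?thesis .
qed

lemma ip_scale_right:
  assumes "x \<in> carrier X" "y \<in> carrier X"
  shows "ip X x (c \<odot> y) = cnj c * ip X x y"
proof -
  have "ip X x (c \<odot> y) = cnj (ip X (c \<odot> y) x)" using assms by (intro ip_cnj) auto
  also have "\<dots> = cnj c * ip X x y" using assms by (simp add: ip_smult ip_cnj[of y x])
  finally show ?thesis .
qed

lemma ip_zero_left [simp]: "y \<in> carrier X \<Longrightarrow> ip X \<zero> y = 0"
  using ip_smult[of \<zero> y 0] by simp

lemma ip_zero_right [simp]: "x \<in> carrier X \<Longrightarrow> ip X x \<zero> = 0"
  using ip_scale_right[of x \<zero> 0] by simp

lemma ip_minus_left: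
  "\<lbrakk>x \<in> carrier X; y \<in> carrier X; z \<in> carrier X\<rbrakk> \<Longrightarrow> ip X (x \<ominus> y) z = ip X x z - ip X y z"
  by (simp add: minus_eq_scale ip_add ip_smult)

lemma Re_ip_nonneg: "x \<in> carrier X \<Longrightarrow> 0 \<le> Re (ip X x x)"
  using ip_pos[of x] by (cases "x = \<zero>") auto

lemma ip_self: "x \<in> carrier X \<Longrightarrow> ip X x x = of_real ((len x)\<^sup>2)"
  using ip_cnj[of x x] Re_ip_nonneg[of x] by (simp add: complex_eq_iff ip_norm_def)

lemma len_sq: "x \<in> carrier X \<Longrightarrow> (len x)\<^sup>2 = Re (ip X x x)"
  by (simp add: ip_self)

lemma len_nonneg: "x \<in> carrier X \<Longrightarrow> 0 \<le> len x"
  by (simp add: ip_norm_def Re_ip_nonneg)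

lemma len_add_sq:
  assumes "x \<in> carrier X" "y \<in> carrier X"
  shows "(len (x \<oplus> y))\<^sup>2 = (len x)\<^sup>2 + 2 * Re (ip X x y) + (len y)\<^sup>2"
  using assms ip_cnj[of x y] by (simp add: len_sq ip_add ip_add_right)

lemma len_scale_sq: "x \<in> carrier X \<Longrightarrow> (len (c \<odot> x))\<^sup>2 = (cmod c)\<^sup>2 * (len x)\<^sup>2"
proof -
  assume x: "x \<in> carrier X"
  have c: "c * cnj c = of_real ((cmod c)\<^sup>2)" by (rule complex_norm_square[symmetric])
  have "ip X (c \<odot> x) (c \<odot> x) = (c * cnj c) * ip X x x"
    using x by (simp add: ip_smult ip_scale_right)
  also have "\<dots> = of_real ((cmod c)\<^sup>2 * (len x)\<^sup>2)" unfolding c ip_self[OF x] of_real_mult ..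
  finally have "Re (ip X (c \<odot> x) (c \<odot> x)) = (cmod c)\<^sup>2 * (len x)\<^sup>2" by (simp only: Re_complex_of_real)
  then show ?thesis using x by (simp add: len_sq)
qed

lemma len_scale: "x \<in> carrier X \<Longrightarrow> len (c \<odot> x) = cmod c * len x"
  using len_scale_sq[of x c] len_nonneg[of x] len_nonneg[of "c \<odot> x"]
  by (metis mult_nonneg_nonneg norm_ge_zero power2_eq_iff_nonneg power_mult_distrib scale_closed)

lemma len_add_scale_sq:
  assumes "x \<in> carrier X" "y \<in> carrier X"
  shows "(len (x \<oplus> c \<odot> y))\<^sup>2 = (len x)\<^sup>2 + 2 * Re (cnj c * ip X x y) + (cmod c)\<^sup>2 * (len y)\<^sup>2"
  using assms by (simp add: len_add_sq ip_scale_right len_scale_sq)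

lemma len_eq_0: "x \<in> carrier X \<Longrightarrow> len x = 0 \<longleftrightarrow> x = \<zero>"
  using ip_pos[of x] by (cases "x = \<zero>") (auto simp: ip_norm_def)

lemma Cauchy_Schwarz:
  assumes "x \<in> carrier X" "y \<in> carrier X"
  shows "cmod (ip X x y) \<le> len x * len y"
proof (cases "y = \<zero>")
  case True
  then have "len y = 0" using assms by (simp add: len_eq_0)
  then show ?thesis using assms True by simp
next
  case False
  define q where "q = (len y)\<^sup>2"
  have q: "q > 0" using False assms len_eq_0 by (simp add: q_def)
  define c where "c = - (ip X x y / of_real q)"
  have c2: "(cmod c)\<^sup>2 = (cmod (ip X x y))\<^sup>2 / q\<^sup>2"
    using q by (simp add: c_def norm_divide power_divide)
  have cR: "Re (cnj c * ip X x y) = - ((cmod (ip X x y))\<^sup>2 / q)"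
    using q unfolding cmod_power2 by (simp add: c_def power2_eq_square add_divide_distrib)
  have "0 \<le> (len x)\<^sup>2 + 2 * Re (cnj c * ip X x y) + (cmod c)\<^sup>2 * q"
    using len_add_scale_sq[OF assms, of c] q_def by (metis zero_le_power2)
  then have "0 \<le> (len x)\<^sup>2 - (cmod (ip X x y))\<^sup>2 / q"
    using q unfolding c2 cR by (simp add: field_simps power2_eq_square)
  then have "(cmod (ip X x y))\<^sup>2 \<le> (len x * len y)\<^sup>2"
    using q by (simp add: field_simps power_mult_distrib q_def)
  then show ?thesis using assms by (simp add: abs_le_square_iff[symmetric] len_nonneg)
qed

sublocale normed_cspace X "ip_norm X"
proof
  fix x y assume x: "x \<in> carrier X" and y: "y \<in> carrier X"
  have "Re (ip X x y) \<le> len x * len y"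
    using Cauchy_Schwarz[OF x y] complex_Re_le_cmod order_trans by blast
  then have "(len (x \<oplus> y))\<^sup>2 \<le> (len x + len y)\<^sup>2"
    using x y by (simp add: len_add_sq power2_sum)
  then show "len (x \<oplus> y) \<le> len x + len y"
    by (rule power2_le_imp_le) (simp add: x y len_nonneg)
qed (simp_all add: len_nonneg len_eq_0 len_scale)

lemma ip_eqI:
  assumes "x \<in> carrier X" "y \<in> carrier X" "\<And>z. z \<in> carrier X \<Longrightarrow> ip X x z = ip X y z"
  shows "x = y"
proof -
  have "ip X (x \<ominus> y) (x \<ominus> y) = 0" using assms by (simp add: ip_minus_left)
  then have "len (x \<ominus> y) = 0" by (simp add: ip_norm_def)
  then show ?thesis using assms by (simp add: len_eq_0 minus_eq_zero_iff)
qed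

lemma converges_ip_left:
  assumes s: "converges X len s v" and y: "y \<in> carrier X"
  shows "(\<lambda>n. ip X (s n) y) \<longlonglongrightarrow> ip X v y"
proof -
  note sv = convergesD[OF s]
  have "(\<lambda>n. ip X (s n) y - ip X v y) \<longlonglongrightarrow> 0"
  proof (rule Lim_null_comparison)
    show "\<forall>\<^sub>F n in sequentially. norm (ip X (s n) y - ip X v y) \<le> len (s n \<ominus> v) * len y"
      using Cauchy_Schwarz[of "s _ \<ominus> v" y] sv(1,2) y
      by (intro always_eventually allI) (simp add: ip_minus_left)
    show "(\<lambda>n. len (s n \<ominus> v) * len y) \<longlonglongrightarrow> 0"
      using tendsto_mult_left_zero[OF sv(3)] by simp
  qed
  then show ?thesis by (simp add: LIM_zero_iff)
qed

lemma converges_ip_right: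
  assumes s: "converges X len s v" and y: "y \<in> carrier X"
  shows "(\<lambda>n. ip X y (s n)) \<longlonglongrightarrow> ip X y v"
proof -
  have "(\<lambda>n. cnj (ip X (s n) y)) \<longlonglongrightarrow> cnj (ip X v y)"
    by (intro tendsto_cnj converges_ip_left[OF s y])
  moreover have "cnj (ip X (s n) y) = ip X y (s n)" "cnj (ip X v y) = ip X y v" for n
    using convergesD(1,2)[OF s] y by (simp_all add: ip_cnj[symmetric])
  ultimately show ?thesis by simp
qed

text \<open>
  If \<open>f\<close> is the inner product with \<open>v\<close>, then \<open>J(x) = \<parallel>x - v\<parallel>\<^sup>2 - \<parallel>v\<parallel>\<^sup>2\<close>, so \<open>v\<close> is to be found as a
  minimiser of \<open>J\<close>. By the parallelogram law, \<open>\<parallel>x - y\<parallel>\<^sup>2 = 2 J(x) + 2 J(y) - 4 J((x + y) / 2)\<close>, and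
  therefore a minimising sequence is Cauchy.
\<close>

lemma riesz_minimiser:
  assumes f_add: "\<And>x y. \<lbrakk>x \<in> carrier X; y \<in> carrier X\<rbrakk> \<Longrightarrow> f (x \<oplus> y) = f x + f y"
    and f_scale: "\<And>c x. x \<in> carrier X \<Longrightarrow> f (c \<odot> x) = c * f x"
    and f_bound: "\<And>x. x \<in> carrier X \<Longrightarrow> cmod (f x) \<le> K * len x"
  defines "J \<equiv> \<lambda>x. (len x)\<^sup>2 - 2 * Re (f x)"
  shows "\<exists>x\<in>carrier X. \<forall>y\<in>carrier X. J x \<le> J y"
proof -
  have J_lower: "- K\<^sup>2 \<le> J x" if "x \<in> carrier X" for x
  proof -
    have "Re (f x) \<le> K * len x" using f_bound[OF that] complex_Re_le_cmod order_trans by blast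
    moreover have "0 \<le> (len x - K)\<^sup>2" by simp
    ultimately show ?thesis by (simp add: J_def power2_diff mult.commute)
  qed
  define m where "m = (INF x\<in>carrier X. J x)"
  have bdd: "bdd_below (J ` carrier X)" using J_lower by (rule bdd_belowI2)
  have m: "m \<le> J x" if "x \<in> carrier X" for x unfolding m_def using bdd that by (rule cINF_lower)
  have "\<exists>x\<in>carrier X. J x < m + inverse (real (Suc n))" for n
  proof -
    have "carrier X \<noteq> {}" by auto
    moreover have "(INF x\<in>carrier X. J x) < m + inverse (real (Suc n))" by (simp add: m_def)
    ultimately show ?thesis using cINF_less_iff[OF _ bdd] by blast
  qed
  then obtain s where s: "\<And>n. s n \<in> carrier X" "\<And>n. J (s n) < m + inverse (real (Suc n))" by metis
  have para: "(len (x \<ominus> y))\<^sup>2 = 2 * J x + 2 * J y - 4 * J ((1/2) \<odot> (x \<oplus> y))"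
    if "x \<in> carrier X" "y \<in> carrier X" for x y
  proof -
    have "(len (x \<ominus> y))\<^sup>2 = (len x)\<^sup>2 - 2 * Re (ip X x y) + (len y)\<^sup>2"
      using len_add_scale_sq[OF that, of "-1"] that by (simp add: minus_eq_scale)
    moreover have "(len ((1/2) \<odot> (x \<oplus> y)))\<^sup>2 = (1/4) * ((len x)\<^sup>2 + 2 * Re (ip X x y) + (len y)\<^sup>2)"
      using that by (simp add: len_scale_sq len_add_sq power_divide norm_divide)
    moreover have "Re (f ((1/2) \<odot> (x \<oplus> y))) = (1/2) * (Re (f x) + Re (f y))"
      using that by (simp add: f_scale f_add)
    ultimately show ?thesis by (simp add: J_def)
  qed
  have close: "(len (s a \<ominus> s b))\<^sup>2 \<le> 2 * inverse (real (Suc a)) + 2 * inverse (real (Suc b))" for a b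
    using para[OF s(1) s(1), of a b] s(2)[of a] s(2)[of b] m[of "(1/2) \<odot> (s a \<oplus> s b)"] s(1) by simp
  have "\<exists>N. \<forall>a\<ge>N. \<forall>b\<ge>N. len (s a \<ominus> s b) < e" if e: "e > 0" for e
  proof -
    obtain N where N: "inverse (real (Suc N)) < e\<^sup>2 / 4" using reals_Archimedean[of "e\<^sup>2/4"] e by auto
    have "len (s a \<ominus> s b) < e" if "a \<ge> N" "b \<ge> N" for a b
    proof -
      have "inverse (real (Suc a)) \<le> inverse (real (Suc N))" "inverse (real (Suc b)) \<le> inverse (real (Suc N))"
        using that by (auto intro!: le_imp_inverse_le)
      then have "(len (s a \<ominus> s b))\<^sup>2 < e\<^sup>2" using close[of a b] N by linarith
      then show ?thesis using e by (simp add: power2_less_imp_less)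
    qed
    then show ?thesis by blast
  qed
  then obtain v where v: "converges X len s v"
    using complete[unfolded norm_complete_iff, rule_format, of s] s(1) by auto
  note vc = convergesD(1,2)[OF v]
  have f_minus: "f (x \<ominus> y) = f x - f y" if "x \<in> carrier X" "y \<in> carrier X" for x y
    using that by (simp add: minus_eq_scale f_add f_scale)
  have "(\<lambda>n. f (s n) - f v) \<longlonglongrightarrow> 0"
  proof (rule Lim_null_comparison)
    show "\<forall>\<^sub>F n in sequentially. norm (f (s n) - f v) \<le> K * len (s n \<ominus> v)"
      using f_bound[of "s _ \<ominus> v"] vc by (intro always_eventually allI) (simp add: f_minus)
    show "(\<lambda>n. K * len (s n \<ominus> v)) \<longlonglongrightarrow> 0"
      using tendsto_mult_right_zero[OF convergesD(3)[OF v]] by simp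
  qed
  then have "(\<lambda>n. f (s n)) \<longlonglongrightarrow> f v" by (simp add: LIM_zero_iff)
  then have "(\<lambda>n. J (s n)) \<longlonglongrightarrow> J v"
    unfolding J_def by (intro tendsto_intros converges_nm[OF v]) auto
  moreover have "(\<lambda>n. m + inverse (real (Suc n))) \<longlonglongrightarrow> m"
    using tendsto_add[OF tendsto_const LIMSEQ_inverse_real_of_nat, of m] by simp
  ultimately have "J v \<le> m"
    by (rule LIMSEQ_le) (use s(2) less_imp_le in blast)
  then show ?thesis using m vc by (meson order_trans)
qed

text \<open>
  The first variation of \<open>J\<close> at a minimiser vanishes in every direction.
\<close>

lemma riesz_representation:
  assumes f_add: "\<And>x y. \<lbrakk>x \<in> carrier X; y \<in> carrier X\<rbrakk> \<Longrightarrow> f (x \<oplus> y) = f x + f y"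
    and f_scale: "\<And>c x. x \<in> carrier X \<Longrightarrow> f (c \<odot> x) = c * f x"
    and f_bound: "\<And>x. x \<in> carrier X \<Longrightarrow> cmod (f x) \<le> K * len x"
  shows "\<exists>v\<in>carrier X. \<forall>x\<in>carrier X. f x = ip X x v"
proof -
  obtain v where v: "v \<in> carrier X"
    and min: "\<And>y. y \<in> carrier X \<Longrightarrow> (len v)\<^sup>2 - 2 * Re (f v) \<le> (len y)\<^sup>2 - 2 * Re (f y)"
    using riesz_minimiser[of f K, OF f_add f_scale f_bound] by auto
  have "f x = ip X x v" if x: "x \<in> carrier X" for x
  proof (rule ccontr)
    assume ne: "f x \<noteq> ip X x v"
    define d where "d = ip X x v - f x"
    define q where "q = (len x)\<^sup>2"
    have d: "(cmod d)\<^sup>2 > 0" using ne by (simp add: d_def)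
    have q: "0 \<le> q" by (simp add: q_def)
    have var: "0 \<le> 2 * Re (t * d) + (cmod t)\<^sup>2 * q" for t
    proof -
      have "Re (cnj t * ip X v x) = Re (t * ip X x v)"
        using ip_cnj[OF v x] by simp
      then show ?thesis
        using min[of "v \<oplus> t \<odot> x"] v x
        by (simp add: len_add_scale_sq f_add f_scale d_def q_def right_diff_distrib)
    qed
    \<comment> \<open>small enough for the linear term of the variation to dominate the quadratic one\<close>
    define s where "s = 1 / (q + 1)"
    have s: "s > 0" "s * q \<le> 1" using q by (auto simp: s_def)
    have "Re (- of_real s * cnj d * d) = - s * (cmod d)\<^sup>2"
      unfolding cmod_power2 by (simp add: power2_eq_square algebra_simps)
    moreover have "(cmod (- of_real s * cnj d))\<^sup>2 = s\<^sup>2 * (cmod d)\<^sup>2"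
      using s by (simp add: norm_mult power_mult_distrib)
    ultimately have "0 \<le> 2 * (- s * (cmod d)\<^sup>2) + s\<^sup>2 * (cmod d)\<^sup>2 * q" using var by metis
    also have "\<dots> = s * (cmod d)\<^sup>2 * (s * q - 2)" by (simp add: algebra_simps power2_eq_square)
    also have "\<dots> < 0" using s d by (intro mult_pos_neg) auto
    finally show False by simp
  qed
  then show ?thesis using v by blast
qed

end

lemma (in normed_cspace) bounded_operators_iff:
  "T \<in> bounded_operators V nm \<longleftrightarrow> T \<in> carrier V \<rightarrow>\<^sub>E carrier V \<and>
    (\<exists>K. bounded_linear_on V nm V nm (carrier V) K T)" (is "?l \<longleftrightarrow> ?r")
proof
  assume l: ?l
  then obtain K where K: "\<forall>x\<in>carrier V. nm (T x) \<le> K * nm x" by (auto simp: bounded_operators_def)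
  have "nm (T x) \<le> \<bar>K\<bar> * nm x" if "x \<in> carrier V" for x
    using K[rule_format, OF that] mult_right_mono[OF abs_ge_self nm_nonneg[OF that], of K] by linarith
  then show ?r using l by (auto simp: bounded_operators_def bounded_linear_on_def intro!: exI[of _ "\<bar>K\<bar>"])
next
  assume ?r
  then show ?l by (auto simp: bounded_operators_def bounded_linear_on_def)
qed

lemma bounded_linear_onD:
  assumes "bounded_linear_on V nm X nx S K T"
  shows "x \<in> S \<Longrightarrow> T x \<in> carrier X" "0 \<le> K"
    "\<lbrakk>x \<in> S; y \<in> S\<rbrakk> \<Longrightarrow> T (x \<oplus>\<^bsub>V\<^esub> y) = T x \<oplus>\<^bsub>X\<^esub> T y"
    "x \<in> S \<Longrightarrow> T (c \<odot>\<^bsub>V\<^esub> x) = c \<odot>\<^bsub>X\<^esub> T x" "x \<in> S \<Longrightarrow> nx (T x) \<le> K * nm x"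
  using assms by (auto simp: bounded_linear_on_def)

context hilbert_space
begin

abbreviation "bops \<equiv> bounded_operators X (ip_norm X)"

lemma bopsD:
  assumes "T \<in> bops"
  shows "x \<in> carrier X \<Longrightarrow> T x \<in> carrier X"
    "\<lbrakk>x \<in> carrier X; y \<in> carrier X\<rbrakk> \<Longrightarrow> T (x \<oplus> y) = T x \<oplus> T y"
    "x \<in> carrier X \<Longrightarrow> T (c \<odot> x) = c \<odot> T x"
  using assms by (auto simp: bounded_operators_def)

lemma bops_eqI:
  assumes "S \<in> bops" "T \<in> bops" "\<And>x. x \<in> carrier X \<Longrightarrow> S x = T x"
  shows "S = T"
proof
  show "S x = T x" for x
    using assms by (cases "x \<in> carrier X") (auto simp: bounded_operators_def PiE_def extensional_def)
qed

lemma bopsI: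
  assumes "T \<in> carrier X \<rightarrow>\<^sub>E carrier X"
    "\<And>x y. \<lbrakk>x \<in> carrier X; y \<in> carrier X\<rbrakk> \<Longrightarrow> T (x \<oplus> y) = T x \<oplus> T y"
    "\<And>c x. x \<in> carrier X \<Longrightarrow> T (c \<odot> x) = c \<odot> T x"
    "\<And>x. x \<in> carrier X \<Longrightarrow> len (T x) \<le> K * len x"
  shows "T \<in> bops"
proof -
  have "\<exists>K. \<forall>x\<in>carrier X. len (T x) \<le> K * len x" using assms(4) by (intro exI[of _ K]) simp
  then show ?thesis using assms(1-3) by (simp add: bounded_operators_def)
qed

lemma adjoint_exists:
  assumes T: "T \<in> bops"
  shows "\<exists>S\<in>bops. \<forall>x\<in>carrier X. \<forall>y\<in>carrier X. ip X (T x) y = ip X x (S y)"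
proof -
  obtain K where K: "bounded_linear_on X len X len (carrier X) K T"
    using T by (auto simp: bounded_operators_iff)
  note TD = bopsD[OF T]
  have "\<exists>v\<in>carrier X. \<forall>x\<in>carrier X. ip X (T x) y = ip X x v" if y: "y \<in> carrier X" for y
  proof (rule riesz_representation[where K = "K * len y"])
    fix x assume x: "x \<in> carrier X"
    have "cmod (ip X (T x) y) \<le> len (T x) * len y" using Cauchy_Schwarz[OF TD(1)[OF x] y] .
    also have "\<dots> \<le> K * len x * len y"
      using bounded_linear_onD(5)[OF K x] len_nonneg[OF y] by (rule mult_right_mono)
    finally show "cmod (ip X (T x) y) \<le> K * len y * len x" by (simp add: ac_simps)
  qed (use y in \<open>auto simp: TD ip_add ip_smult\<close>)
  then obtain S where S: "\<And>y. y \<in> carrier X \<Longrightarrow> S y \<in> carrier X"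
    "\<And>x y. \<lbrakk>x \<in> carrier X; y \<in> carrier X\<rbrakk> \<Longrightarrow> ip X (T x) y = ip X x (S y)" by metis
  have S': "ip X (S y) x = ip X y (T x)" if "x \<in> carrier X" "y \<in> carrier X" for x y
    using S(2)[OF that] ip_cnj[OF TD(1)[OF that(1)] that(2)] ip_cnj[OF that(1) S(1)[OF that(2)]] that
    by simp
  have "restrict S (carrier X) \<in> bops"
  proof (rule bopsI[where K = K])
    fix y assume y: "y \<in> carrier X"
    show "restrict S (carrier X) (c \<odot> y) = c \<odot> restrict S (carrier X) y" for c
      using y by (intro ip_eqI) (simp_all add: S(1) TD S' ip_smult)
    show "restrict S (carrier X) (y \<oplus> z) = restrict S (carrier X) y \<oplus> restrict S (carrier X) z"
      if "z \<in> carrier X" for z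
      using y that by (intro ip_eqI) (simp_all add: S(1) TD S' ip_add)
    have "(len (S y))\<^sup>2 = Re (ip X (T (S y)) y)" using y S by (simp add: len_sq)
    also have "\<dots> \<le> len (T (S y)) * len y"
      using Cauchy_Schwarz[OF TD(1)[OF S(1)[OF y]] y] complex_Re_le_cmod order_trans by blast
    also have "\<dots> \<le> K * len (S y) * len y"
      using bounded_linear_onD(5)[OF K S(1)[OF y]] len_nonneg[OF y] by (rule mult_right_mono)
    finally have *: "len (S y) * len (S y) \<le> len (S y) * (K * len y)"
      by (simp add: power2_eq_square ac_simps)
    have "len (S y) \<le> K * len y"
    proof (cases "len (S y) = 0")
      case True
      then show ?thesis using bounded_linear_onD(2)[OF K] len_nonneg[OF y] by simp
    next
      case False
      then have "len (S y) > 0" using len_nonneg[OF S(1)[OF y]] by simp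
      then show ?thesis using * by simp
    qed
    then show "len (restrict S (carrier X) y) \<le> K * len y" using y by simp
  qed (use S(1) in auto)
  moreover have "\<forall>x\<in>carrier X. \<forall>y\<in>carrier X. ip X (T x) y = ip X x (restrict S (carrier X) y)"
    using S(2) by simp
  ultimately show ?thesis by blast
qed

lemma adjoint_unique:
  assumes "S \<in> bops" "S' \<in> bops" "T \<in> bops"
    and "\<And>x y. \<lbrakk>x \<in> carrier X; y \<in> carrier X\<rbrakk> \<Longrightarrow> ip X (T x) y = ip X x (S y)"
    and "\<And>x y. \<lbrakk>x \<in> carrier X; y \<in> carrier X\<rbrakk> \<Longrightarrow> ip X (T x) y = ip X x (S' y)"
  shows "S = S'"
proof (rule bops_eqI[OF assms(1,2)])
  fix y assume y: "y \<in> carrier X"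
  note c = bopsD(1)[OF assms(1) y] bopsD(1)[OF assms(2) y]
  show "S y = S' y"
  proof (rule ip_eqI[OF c])
    fix z assume z: "z \<in> carrier X"
    have "ip X z (S y) = ip X z (S' y)" using assms(4,5) y z by metis
    then show "ip X (S y) z = ip X (S' y) z" using ip_cnj z c by metis
  qed
qed

text \<open>
  The adjoint in \<^const>\<open>operator_algebra\<close> is a definite description, which has its intended
  meaning only once existence and uniqueness are known.
\<close>

lemma star_operator:
  assumes T: "T \<in> bops"
  shows "star (operator_algebra X) T \<in> bops"
    and "\<lbrakk>x \<in> carrier X; y \<in> carrier X\<rbrakk> \<Longrightarrow> ip X (T x) y = ip X x (star (operator_algebra X) T y)"
proof -
  have "\<exists>!S. S \<in> bops \<and> (\<forall>x\<in>carrier X. \<forall>y\<in>carrier X. ip X (T x) y = ip X x (S y))"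
  proof (rule ex_ex1I)
    show "\<exists>S. S \<in> bops \<and> (\<forall>x\<in>carrier X. \<forall>y\<in>carrier X. ip X (T x) y = ip X x (S y))"
      using adjoint_exists[OF T] by blast
  qed (rule adjoint_unique[OF _ _ T], simp_all)
  from theI'[OF this]
  show "star (operator_algebra X) T \<in> bops"
    and "\<lbrakk>x \<in> carrier X; y \<in> carrier X\<rbrakk> \<Longrightarrow> ip X (T x) y = ip X x (star (operator_algebra X) T y)"
    by (auto simp: operator_algebra_def)
qed

lemma star_operator_eqI:
  assumes "T \<in> bops" "S \<in> bops"
    and "\<And>x y. \<lbrakk>x \<in> carrier X; y \<in> carrier X\<rbrakk> \<Longrightarrow> ip X (T x) y = ip X x (S y)"
  shows "star (operator_algebra X) T = S"
  using assms by (intro adjoint_unique[OF star_operator(1)[OF assms(1)] assms(2,1)] star_operator(2))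

lemma operator_algebra_simps [simp]:
  "carrier (operator_algebra X) = bops"
  "S \<otimes>\<^bsub>operator_algebra X\<^esub> T = compose (carrier X) S T"
  "S \<oplus>\<^bsub>operator_algebra X\<^esub> T = (\<lambda>x\<in>carrier X. S x \<oplus> T x)"
  "c \<odot>\<^bsub>operator_algebra X\<^esub> T = (\<lambda>x\<in>carrier X. c \<odot> T x)"
  "\<one>\<^bsub>operator_algebra X\<^esub> = (\<lambda>x\<in>carrier X. x)"
  "nrm (operator_algebra X) = operator_norm X len"
  by (simp_all add: operator_algebra_def)

text \<open>
  Operators are extensional functions, so an equation between them is an equation between their
  values on the carrier. This and \<open>star_hom_operatorI\<close> translate *-homomorphisms into operators
  to statements about vectors.
\<close>

lemma star_hom_operatorD:
  assumes "star_hom A (operator_algebra X) \<phi>" and a: "a \<in> carrier A"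
  shows "\<phi> a \<in> bops"
    and "\<lbrakk>b \<in> carrier A; x \<in> carrier X\<rbrakk> \<Longrightarrow> \<phi> (a \<oplus>\<^bsub>A\<^esub> b) x = \<phi> a x \<oplus> \<phi> b x"
    and "x \<in> carrier X \<Longrightarrow> \<phi> (c \<odot>\<^bsub>A\<^esub> a) x = c \<odot> \<phi> a x"
    and "\<lbrakk>b \<in> carrier A; x \<in> carrier X\<rbrakk> \<Longrightarrow> \<phi> (a \<otimes>\<^bsub>A\<^esub> b) x = \<phi> a (\<phi> b x)"
    and "\<lbrakk>x \<in> carrier X; y \<in> carrier X\<rbrakk> \<Longrightarrow> ip X (\<phi> a x) y = ip X x (\<phi> (star A a) y)"
proof -
  show b: "\<phi> a \<in> bops" using assms by (auto simp: star_hom_def)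
  show "\<lbrakk>x \<in> carrier X; y \<in> carrier X\<rbrakk> \<Longrightarrow> ip X (\<phi> a x) y = ip X x (\<phi> (star A a) y)"
    using star_operator(2)[OF b] assms by (simp add: star_hom_def)
qed (use assms in \<open>auto simp: star_hom_def compose_def\<close>)

lemma star_hom_operatorI:
  assumes closed: "\<And>a b. \<lbrakk>a \<in> carrier A; b \<in> carrier A\<rbrakk> \<Longrightarrow> a \<oplus>\<^bsub>A\<^esub> b \<in> carrier A"
      "\<And>c a. a \<in> carrier A \<Longrightarrow> c \<odot>\<^bsub>A\<^esub> a \<in> carrier A"
      "\<And>a b. \<lbrakk>a \<in> carrier A; b \<in> carrier A\<rbrakk> \<Longrightarrow> a \<otimes>\<^bsub>A\<^esub> b \<in> carrier A"
      "\<And>a. a \<in> carrier A \<Longrightarrow> star A a \<in> carrier A"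
    and \<phi>: "\<And>a. a \<in> carrier A \<Longrightarrow> \<phi> a \<in> bops"
    and add: "\<And>a b x. \<lbrakk>a \<in> carrier A; b \<in> carrier A; x \<in> carrier X\<rbrakk> \<Longrightarrow> \<phi> (a \<oplus>\<^bsub>A\<^esub> b) x = \<phi> a x \<oplus> \<phi> b x"
    and scale: "\<And>c a x. \<lbrakk>a \<in> carrier A; x \<in> carrier X\<rbrakk> \<Longrightarrow> \<phi> (c \<odot>\<^bsub>A\<^esub> a) x = c \<odot> \<phi> a x"
    and mult: "\<And>a b x. \<lbrakk>a \<in> carrier A; b \<in> carrier A; x \<in> carrier X\<rbrakk> \<Longrightarrow> \<phi> (a \<otimes>\<^bsub>A\<^esub> b) x = \<phi> a (\<phi> b x)"
    and adj: "\<And>a x y. \<lbrakk>a \<in> carrier A; x \<in> carrier X; y \<in> carrier X\<rbrakk> \<Longrightarrow>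
        ip X (\<phi> a x) y = ip X x (\<phi> (star A a) y)"
  shows "star_hom A (operator_algebra X) \<phi>"
proof -
  have ext: "\<phi> a = restrict (\<phi> a) (carrier X)" if "a \<in> carrier A" for a
    using \<phi>[OF that] by (auto simp: bounded_operators_def PiE_def extensional_restrict)
  have ext': "\<phi> a = (\<lambda>x\<in>carrier X. f x)" if "a \<in> carrier A" "\<And>x. x \<in> carrier X \<Longrightarrow> \<phi> a x = f x" for a f
    by (subst ext[OF that(1)]) (auto simp: that(2))
  show ?thesis
    unfolding star_hom_def
  proof (intro conjI ballI allI)
    show "\<phi> (a \<otimes>\<^bsub>A\<^esub> b) = \<phi> a \<otimes>\<^bsub>operator_algebra X\<^esub> \<phi> b" if "a \<in> carrier A" "b \<in> carrier A" for a b
      unfolding operator_algebra_simps compose_def using that closed mult by (intro ext') auto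
  qed (use closed \<phi> add scale adj in \<open>auto intro!: ext' star_operator_eqI[symmetric]\<close>)
qed

end

section \<open>C*-algebras and automatic contractivity\<close>

context cstar_algebra
begin

sublocale cspace A ..

sublocale normed_cspace A "nrm A"
  by unfold_locales (simp_all add: nrm_nonneg nrm_eq_0 nrm_triangle nrm_smult)

lemmas [simp, intro] = mult_closed star_closed
lemmas [simp] = star_star

lemma mult_zero_left [simp]: "x \<in> carrier A \<Longrightarrow> \<zero> \<otimes> x = \<zero>"
  using smult_mult_left[of \<zero> x 0] by simp

lemma mult_zero_right [simp]: "x \<in> carrier A \<Longrightarrow> x \<otimes> \<zero> = \<zero>"
  using smult_mult_right[of x \<zero> 0] by simp

lemma star_zero [simp]: "star A \<zero> = \<zero>"
  using star_smult[of \<zero> 0] by simp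

lemma mult_minus_left:
  "\<lbrakk>x \<in> carrier A; y \<in> carrier A; z \<in> carrier A\<rbrakk> \<Longrightarrow> (x \<ominus> y) \<otimes> z = x \<otimes> z \<ominus> y \<otimes> z"
  by (simp add: minus_eq_scale distrib_right smult_mult_left)

lemma mult_minus_right:
  "\<lbrakk>x \<in> carrier A; y \<in> carrier A; z \<in> carrier A\<rbrakk> \<Longrightarrow> x \<otimes> (y \<ominus> z) = x \<otimes> y \<ominus> x \<otimes> z"
  by (simp add: minus_eq_scale distrib_left smult_mult_right)

lemma star_minus:
  "\<lbrakk>x \<in> carrier A; y \<in> carrier A\<rbrakk> \<Longrightarrow> star A (x \<ominus> y) = star A x \<ominus> star A y"
  by (simp add: minus_eq_scale star_add star_smult)

lemma nrm_star [simp]: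
  assumes "x \<in> carrier A"
  shows "nrm A (star A x) = nrm A x"
proof -
  have "nrm A y \<le> nrm A (star A y)" if y: "y \<in> carrier A" for y
  proof (cases "nrm A y = 0")
    case False
    have "nrm A y * nrm A y \<le> nrm A (star A y) * nrm A y"
      using nrm_mult[of "star A y" y] nrm_star_mult[OF y] y by (simp add: power2_eq_square)
    then show ?thesis using False nrm_nonneg[OF y] by simp
  qed (use y nrm_nonneg in simp)
  from this[of x] this[of "star A x"] assms show ?thesis by simp
qed

lemma left_mult_inj:
  assumes "x \<in> carrier A" "y \<in> carrier A" "\<And>z. z \<in> carrier A \<Longrightarrow> x \<otimes> z = y \<otimes> z"
  shows "x = y"
proof -
  define d where "d = x \<ominus> y"
  have d: "d \<in> carrier A" using assms by (simp add: d_def)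
  have "d \<otimes> star A d = \<zero>"
    using assms d by (simp add: d_def mult_minus_left minus_eq_zero_iff)
  then have "(nrm A (star A d))\<^sup>2 = 0" using nrm_star_mult[of "star A d"] d by simp
  then show ?thesis using d assms by (simp add: nrm_eq_0 d_def minus_eq_zero_iff)
qed

lemma star_mult_inj:
  assumes "x \<in> carrier A" "y \<in> carrier A" "\<And>z. z \<in> carrier A \<Longrightarrow> star A z \<otimes> x = star A z \<otimes> y"
  shows "x = y"
proof -
  have "star A x = star A y"
  proof (rule left_mult_inj)
    fix z assume "z \<in> carrier A"
    then show "star A x \<otimes> z = star A y \<otimes> z"
      using assms star_mult[of "star A z" x] star_mult[of "star A z" y] by simp
  qed (use assms in auto)
  then show ?thesis using assms star_star by metis
qed

lemma converges_mult:
  assumes s: "converges A (nrm A) s v" and t: "converges A (nrm A) t w"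
  shows "converges A (nrm A) (\<lambda>n. s n \<otimes> t n) (v \<otimes> w)"
proof (rule convergesI)
  note c [simp] = convergesD(1,2)[OF s] convergesD(1,2)[OF t]
  show "s n \<otimes> t n \<in> carrier A" "v \<otimes> w \<in> carrier A" for n by auto
  show "nrm A (s n \<otimes> t n \<ominus> v \<otimes> w) \<le> nrm A (s n \<ominus> v) * nrm A (t n) + nrm A v * nrm A (t n \<ominus> w)" for n
  proof -
    have "nrm A (s n \<otimes> t n \<ominus> v \<otimes> w) \<le>
        nrm A (s n \<otimes> t n \<ominus> v \<otimes> t n) + nrm A (v \<otimes> t n \<ominus> v \<otimes> w)"
      by (intro nm_minus_triangle) auto
    also have "\<dots> = nrm A ((s n \<ominus> v) \<otimes> t n) + nrm A (v \<otimes> (t n \<ominus> w))"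
      by (simp add: mult_minus_left mult_minus_right)
    also have "\<dots> \<le> nrm A (s n \<ominus> v) * nrm A (t n) + nrm A v * nrm A (t n \<ominus> w)"
      by (intro add_mono nrm_mult) auto
    finally show ?thesis .
  qed
  have "(\<lambda>n. nrm A (s n \<ominus> v) * nrm A (t n) + nrm A v * nrm A (t n \<ominus> w)) \<longlonglongrightarrow>
      0 * nrm A w + nrm A v * 0"
    by (intro tendsto_intros convergesD(3)[OF s] convergesD(3)[OF t] converges_nm[OF t])
  then show "(\<lambda>n. nrm A (s n \<ominus> v) * nrm A (t n) + nrm A v * nrm A (t n \<ominus> w)) \<longlonglongrightarrow> 0" by simp
qed

lemma converges_star:
  assumes s: "converges A (nrm A) s v"
  shows "converges A (nrm A) (\<lambda>n. star A (s n)) (star A v)"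
  using convergesD[OF s] by (simp add: converges_def star_minus[symmetric])

text \<open>
  The element is \<open>k = 1 - sqrt (1 - h\<^sup>2)\<close>, a fixed point of \<open>k \<mapsto> (h\<^sup>2 + k\<^sup>2) / 2\<close>; the formula is
  free of the unit, which the algebra may lack. The iteration from 0 stays among the selfadjoint
  elements that commute with \<open>h\<close>. It converges because its increments are dominated by those of the
  scalar iteration \<open>t \<mapsto> (1 + t\<^sup>2) / 2\<close>, which increases and is bounded by 1.
\<close>

lemma exists_one_minus_sqrt:
  assumes h: "h \<in> carrier A" and sa: "star A h = h" and h1: "nrm A h \<le> 1"
  shows "\<exists>k\<in>carrier A. star A k = k \<and> h \<otimes> k = k \<otimes> h \<and> h \<otimes> h \<oplus> k \<otimes> k = k \<oplus> k"
proof -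
  define k where "k = rec_nat \<zero> (\<lambda>_ k. (1/2) \<odot> (h \<otimes> h \<oplus> k \<otimes> k))"
  have k0: "k 0 = \<zero>" and kS: "k (Suc n) = (1/2) \<odot> (h \<otimes> h \<oplus> k n \<otimes> k n)" for n
    by (simp_all add: k_def)
  \<comment> \<open>scalar majorant\<close>
  define t :: "nat \<Rightarrow> real" where "t = rec_nat 0 (\<lambda>_ t. (1 + t\<^sup>2) / 2)"
  have t0: "t 0 = 0" and tS: "t (Suc n) = (1 + (t n)\<^sup>2) / 2" for n by (simp_all add: t_def)
  have t1: "0 \<le> t n \<and> t n \<le> 1" for n
    by (induction n) (auto simp: t0 tS power_le_one)
  have tmono: "t n \<le> t (Suc n)" for n
    using zero_le_power2[of "t n - 1"] by (simp add: tS power2_diff)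
  have kc [simp]: "k n \<in> carrier A" for n
    by (induction n) (use h in \<open>simp_all add: k0 kS\<close>)
  have k_star: "star A (k n) = k n" for n
    by (induction n) (use h sa in \<open>simp_all add: k0 kS star_smult star_add star_mult\<close>)
  have k_comm: "h \<otimes> k n = k n \<otimes> h" for n
  proof (induction n)
    case (Suc n)
    have "h \<otimes> (k n \<otimes> k n) = k n \<otimes> (k n \<otimes> h)"
      using h Suc by (metis kc mult_assoc)
    then show ?case using h
      by (simp add: kS smult_mult_left smult_mult_right distrib_left distrib_right mult_assoc)
  qed (use h in \<open>simp add: k0\<close>)
  have k_nrm: "nrm A (k n) \<le> t n" for n
  proof (induction n)
    case (Suc n)
    have "nrm A (h \<otimes> h) \<le> 1 * 1"
      using nrm_mult[OF h h] mult_mono[OF h1 h1] nrm_nonneg[OF h] by simp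
    moreover have "nrm A (k n \<otimes> k n) \<le> t n * t n"
      using nrm_mult[OF kc kc, of n n] mult_mono[OF Suc Suc] t1[of n] nrm_nonneg[OF kc, of n] by simp
    ultimately have "nrm A (h \<otimes> h \<oplus> k n \<otimes> k n) \<le> 1 + t n * t n"
      using nrm_triangle[of "h \<otimes> h" "k n \<otimes> k n"] h by simp
    then show ?case using h by (simp add: kS tS nrm_smult norm_divide power2_eq_square)
  qed (simp add: k0 t0)
  \<comment> \<open>\<open>a\<^sup>2 - b\<^sup>2 = a (a - b) + (a - b) b\<close> for consecutive iterates \<open>a\<close>, \<open>b\<close>, matching \<open>t\<^sup>2 - s\<^sup>2 = (t + s) (t - s)\<close>\<close>
  have k_step: "nrm A (k (Suc n) \<ominus> k n) \<le> t (Suc n) - t n" for n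
  proof (induction n)
    case 0
    then show ?case using k_nrm[of "Suc 0"] by (simp add: k0 t0 minus_eq_scale)
  next
    case (Suc n)
    define a b where "a = k (Suc n)" and "b = k n"
    have ab: "a \<in> carrier A" "b \<in> carrier A" by (simp_all add: a_def b_def)
    have aS: "k (Suc (Suc n)) = (1/2) \<odot> (h \<otimes> h \<oplus> a \<otimes> a)" unfolding a_def by (rule kS)
    have bS: "k (Suc n) = (1/2) \<odot> (h \<otimes> h \<oplus> b \<otimes> b)" unfolding b_def by (rule kS)
    have "k (Suc (Suc n)) \<ominus> k (Suc n) = (1/2) \<odot> ((h \<otimes> h \<oplus> a \<otimes> a) \<ominus> (h \<otimes> h \<oplus> b \<otimes> b))"
      unfolding aS bS using h ab by (simp add: scale_minus)
    also have "(h \<otimes> h \<oplus> a \<otimes> a) \<ominus> (h \<otimes> h \<oplus> b \<otimes> b) = a \<otimes> a \<ominus> b \<otimes> b"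
      using h ab by (simp add: add_minus_add minus_eq_zero_iff[THEN iffD2])
    finally have "nrm A (k (Suc (Suc n)) \<ominus> k (Suc n)) = nrm A (a \<otimes> a \<ominus> b \<otimes> b) / 2"
      using ab by (simp add: nrm_smult norm_divide)
    also have "nrm A (a \<otimes> a \<ominus> b \<otimes> b) \<le> nrm A (a \<otimes> a \<ominus> a \<otimes> b) + nrm A (a \<otimes> b \<ominus> b \<otimes> b)"
      using ab by (intro nm_minus_triangle) auto
    also have "\<dots> = nrm A (a \<otimes> (a \<ominus> b)) + nrm A ((a \<ominus> b) \<otimes> b)"
      using ab by (simp add: mult_minus_left mult_minus_right)
    also have "\<dots> \<le> nrm A a * nrm A (a \<ominus> b) + nrm A (a \<ominus> b) * nrm A b"
      using ab by (intro add_mono nrm_mult) auto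
    also have "\<dots> \<le> t (Suc n) * (t (Suc n) - t n) + (t (Suc n) - t n) * t n"
      using Suc k_nrm[of n] k_nrm[of "Suc n"] t1[of n] t1[of "Suc n"] tmono[of n] ab
      by (intro add_mono mult_mono) (auto simp: a_def b_def nrm_nonneg)
    also have "\<dots> / 2 = t (Suc (Suc n)) - t (Suc n)"
      by (simp add: tS[of "Suc n"] tS[of n] power2_eq_square field_simps)
    finally show ?case by simp
  qed
  have k_far: "nrm A (k (n + d) \<ominus> k n) \<le> t (n + d) - t n" for n d
  proof (induction d)
    case 0
    then show ?case by (simp add: a_minus_def M.r_neg)
  next
    case (Suc d)
    then show ?case using nm_minus_triangle[of "k (Suc (n + d))" "k (n + d)" "k n"] k_step[of "n + d"] by simp
  qed
  have "convergent t"
    by (rule Bseq_mono_convergent) (use t1 tmono lift_Suc_mono_le[of t] in \<open>auto intro!: BseqI'[of _ 1]\<close>)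
  then have tC: "Cauchy t" by (rule convergent_Cauchy)
  have "\<exists>N. \<forall>m\<ge>N. \<forall>n\<ge>N. nrm A (k m \<ominus> k n) < e" if e: "e > 0" for e
  proof -
    obtain N where N: "\<And>m n. m \<ge> N \<Longrightarrow> n \<ge> N \<Longrightarrow> dist (t m) (t n) < e"
      using tC e by (meson metric_CauchyD)
    have le: "nrm A (k m \<ominus> k n) < e" if "m \<ge> n" "n \<ge> N" for m n
      using k_far[of n "m - n"] N[of m n] that by (simp add: dist_real_def)
    have "nrm A (k m \<ominus> k n) < e" if "m \<ge> N" "n \<ge> N" for m n
      using le[of n m] le[of m n] that nm_minus_commute[of "k m" "k n"] by (cases "n \<le> m") auto
    then show ?thesis by blast
  qed
  then obtain l where l: "converges A (nrm A) k l"
    using complete[unfolded norm_complete_iff, rule_format, of k] by auto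
  note lc [simp] = convergesD(2)[OF l]
  have "converges A (nrm A) (\<lambda>n. k (Suc n)) l"
    using convergesD[OF l] LIMSEQ_Suc[of "\<lambda>n. nrm A (k n \<ominus> l)"] by (simp add: converges_def)
  moreover have "converges A (nrm A) (\<lambda>n. k (Suc n)) ((1/2) \<odot> (h \<otimes> h \<oplus> l \<otimes> l))"
    unfolding kS using h by (intro converges_scale converges_add converges_mult l converges_const) auto
  ultimately have l_eq: "l = (1/2) \<odot> (h \<otimes> h \<oplus> l \<otimes> l)" by (rule converges_unique)
  have "l \<oplus> l = (1/2 + 1/2) \<odot> (h \<otimes> h \<oplus> l \<otimes> l)"
    using h l_eq scale_add_left[of "h \<otimes> h \<oplus> l \<otimes> l" "1/2" "1/2"] by simp
  then have "h \<otimes> h \<oplus> l \<otimes> l = l \<oplus> l" using h by simp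
  moreover have "star A l = l"
    using converges_star[OF l] l converges_unique by (simp add: k_star)
  moreover have "h \<otimes> l = l \<otimes> h"
    using converges_mult[OF converges_const[OF h] l] converges_mult[OF l converges_const[OF h]]
      converges_unique by (simp add: k_comm)
  ultimately show ?thesis by auto
qed

text \<open>
  The C*-identity reduces a bound for \<open>a\<close> to one for the selfadjoint element \<open>a\<^sup>* a\<close>, which is then
  scaled to norm 1.
\<close>

lemma bound_from_selfadjoint:
  assumes scale: "\<And>c a. a \<in> carrier A \<Longrightarrow> \<nu> (c \<odot> a) = cmod c * \<nu> a"
    and sq: "\<And>a. a \<in> carrier A \<Longrightarrow> (\<nu> a)\<^sup>2 \<le> \<nu> (star A a \<otimes> a) * K"
    and selfadjoint: "\<And>h. \<lbrakk>h \<in> carrier A; star A h = h; nrm A h \<le> 1\<rbrakk> \<Longrightarrow> \<nu> h \<le> K"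
    and K: "0 \<le> K" and a: "a \<in> carrier A"
  shows "\<nu> a \<le> nrm A a * K"
proof -
  define r where "r = nrm A a"
  define aa where "aa = star A a \<otimes> a"
  have aa: "aa \<in> carrier A" "star A aa = aa" "nrm A aa = r\<^sup>2"
    using a by (simp_all add: aa_def star_mult nrm_star_mult r_def)
  have r: "0 \<le> r" using a by (simp add: r_def nrm_nonneg)
  have "\<nu> aa \<le> r\<^sup>2 * K"
  proof (cases "r = 0")
    case True
    then have "aa = 0 \<odot> aa" using aa by (simp add: nrm_eq_0)
    then have "\<nu> aa = 0" using scale[OF aa(1), of 0] by simp
    then show ?thesis using True by simp
  next
    case False
    define h where "h = complex_of_real (1 / r\<^sup>2) \<odot> aa"
    have h: "h \<in> carrier A" "star A h = h" "nrm A h \<le> 1"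
      using aa False by (simp_all add: h_def star_smult nrm_smult norm_divide norm_power)
    have "\<nu> h = \<nu> aa / r\<^sup>2"
      using aa by (simp add: h_def scale norm_divide norm_power)
    then show ?thesis using mult_right_mono[OF selfadjoint[OF h], of "r\<^sup>2"] False by (simp add: field_simps)
  qed
  then have "\<nu> aa * K \<le> r\<^sup>2 * K * K" using K by (rule mult_right_mono)
  then have "(\<nu> a)\<^sup>2 \<le> r\<^sup>2 * K * K" using sq[OF a] unfolding aa_def by linarith
  also have "\<dots> = (r * K)\<^sup>2" by (simp add: power2_eq_square)
  finally show ?thesis unfolding r_def[symmetric] by (rule power2_le_imp_le) (simp add: r K)
qed

end

text \<open>
  With \<open>k\<close> as in \<open>exists_one_minus_sqrt\<close>, the identity \<open>h\<^sup>2 + (1 - k)\<^sup>2 = 1\<close> gives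
  \<open>\<parallel>\<phi>(h) x\<parallel>\<^sup>2 + \<parallel>x - \<phi>(k) x\<parallel>\<^sup>2 = \<parallel>x\<parallel>\<^sup>2\<close>.
\<close>

lemma star_hom_contractive:
  assumes A: "cstar_algebra A" and X: "hilbert_space X"
    and \<phi>: "star_hom A (operator_algebra X) \<phi>" and a: "a \<in> carrier A" and x: "x \<in> carrier X"
  shows "ip_norm X (\<phi> a x) \<le> nrm A a * ip_norm X x"
proof -
  interpret A: cstar_algebra A by fact
  interpret X: hilbert_space X by fact
  note hom = X.star_hom_operatorD[OF \<phi>]
  have cl [simp]: "\<phi> b y \<in> carrier X" if "b \<in> carrier A" "y \<in> carrier X" for b y
    using X.bopsD(1)[OF hom(1)] that by blast
  have sq: "(ip_norm X (\<phi> b x))\<^sup>2 = Re (ip X (\<phi> (star A b \<otimes>\<^bsub>A\<^esub> b) x) x)" if b: "b \<in> carrier A" for b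
    using hom(5)[of "star A b" "\<phi> b x" x] b x by (simp add: X.len_sq hom(4))
  have selfadjoint: "ip_norm X (\<phi> h x) \<le> ip_norm X x"
    if h: "h \<in> carrier A" "star A h = h" "nrm A h \<le> 1" for h
  proof -
    obtain k where k: "k \<in> carrier A" "star A k = k" "h \<otimes>\<^bsub>A\<^esub> h \<oplus>\<^bsub>A\<^esub> k \<otimes>\<^bsub>A\<^esub> k = k \<oplus>\<^bsub>A\<^esub> k"
      using A.exists_one_minus_sqrt[OF h] by blast
    have "ip X (\<phi> (h \<otimes>\<^bsub>A\<^esub> h \<oplus>\<^bsub>A\<^esub> k \<otimes>\<^bsub>A\<^esub> k) x) x = ip X (\<phi> (k \<oplus>\<^bsub>A\<^esub> k) x) x" by (simp add: k(3))
    then have "ip X (\<phi> (h \<otimes>\<^bsub>A\<^esub> h) x) x + ip X (\<phi> (k \<otimes>\<^bsub>A\<^esub> k) x) x = ip X (\<phi> k x) x + ip X (\<phi> k x) x"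
      using h k(1,2) x by (simp add: hom(2) X.ip_add)
    from arg_cong[OF this, of Re]
    have "(ip_norm X (\<phi> h x))\<^sup>2 + (ip_norm X (\<phi> k x))\<^sup>2 = 2 * Re (ip X (\<phi> k x) x)"
      using h k(1,2) by (simp add: sq)
    moreover have "(ip_norm X (x \<ominus>\<^bsub>X\<^esub> \<phi> k x))\<^sup>2 =
        (ip_norm X x)\<^sup>2 - 2 * Re (ip X (\<phi> k x) x) + (ip_norm X (\<phi> k x))\<^sup>2"
      using X.len_add_scale_sq[of x "\<phi> k x" "-1"] X.ip_cnj[of "\<phi> k x" x] k x by (simp add: X.minus_eq_scale)
    ultimately have "(ip_norm X (\<phi> h x))\<^sup>2 \<le> (ip_norm X x)\<^sup>2"
      using zero_le_power2[of "ip_norm X (x \<ominus>\<^bsub>X\<^esub> \<phi> k x)"] by linarith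
    then show ?thesis by (rule power2_le_imp_le) (simp add: X.len_nonneg x)
  qed
  show ?thesis
  proof (rule A.bound_from_selfadjoint[OF _ _ selfadjoint X.len_nonneg[OF x] a])
    fix b assume b: "b \<in> carrier A"
    show "ip_norm X (\<phi> (c \<odot>\<^bsub>A\<^esub> b) x) = cmod c * ip_norm X (\<phi> b x)" for c
      using b x by (simp add: hom(3) X.len_scale)
    have "star A b \<otimes>\<^bsub>A\<^esub> b \<in> carrier A" using b by simp
    then show "(ip_norm X (\<phi> b x))\<^sup>2 \<le> ip_norm X (\<phi> (star A b \<otimes>\<^bsub>A\<^esub> b) x) * ip_norm X x"
      unfolding sq[OF b] using X.Cauchy_Schwarz[OF cl x] x complex_Re_le_cmod order_trans by blast
  qed
qed

text \<open>
  The analogue for an action by adjointable operators on a C*-algebra. There a sum of squares cannot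
  be compared with one summand by means of an inner product. Instead, since \<open>h\<close> and \<open>k\<close> commute,
  \<open>h + \<i> (1 - k)\<close> is unitary, hence isometric, and \<open>h\<close> is the mean of this unitary and its adjoint.
\<close>

lemma star_action_contractive:
  assumes A: "cstar_algebra A" and B: "cstar_algebra B"
    and closed: "\<And>a b. \<lbrakk>a \<in> carrier A; b \<in> carrier B\<rbrakk> \<Longrightarrow> L a b \<in> carrier B"
    and L_add: "\<And>a a' b. \<lbrakk>a \<in> carrier A; a' \<in> carrier A; b \<in> carrier B\<rbrakk> \<Longrightarrow>
      L (a \<oplus>\<^bsub>A\<^esub> a') b = L a b \<oplus>\<^bsub>B\<^esub> L a' b"
    and L_scale: "\<And>c a b. \<lbrakk>a \<in> carrier A; b \<in> carrier B\<rbrakk> \<Longrightarrow> L (c \<odot>\<^bsub>A\<^esub> a) b = c \<odot>\<^bsub>B\<^esub> L a b"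
    and L_mult: "\<And>a a' b. \<lbrakk>a \<in> carrier A; a' \<in> carrier A; b \<in> carrier B\<rbrakk> \<Longrightarrow>
      L (a \<otimes>\<^bsub>A\<^esub> a') b = L a (L a' b)"
    and L_star: "\<And>a b c. \<lbrakk>a \<in> carrier A; b \<in> carrier B; c \<in> carrier B\<rbrakk> \<Longrightarrow>
      star B (L a b) \<otimes>\<^bsub>B\<^esub> c = star B b \<otimes>\<^bsub>B\<^esub> L (star A a) c"
    and L_minus: "\<And>a b c. \<lbrakk>a \<in> carrier A; b \<in> carrier B; c \<in> carrier B\<rbrakk> \<Longrightarrow>
      L a (b \<ominus>\<^bsub>B\<^esub> c) = L a b \<ominus>\<^bsub>B\<^esub> L a c"
    and a: "a \<in> carrier A" and b: "b \<in> carrier B"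
  shows "nrm B (L a b) \<le> nrm A a * nrm B b"
proof -
  interpret A: cstar_algebra A by fact
  interpret B: cstar_algebra B by fact
  note [simp] = closed b
  have selfadjoint: "nrm B (L h b) \<le> nrm B b"
    if h: "h \<in> carrier A" "star A h = h" "nrm A h \<le> 1" for h
  proof -
    obtain k where k: "k \<in> carrier A" "star A k = k" "h \<otimes>\<^bsub>A\<^esub> k = k \<otimes>\<^bsub>A\<^esub> h"
      and hk: "h \<otimes>\<^bsub>A\<^esub> h \<oplus>\<^bsub>A\<^esub> k \<otimes>\<^bsub>A\<^esub> k = k \<oplus>\<^bsub>A\<^esub> k"
      using A.exists_one_minus_sqrt[OF h] by blast
    note [simp] = h(1) k(1)
    define p q where "p = L h b" and "q = b \<ominus>\<^bsub>B\<^esub> L k b"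
    have pq [simp]: "p \<in> carrier B" "q \<in> carrier B" by (simp_all add: p_def q_def)
    define hh kk where "hh = L h (L h b)" and "kk = L k (L k b)"
    have [simp]: "hh \<in> carrier B" "kk \<in> carrier B" by (simp_all add: hh_def kk_def)
    have "L (h \<otimes>\<^bsub>A\<^esub> h \<oplus>\<^bsub>A\<^esub> k \<otimes>\<^bsub>A\<^esub> k) b = L (k \<oplus>\<^bsub>A\<^esub> k) b" by (simp only: hk)
    then have L2: "hh \<oplus>\<^bsub>B\<^esub> kk = L k b \<oplus>\<^bsub>B\<^esub> L k b"
      by (simp add: L_add L_mult hh_def kk_def)
    have Lhk: "L h (L k b) = L k (L h b)" using L_mult[of h k b] L_mult[of k h b] k(3) by simp
    \<comment> \<open>the mixed terms cancel because \<open>h\<close> and \<open>k\<close> commute\<close>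
    have cross: "star B p \<otimes>\<^bsub>B\<^esub> q = star B q \<otimes>\<^bsub>B\<^esub> p"
      using h(2) k(2)
      by (simp add: p_def q_def B.star_minus B.mult_minus_left L_star L_minus Lhk B.mult_minus_right)
    have qq: "q \<ominus>\<^bsub>B\<^esub> L k q = b \<ominus>\<^bsub>B\<^esub> hh"
    proof -
      have "q \<ominus>\<^bsub>B\<^esub> L k q = (b \<oplus>\<^bsub>B\<^esub> kk) \<ominus>\<^bsub>B\<^esub> (L k b \<oplus>\<^bsub>B\<^esub> L k b)"
      proof -
        have "L k q = L k b \<ominus>\<^bsub>B\<^esub> kk" by (simp add: q_def L_minus kk_def)
        then show ?thesis by (simp add: q_def B.M.minus_eq B.M.minus_add B.M.a_ac B.M.minus_minus)
      qed
      also have "\<dots> = (b \<oplus>\<^bsub>B\<^esub> kk) \<ominus>\<^bsub>B\<^esub> (hh \<oplus>\<^bsub>B\<^esub> kk)" by (simp only: L2)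
      also have "\<dots> = b \<ominus>\<^bsub>B\<^esub> hh" by (simp add: B.add_minus_add B.minus_eq_zero_iff[THEN iffD2])
      finally show ?thesis .
    qed
    have "star B p \<otimes>\<^bsub>B\<^esub> p = star B b \<otimes>\<^bsub>B\<^esub> hh" using h by (simp add: p_def L_star hh_def)
    moreover have "star B q \<otimes>\<^bsub>B\<^esub> q = star B b \<otimes>\<^bsub>B\<^esub> (q \<ominus>\<^bsub>B\<^esub> L k q)"
    proof -
      have "star B q \<otimes>\<^bsub>B\<^esub> q = star B b \<otimes>\<^bsub>B\<^esub> q \<ominus>\<^bsub>B\<^esub> star B (L k b) \<otimes>\<^bsub>B\<^esub> q"
        by (subst (1) q_def) (simp add: B.star_minus B.mult_minus_left)
      then show ?thesis using k(2) by (simp add: L_star B.mult_minus_right)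
    qed
    ultimately have diag: "star B p \<otimes>\<^bsub>B\<^esub> p \<oplus>\<^bsub>B\<^esub> star B q \<otimes>\<^bsub>B\<^esub> q = star B b \<otimes>\<^bsub>B\<^esub> b"
      by (simp add: qq B.distrib_left[symmetric] B.M.a_comm[of hh] B.minus_add_cancel)
    \<comment> \<open>\<open>c = \<plusminus>\<i>\<close>\<close>
    have isometric: "nrm B (p \<oplus>\<^bsub>B\<^esub> c \<odot>\<^bsub>B\<^esub> q) = nrm B b" if c: "cnj c = - c" "c * c = -1" for c
    proof -
      define P Q R where "P = star B p \<otimes>\<^bsub>B\<^esub> p" and "Q = star B q \<otimes>\<^bsub>B\<^esub> q" and "R = star B q \<otimes>\<^bsub>B\<^esub> p"
      have PQR [simp]: "P \<in> carrier B" "Q \<in> carrier B" "R \<in> carrier B" by (simp_all add: P_def Q_def R_def)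
      have "star B (p \<oplus>\<^bsub>B\<^esub> c \<odot>\<^bsub>B\<^esub> q) \<otimes>\<^bsub>B\<^esub> (p \<oplus>\<^bsub>B\<^esub> c \<odot>\<^bsub>B\<^esub> q) =
          (P \<oplus>\<^bsub>B\<^esub> (- c) \<odot>\<^bsub>B\<^esub> R) \<oplus>\<^bsub>B\<^esub> (c \<odot>\<^bsub>B\<^esub> R \<oplus>\<^bsub>B\<^esub> (- c * c) \<odot>\<^bsub>B\<^esub> Q)"
        using c cross by (simp add: B.star_add B.star_smult B.distrib_left B.distrib_right
            B.smult_mult_left B.smult_mult_right P_def Q_def R_def B.scale_add_right B.scale_scale)
      also have "\<dots> = P \<oplus>\<^bsub>B\<^esub> (((- c) \<odot>\<^bsub>B\<^esub> R \<oplus>\<^bsub>B\<^esub> c \<odot>\<^bsub>B\<^esub> R) \<oplus>\<^bsub>B\<^esub> Q)"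
        using c by (simp add: B.M.a_assoc)
      also have "(- c) \<odot>\<^bsub>B\<^esub> R \<oplus>\<^bsub>B\<^esub> c \<odot>\<^bsub>B\<^esub> R = \<zero>\<^bsub>B\<^esub>"
        by (simp add: B.scale_add_left[symmetric])
      also have "P \<oplus>\<^bsub>B\<^esub> (\<zero>\<^bsub>B\<^esub> \<oplus>\<^bsub>B\<^esub> Q) = star B b \<otimes>\<^bsub>B\<^esub> b" using diag by (simp add: P_def Q_def)
      finally have "(nrm B (p \<oplus>\<^bsub>B\<^esub> c \<odot>\<^bsub>B\<^esub> q))\<^sup>2 = (nrm B b)\<^sup>2"
        using B.nrm_star_mult[of "p \<oplus>\<^bsub>B\<^esub> c \<odot>\<^bsub>B\<^esub> q"] B.nrm_star_mult[OF b] by simp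
      then show ?thesis by (simp add: power2_eq_iff_nonneg B.nrm_nonneg)
    qed
    have "(p \<oplus>\<^bsub>B\<^esub> \<i> \<odot>\<^bsub>B\<^esub> q) \<oplus>\<^bsub>B\<^esub> (p \<oplus>\<^bsub>B\<^esub> (- \<i>) \<odot>\<^bsub>B\<^esub> q) =
        (p \<oplus>\<^bsub>B\<^esub> p) \<oplus>\<^bsub>B\<^esub> (\<i> \<odot>\<^bsub>B\<^esub> q \<oplus>\<^bsub>B\<^esub> (- \<i>) \<odot>\<^bsub>B\<^esub> q)"
      by (simp add: B.M.a_ac)
    also have "\<dots> = (1 + 1) \<odot>\<^bsub>B\<^esub> p"
      unfolding B.scale_add_left[OF pq(1)] by (simp add: B.scale_add_left[symmetric])
    finally have "nrm B ((1 + 1) \<odot>\<^bsub>B\<^esub> p) \<le> nrm B b + nrm B b"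
      using B.nrm_triangle[of "p \<oplus>\<^bsub>B\<^esub> \<i> \<odot>\<^bsub>B\<^esub> q" "p \<oplus>\<^bsub>B\<^esub> (- \<i>) \<odot>\<^bsub>B\<^esub> q"] isometric[of \<i>] isometric[of "- \<i>"]
      by simp
    then show ?thesis by (simp add: B.nrm_smult p_def)
  qed
  show ?thesis
  proof (rule A.bound_from_selfadjoint[OF _ _ selfadjoint B.nrm_nonneg[OF b] a])
    fix x assume x: "x \<in> carrier A"
    show "nrm B (L (c \<odot>\<^bsub>A\<^esub> x) b) = cmod c * nrm B (L x b)" for c
      using x by (simp add: L_scale B.nrm_smult)
    have "(nrm B (L x b))\<^sup>2 = nrm B (star B b \<otimes>\<^bsub>B\<^esub> L (star A x \<otimes>\<^bsub>A\<^esub> x) b)"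
      using x by (simp add: B.nrm_star_mult[symmetric] L_star L_mult)
    also have "\<dots> \<le> nrm B (L (star A x \<otimes>\<^bsub>A\<^esub> x) b) * nrm B b"
      using B.nrm_mult[of "star B b" "L (star A x \<otimes>\<^bsub>A\<^esub> x) b"] x by (simp add: mult.commute)
    finally show "(nrm B (L x b))\<^sup>2 \<le> nrm B (L (star A x \<otimes>\<^bsub>A\<^esub> x) b) * nrm B b" .
  qed
qed

section \<open>Multipliers\<close>

context normed_cspace
begin

lemma operator_norm_bdd_above:
  assumes "T \<in> bounded_operators V nm"
  shows "bdd_above ((\<lambda>x. nm (T x)) ` {x \<in> carrier V. nm x \<le> 1})"
proof -
  obtain K where K: "bounded_linear_on V nm V nm (carrier V) K T"
    using assms by (auto simp: bounded_operators_iff)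
  have "nm (T x) \<le> K" if "x \<in> carrier V" "nm x \<le> 1" for x
    using bounded_linear_onD(5)[OF K that(1)] mult_left_mono[OF that(2) bounded_linear_onD(2)[OF K]] by simp
  then show ?thesis by (auto intro!: bdd_aboveI2)
qed

lemma operator_norm_nonneg:
  assumes "T \<in> bounded_operators V nm"
  shows "0 \<le> operator_norm V nm T"
proof -
  have T0: "T \<zero> \<in> carrier V" using assms by (auto simp: bounded_operators_def)
  have "nm (T \<zero>) \<le> operator_norm V nm T"
    unfolding operator_norm_def by (rule cSUP_upper[OF _ operator_norm_bdd_above[OF assms]]) simp
  then show ?thesis using nm_nonneg[OF T0] by simp
qed

lemma operator_norm_bound:
  assumes T: "T \<in> bounded_operators V nm" and x: "x \<in> carrier V"
  shows "nm (T x) \<le> operator_norm V nm T * nm x"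
proof (cases "nm x = 0")
  case True
  then have "x = \<zero>" using x by (simp add: nm_eq_0)
  moreover have "T (0 \<odot> \<zero>) = 0 \<odot> T \<zero>" "T \<zero> \<in> carrier V"
    using T M.zero_closed unfolding bounded_operators_def by blast+
  ultimately show ?thesis by simp
next
  case False
  then have pos: "nm x > 0" using nm_nonneg[OF x] by simp
  define y where "y = complex_of_real (1 / nm x) \<odot> x"
  have y: "y \<in> carrier V" "nm y \<le> 1" using x pos by (simp_all add: y_def nm_scale norm_divide)
  have "nm (T y) \<le> operator_norm V nm T"
    unfolding operator_norm_def by (rule cSUP_upper[OF _ operator_norm_bdd_above[OF T]]) (use y in simp)
  moreover have "T y = complex_of_real (1 / nm x) \<odot> T x" "T x \<in> carrier V"
    using T x by (auto simp: y_def bounded_operators_def)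
  ultimately show ?thesis using pos by (simp add: nm_scale norm_divide field_simps)
qed

lemma operator_norm_le:
  assumes T: "T \<in> carrier V \<rightarrow> carrier V" and "\<And>x. x \<in> carrier V \<Longrightarrow> nm (T x) \<le> K * nm x" "0 \<le> K"
  shows "operator_norm V nm T \<le> K"
  unfolding operator_norm_def
proof (rule cSUP_least)
  show "{x \<in> carrier V. nm x \<le> 1} \<noteq> {}" using zero_closed by (auto intro!: exI[of _ \<zero>])
  fix x assume "x \<in> {x \<in> carrier V. nm x \<le> 1}"
  then show "nm (T x) \<le> K" using assms(2)[of x] mult_left_mono[of "nm x" 1 K] assms(3) by simp
qed

end

context cstar_algebra
begin

abbreviation "mult_alg \<equiv> multiplier_algebra A"

abbreviation "bA \<equiv> bounded_operators A (nrm A)"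

abbreviation "emb \<equiv> multiplier_embedding A"

lemma multiplier_simps:
  "fst (m \<otimes>\<^bsub>mult_alg\<^esub> n) = compose (carrier A) (fst m) (fst n)"
  "snd (m \<otimes>\<^bsub>mult_alg\<^esub> n) = compose (carrier A) (snd n) (snd m)"
  "fst (m \<oplus>\<^bsub>mult_alg\<^esub> n) = (\<lambda>b\<in>carrier A. fst m b \<oplus> fst n b)"
  "snd (m \<oplus>\<^bsub>mult_alg\<^esub> n) = (\<lambda>b\<in>carrier A. snd m b \<oplus> snd n b)"
  "fst (c \<odot>\<^bsub>mult_alg\<^esub> m) = (\<lambda>b\<in>carrier A. c \<odot> fst m b)"
  "snd (c \<odot>\<^bsub>mult_alg\<^esub> m) = (\<lambda>b\<in>carrier A. c \<odot> snd m b)"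
  "fst (star mult_alg m) = (\<lambda>b\<in>carrier A. star A (snd m (star A b)))"
  "fst \<one>\<^bsub>mult_alg\<^esub> = (\<lambda>b\<in>carrier A. b)"
  "fst \<zero>\<^bsub>mult_alg\<^esub> = (\<lambda>b\<in>carrier A. \<zero>)"
  "snd \<zero>\<^bsub>mult_alg\<^esub> = (\<lambda>b\<in>carrier A. \<zero>)"
  "nrm mult_alg m = operator_norm A (nrm A) (fst m)"
  by (simp_all add: multiplier_algebra_def case_prod_beta)

lemma multiplier_iff:
  "m \<in> carrier mult_alg \<longleftrightarrow> fst m \<in> bA \<and> snd m \<in> bA \<and>
    (\<forall>a\<in>carrier A. \<forall>b\<in>carrier A. fst m (a \<otimes> b) = fst m a \<otimes> b \<and>
      snd m (a \<otimes> b) = a \<otimes> snd m b \<and> snd m a \<otimes> b = a \<otimes> fst m b)"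
  by (simp add: multiplier_algebra_def case_prod_beta)

lemma bA_D:
  assumes "T \<in> bA"
  shows "x \<in> carrier A \<Longrightarrow> T x \<in> carrier A"
    "\<lbrakk>x \<in> carrier A; y \<in> carrier A\<rbrakk> \<Longrightarrow> T (x \<oplus> y) = T x \<oplus> T y"
    "x \<in> carrier A \<Longrightarrow> T (c \<odot> x) = c \<odot> T x"
  using assms by (auto simp: bounded_operators_def)

lemma multD:
  assumes "m \<in> carrier mult_alg"
  shows "x \<in> carrier A \<Longrightarrow> fst m x \<in> carrier A"
    "\<lbrakk>x \<in> carrier A; y \<in> carrier A\<rbrakk> \<Longrightarrow> fst m (x \<oplus> y) = fst m x \<oplus> fst m y"
    "x \<in> carrier A \<Longrightarrow> fst m (c \<odot> x) = c \<odot> fst m x"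
    "\<lbrakk>x \<in> carrier A; y \<in> carrier A\<rbrakk> \<Longrightarrow> fst m (x \<otimes> y) = fst m x \<otimes> y"
    "\<lbrakk>x \<in> carrier A; y \<in> carrier A\<rbrakk> \<Longrightarrow> fst m (x \<ominus> y) = fst m x \<ominus> fst m y"
    "x \<in> carrier A \<Longrightarrow> snd m x \<in> carrier A"
    "\<lbrakk>x \<in> carrier A; y \<in> carrier A\<rbrakk> \<Longrightarrow> snd m x \<otimes> y = x \<otimes> fst m y"
    "fst m \<in> bA" "snd m \<in> bA"
proof -
  have f: "fst m \<in> bA" "snd m \<in> bA" using assms by (simp_all add: multiplier_iff)
  then show "fst m \<in> bA" "snd m \<in> bA" by auto
  show "x \<in> carrier A \<Longrightarrow> fst m x \<in> carrier A" "x \<in> carrier A \<Longrightarrow> snd m x \<in> carrier A"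
    "\<lbrakk>x \<in> carrier A; y \<in> carrier A\<rbrakk> \<Longrightarrow> fst m (x \<oplus> y) = fst m x \<oplus> fst m y"
    "x \<in> carrier A \<Longrightarrow> fst m (c \<odot> x) = c \<odot> fst m x"
    using bA_D[OF f(1)] bA_D[OF f(2)] by auto
  then show "\<lbrakk>x \<in> carrier A; y \<in> carrier A\<rbrakk> \<Longrightarrow> fst m (x \<ominus> y) = fst m x \<ominus> fst m y"
    using bA_D[OF f(1)] by (simp add: minus_eq_scale)
  show "\<lbrakk>x \<in> carrier A; y \<in> carrier A\<rbrakk> \<Longrightarrow> fst m (x \<otimes> y) = fst m x \<otimes> y"
    "\<lbrakk>x \<in> carrier A; y \<in> carrier A\<rbrakk> \<Longrightarrow> snd m x \<otimes> y = x \<otimes> fst m y"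
    using assms by (simp_all add: multiplier_iff)
qed

lemma multiplier_star_adjoint:
  assumes m: "m \<in> carrier mult_alg" and "b \<in> carrier A" "c \<in> carrier A"
  shows "star A (fst m b) \<otimes> c = star A b \<otimes> fst (star mult_alg m) c"
proof -
  have "star A (fst m b) \<otimes> c = star A (star A c \<otimes> fst m b)"
    using assms multD[OF m] by (simp add: star_mult)
  also have "star A c \<otimes> fst m b = snd m (star A c) \<otimes> b" using assms multD(7)[OF m, of "star A c" b] by simp
  also have "star A (snd m (star A c) \<otimes> b) = star A b \<otimes> fst (star mult_alg m) c"
    using assms multD(6)[OF m] by (simp add: star_mult multiplier_simps)
  finally show ?thesis .
qed

text \<open>
  The right part of a multiplier is determined by the left one because \<open>R(a) b = a L(b)\<close>.
\<close>

lemma multiplier_eqI: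
  assumes m: "m \<in> carrier mult_alg" and n: "n \<in> carrier mult_alg"
    and eq: "\<And>x. x \<in> carrier A \<Longrightarrow> fst m x = fst n x"
  shows "m = n"
proof (rule prod_eqI)
  have f: "fst m \<in> carrier A \<rightarrow>\<^sub>E carrier A" "fst n \<in> carrier A \<rightarrow>\<^sub>E carrier A"
    "snd m \<in> carrier A \<rightarrow>\<^sub>E carrier A" "snd n \<in> carrier A \<rightarrow>\<^sub>E carrier A"
    using m n by (auto simp: multiplier_iff bounded_operators_def)
  show "fst m = fst n" using eq by (rule PiE_ext[OF f(1,2)])
  have "snd m x = snd n x" if x: "x \<in> carrier A" for x
  proof (rule left_mult_inj)
    fix z assume "z \<in> carrier A"
    then show "snd m x \<otimes> z = snd n x \<otimes> z" using x eq by (simp add: multD(7)[OF m] multD(7)[OF n])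
  qed (use x multD(6)[OF m] multD(6)[OF n] in auto)
  then show "snd m = snd n" by (rule PiE_ext[OF f(3,4)])
qed

lemma bA_I:
  assumes "\<And>x. x \<in> carrier A \<Longrightarrow> T x \<in> carrier A"
    "\<And>x y. \<lbrakk>x \<in> carrier A; y \<in> carrier A\<rbrakk> \<Longrightarrow> T (x \<oplus> y) = T x \<oplus> T y"
    "\<And>c x. x \<in> carrier A \<Longrightarrow> T (c \<odot> x) = c \<odot> T x"
    "\<And>x. x \<in> carrier A \<Longrightarrow> nrm A (T x) \<le> K * nrm A x"
  shows "restrict T (carrier A) \<in> bA"
proof -
  have "\<exists>K. \<forall>x\<in>carrier A. nrm A (restrict T (carrier A) x) \<le> K * nrm A x"
    using assms(4) by (intro exI[of _ K]) simp
  then show ?thesis using assms(1-3) by (auto simp: bounded_operators_def)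
qed

lemma bA_compose:
  assumes S: "S \<in> bA" and T: "T \<in> bA"
  shows "compose (carrier A) S T \<in> bA"
  unfolding compose_def
proof (rule bA_I)
  fix x assume x: "x \<in> carrier A"
  have "nrm A (S (T x)) \<le> operator_norm A (nrm A) S * nrm A (T x)"
    by (rule operator_norm_bound[OF S bA_D(1)[OF T x]])
  also have "\<dots> \<le> operator_norm A (nrm A) S * (operator_norm A (nrm A) T * nrm A x)"
    by (rule mult_left_mono[OF operator_norm_bound[OF T x] operator_norm_nonneg[OF S]])
  finally show "nrm A (S (T x)) \<le> (operator_norm A (nrm A) S * operator_norm A (nrm A) T) * nrm A x"
    by (simp add: mult.assoc)
qed (simp_all add: bA_D[OF S] bA_D[OF T])

lemma bA_add:
  assumes S: "S \<in> bA" and T: "T \<in> bA"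
  shows "(\<lambda>b\<in>carrier A. S b \<oplus> T b) \<in> bA"
proof (rule bA_I)
  fix x assume x: "x \<in> carrier A"
  show "nrm A (S x \<oplus> T x) \<le> (operator_norm A (nrm A) S + operator_norm A (nrm A) T) * nrm A x"
    using nrm_triangle[of "S x" "T x"] operator_norm_bound[OF S x] operator_norm_bound[OF T x] x
    by (simp add: bA_D[OF S] bA_D[OF T] semiring_class.distrib_right)
qed (simp_all add: bA_D[OF S] bA_D[OF T] M.a_ac scale_add_right)

lemma bA_scale:
  assumes S: "S \<in> bA"
  shows "(\<lambda>b\<in>carrier A. c \<odot> S b) \<in> bA"
proof (rule bA_I)
  fix x assume x: "x \<in> carrier A"
  show "nrm A (c \<odot> S x) \<le> (cmod c * operator_norm A (nrm A) S) * nrm A x"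
    using mult_left_mono[OF operator_norm_bound[OF S x], of "cmod c"] x
    by (simp add: bA_D[OF S] nrm_smult mult.assoc)
qed (simp_all add: bA_D[OF S] scale_add_right scale_scale mult.commute)

lemma multiplier_mult_closed:
  assumes m: "m \<in> carrier mult_alg" and n: "n \<in> carrier mult_alg"
  shows "m \<otimes>\<^bsub>mult_alg\<^esub> n \<in> carrier mult_alg"
proof -
  have "snd m (a \<otimes> b) = a \<otimes> snd m b" "snd n (a \<otimes> b) = a \<otimes> snd n b" if "a \<in> carrier A" "b \<in> carrier A" for a b
    using m n that by (simp_all add: multiplier_iff)
  then show ?thesis
    using multD[OF m] multD[OF n]
    unfolding multiplier_iff multiplier_simps by (simp add: bA_compose compose_eq)
qed

lemma multiplier_add_closed:
  assumes m: "m \<in> carrier mult_alg" and n: "n \<in> carrier mult_alg"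
  shows "m \<oplus>\<^bsub>mult_alg\<^esub> n \<in> carrier mult_alg"
proof -
  have "snd m (a \<otimes> b) = a \<otimes> snd m b" "snd n (a \<otimes> b) = a \<otimes> snd n b" if "a \<in> carrier A" "b \<in> carrier A" for a b
    using m n that by (simp_all add: multiplier_iff)
  then show ?thesis
    using multD[OF m] multD[OF n]
    unfolding multiplier_iff multiplier_simps by (simp add: bA_add distrib_left distrib_right)
qed

lemma multiplier_scale_closed:
  assumes m: "m \<in> carrier mult_alg"
  shows "c \<odot>\<^bsub>mult_alg\<^esub> m \<in> carrier mult_alg"
proof -
  have "snd m (a \<otimes> b) = a \<otimes> snd m b" if "a \<in> carrier A" "b \<in> carrier A" for a b
    using m that by (simp add: multiplier_iff)
  then show ?thesis
    using multD[OF m]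
    unfolding multiplier_iff multiplier_simps by (simp add: bA_scale smult_mult_left smult_mult_right)
qed

lemma multiplier_zero_closed: "\<zero>\<^bsub>mult_alg\<^esub> \<in> carrier mult_alg"
proof -
  have "(\<lambda>b\<in>carrier A. \<zero>) \<in> bA" by (rule bA_I[of _ 0]) auto
  then show ?thesis unfolding multiplier_iff multiplier_simps by simp
qed

text \<open>
  The closures and spans in the description of a crossed product are taken in the multiplier algebra,
  which for that reason has to be known to be a normed space.
\<close>

lemma multiplier_normed_cspace: "normed_cspace mult_alg (nrm mult_alg)"
proof -
  note cl [simp] = multiplier_add_closed multiplier_scale_closed multiplier_zero_closed
  have ab: "abelian_group mult_alg"
  proof (rule abelian_groupI)
    fix x assume x: "x \<in> carrier mult_alg"
    show "\<exists>y\<in>carrier mult_alg. y \<oplus>\<^bsub>mult_alg\<^esub> x = \<zero>\<^bsub>mult_alg\<^esub>"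
      using x multD[OF x]
      by (intro bexI[of _ "(-1) \<odot>\<^bsub>mult_alg\<^esub> x"] multiplier_eqI)
        (simp_all add: multiplier_simps uminus_eq_scale[symmetric] M.l_neg)
  qed ((intro multiplier_eqI)?; simp add: multiplier_simps multD M.a_ac)+
  have mod: "Module.module complex_ring mult_alg"
    by (rule moduleI[OF cring_complex_ring ab])
      ((intro multiplier_eqI)?; simp add: multiplier_simps multD scale_add_left scale_add_right scale_scale)+
  then interpret mm: cspace mult_alg by (simp add: cspace_def)
  have le: "operator_norm A (nrm A) (fst (c \<odot>\<^bsub>mult_alg\<^esub> m)) \<le> cmod c * operator_norm A (nrm A) (fst m)"
    if m: "m \<in> carrier mult_alg" for c m
  proof (rule operator_norm_le)
    fix x assume x: "x \<in> carrier A"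
    show "nrm A (fst (c \<odot>\<^bsub>mult_alg\<^esub> m) x) \<le> cmod c * operator_norm A (nrm A) (fst m) * nrm A x"
      using mult_left_mono[OF operator_norm_bound[OF multD(8)[OF m] x], of "cmod c"] x
      by (simp add: multiplier_simps nrm_smult multD[OF m] mult.assoc)
  qed (use multD[OF m] operator_norm_nonneg[OF multD(8)[OF m]] in \<open>auto simp: multiplier_simps\<close>)
  show ?thesis
  proof
    fix x assume x: "x \<in> carrier mult_alg"
    show "0 \<le> nrm mult_alg x" using operator_norm_nonneg[OF multD(8)[OF x]] by (simp add: multiplier_simps)
    show "nrm mult_alg x = 0 \<longleftrightarrow> x = \<zero>\<^bsub>mult_alg\<^esub>"
    proof
      assume "nrm mult_alg x = 0"
      then have "nrm A (fst x b) \<le> 0" if "b \<in> carrier A" for b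
        using operator_norm_bound[OF multD(8)[OF x] that] by (simp add: multiplier_simps)
      then have "fst x b = \<zero>" if "b \<in> carrier A" for b
        using that nrm_nonneg nrm_eq_0 multD(1)[OF x that] by (metis antisym)
      then show "x = \<zero>\<^bsub>mult_alg\<^esub>"
        using x by (intro multiplier_eqI) (simp_all add: multiplier_simps)
    next
      assume "x = \<zero>\<^bsub>mult_alg\<^esub>"
      then have "x = 0 \<odot>\<^bsub>mult_alg\<^esub> x" using x by simp
      then have "nrm mult_alg x \<le> 0" using le[OF x, of 0] by (simp add: multiplier_simps(11))
      then show "nrm mult_alg x = 0" using \<open>0 \<le> nrm mult_alg x\<close> by simp
    qed
    show "nrm mult_alg (c \<odot>\<^bsub>mult_alg\<^esub> x) = cmod c * nrm mult_alg x" for c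
    proof (cases "c = 0")
      case True
      have "nrm mult_alg (c \<odot>\<^bsub>mult_alg\<^esub> x) \<le> cmod c * nrm mult_alg x"
        using le[OF x, of c] by (simp add: multiplier_simps(11))
      moreover have "0 \<le> nrm mult_alg (c \<odot>\<^bsub>mult_alg\<^esub> x)"
        unfolding multiplier_simps(11) using x by (intro operator_norm_nonneg multD(8)) simp
      ultimately show ?thesis using True by simp
    next
      case False
      have "inverse c \<odot>\<^bsub>mult_alg\<^esub> (c \<odot>\<^bsub>mult_alg\<^esub> x) = x" using False x by (simp add: mm.scale_scale)
      then have "nrm mult_alg x \<le> cmod (inverse c) * nrm mult_alg (c \<odot>\<^bsub>mult_alg\<^esub> x)"
        using le[of "c \<odot>\<^bsub>mult_alg\<^esub> x" "inverse c"] x by (simp add: multiplier_simps(11))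
      then have "cmod c * nrm mult_alg x \<le> nrm mult_alg (c \<odot>\<^bsub>mult_alg\<^esub> x)"
        using False by (simp add: norm_inverse norm_divide field_simps)
      then show ?thesis using le[OF x, of c] by (simp add: multiplier_simps(11))
    qed
    fix y assume y: "y \<in> carrier mult_alg"
    show "nrm mult_alg (x \<oplus>\<^bsub>mult_alg\<^esub> y) \<le> nrm mult_alg x + nrm mult_alg y"
      unfolding multiplier_simps(11)
    proof (rule operator_norm_le)
      fix b assume b: "b \<in> carrier A"
      show "nrm A (fst (x \<oplus>\<^bsub>mult_alg\<^esub> y) b) \<le>
          (operator_norm A (nrm A) (fst x) + operator_norm A (nrm A) (fst y)) * nrm A b"
        using nrm_triangle[of "fst x b" "fst y b"] operator_norm_bound[OF multD(8)[OF x] b]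
          operator_norm_bound[OF multD(8)[OF y] b] b
        by (simp add: multiplier_simps multD[OF x] multD[OF y] semiring_class.distrib_right)
    qed (use multD[OF x] multD[OF y] operator_norm_nonneg[OF multD(8)[OF x]]
        operator_norm_nonneg[OF multD(8)[OF y]] in \<open>auto simp: multiplier_simps\<close>)
  qed
qed

lemma multiplier_norm_le:
  assumes m: "m \<in> carrier mult_alg" and "0 \<le> K"
    and "\<And>b. b \<in> carrier A \<Longrightarrow> nrm A (fst m b) \<le> K * nrm A b"
  shows "nrm mult_alg m \<le> K"
  unfolding multiplier_simps(11) by (rule operator_norm_le) (use assms multD(1)[OF m] in auto)

lemma emb_simps:
  "x \<in> carrier A \<Longrightarrow> fst (emb b) x = b \<otimes> x"
  by (simp add: multiplier_embedding_def)

lemma emb_closed: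
  assumes b: "b \<in> carrier A"
  shows "emb b \<in> carrier mult_alg"
proof -
  have "(\<lambda>x\<in>carrier A. b \<otimes> x) \<in> bA"
    by (rule bA_I[where K = "nrm A b"]) (use b nrm_mult in \<open>auto simp: distrib_left smult_mult_right\<close>)
  moreover have "(\<lambda>x\<in>carrier A. x \<otimes> b) \<in> bA"
    by (rule bA_I[where K = "nrm A b"])
      (use b nrm_mult in \<open>auto simp: distrib_right smult_mult_left mult.commute[of "nrm A b"]\<close>)
  ultimately show ?thesis
    using b unfolding multiplier_iff multiplier_embedding_def by (auto simp: mult_assoc)
qed

lemma emb_eqI:
  assumes "m \<in> carrier mult_alg" "b \<in> carrier A" "\<And>x. x \<in> carrier A \<Longrightarrow> fst m x = b \<otimes> x"
  shows "m = emb b"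
  using assms by (intro multiplier_eqI emb_closed) (simp_all add: emb_simps)

lemma emb_inj: "\<lbrakk>emb b = emb c; b \<in> carrier A; c \<in> carrier A\<rbrakk> \<Longrightarrow> b = c"
  by (rule left_mult_inj) (auto simp: emb_simps[symmetric])

lemma emb_add: "\<lbrakk>b \<in> carrier A; c \<in> carrier A\<rbrakk> \<Longrightarrow> emb (b \<oplus> c) = emb b \<oplus>\<^bsub>mult_alg\<^esub> emb c"
  by (rule emb_eqI[symmetric])
    (simp_all add: multiplier_add_closed emb_closed multiplier_simps emb_simps distrib_right)

lemma emb_scale: "b \<in> carrier A \<Longrightarrow> emb (k \<odot> b) = k \<odot>\<^bsub>mult_alg\<^esub> emb b"
  by (rule emb_eqI[symmetric])
    (simp_all add: multiplier_scale_closed emb_closed multiplier_simps emb_simps smult_mult_left)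

lemma emb_zero: "emb \<zero> = \<zero>\<^bsub>mult_alg\<^esub>"
  by (rule emb_eqI[symmetric]) (simp_all add: multiplier_zero_closed multiplier_simps)

lemma emb_norm:
  assumes b: "b \<in> carrier A"
  shows "nrm mult_alg (emb b) = nrm A b"
proof (rule antisym)
  show "nrm mult_alg (emb b) \<le> nrm A b"
    using b by (intro multiplier_norm_le emb_closed) (simp_all add: nrm_nonneg emb_simps nrm_mult)
  have "nrm A (b \<otimes> star A b) \<le> nrm mult_alg (emb b) * nrm A (star A b)"
    using operator_norm_bound[OF multD(8)[OF emb_closed[OF b]], of "star A b"] b
    by (simp add: multiplier_simps(11) emb_simps)
  then have "nrm A b * nrm A b \<le> nrm mult_alg (emb b) * nrm A b"
    using nrm_star_mult[of "star A b"] b by (simp add: power2_eq_square)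
  moreover have "0 \<le> nrm mult_alg (emb b)"
    using operator_norm_nonneg[OF multD(8)[OF emb_closed[OF b]]] by (simp add: multiplier_simps(11))
  ultimately show "nrm A b \<le> nrm mult_alg (emb b)"
    using nrm_nonneg[OF b] by (cases "nrm A b = 0") auto
qed

text \<open>
  The algebraic crossed product is defined through a span in the multiplier algebra; this turns it into
  a span in the algebra itself.
\<close>

lemma cspan_emb:
  assumes E: "E \<subseteq> carrier A" and b: "b \<in> carrier A"
  shows "emb b \<in> cspan mult_alg (emb ` E) \<longleftrightarrow> b \<in> cspan A E"
proof
  interpret mm: normed_cspace mult_alg "nrm mult_alg" by (rule multiplier_normed_cspace)
  have EM: "emb ` E \<subseteq> carrier mult_alg" using E emb_closed by blast
  show "emb b \<in> cspan mult_alg (emb ` E)" if "b \<in> cspan A E"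
    using that E
  proof (induction rule: cspan_induct)
    case (gen x)
    then show ?case using mm.cspan_submodule(2)[OF EM] by blast
  next
    case zero
    then show ?case using mm.cspan_submodule(1)[OF EM] by (simp add: emb_zero mm.submodule_iff)
  next
    case (add x y)
    then show ?case using mm.cspan_submodule(1)[OF EM] cspan_submodule(3)[OF E]
      by (auto simp: emb_add mm.submodule_iff subset_iff)
  next
    case (scale c x)
    then show ?case using mm.cspan_submodule(1)[OF EM] cspan_submodule(3)[OF E]
      by (auto simp: emb_scale mm.submodule_iff subset_iff)
  qed
  have "cspan mult_alg (emb ` E) \<subseteq> emb ` cspan A E"
  proof (rule mm.cspan_minimal)
    note c = cspan_submodule[OF E]
    show "submodule (emb ` cspan A E) complex_ring mult_alg"
      unfolding mm.submodule_iff
    proof (intro conjI ballI allI)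
      show "emb ` cspan A E \<subseteq> carrier mult_alg" using c(3) emb_closed by blast
      show "\<zero>\<^bsub>mult_alg\<^esub> \<in> emb ` cspan A E"
        using c(1) by (auto simp: emb_zero[symmetric] submodule_iff)
      fix x assume "x \<in> emb ` cspan A E"
      then obtain x' where x: "x = emb x'" "x' \<in> cspan A E" by blast
      show "k \<odot>\<^bsub>mult_alg\<^esub> x \<in> emb ` cspan A E" for k
        using x c(1,3) by (auto simp: emb_scale[symmetric] submodule_iff subset_iff)
      fix y assume "y \<in> emb ` cspan A E"
      then obtain y' where y: "y = emb y'" "y' \<in> cspan A E" by blast
      show "x \<oplus>\<^bsub>mult_alg\<^esub> y \<in> emb ` cspan A E"
        using x y c(1,3) by (auto simp: emb_add[symmetric] submodule_iff subset_iff)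
    qed
    show "emb ` E \<subseteq> emb ` cspan A E" using c(2) by blast
  qed
  then show "b \<in> cspan A E" if "emb b \<in> cspan mult_alg (emb ` E)"
    using that emb_inj b cspan_submodule(3)[OF E] by blast
qed

end

section \<open>Bounded functions and closed *-subalgebras\<close>

lemma linf_simps [simp]:
  "f \<otimes>\<^bsub>linf N\<^esub> h = (\<lambda>x. f x * h x)" "f \<oplus>\<^bsub>linf N\<^esub> h = (\<lambda>x. f x + h x)"
  "\<zero>\<^bsub>linf N\<^esub> = (\<lambda>x. 0)" "c \<odot>\<^bsub>linf N\<^esub> f = (\<lambda>x. c * f x)"
  "star (linf N) f = (\<lambda>x. cnj (f x))" "nrm (linf N) f = (SUP x\<in>N. cmod (f x))"
  by (simp_all add: linf_def)

lemma linf_carrier: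
  "f \<in> carrier (linf N) \<longleftrightarrow> (\<forall>x. x \<notin> N \<longrightarrow> f x = 0) \<and> (\<exists>K. \<forall>x\<in>N. cmod (f x) \<le> K)"
  by (auto simp: linf_def bounded_iff)

lemma linf_nrm_ge:
  assumes "f \<in> carrier (linf N)" "x \<in> N"
  shows "cmod (f x) \<le> nrm (linf N) f"
proof -
  obtain K where K: "\<forall>x\<in>N. cmod (f x) \<le> K" using assms by (auto simp: linf_carrier)
  show ?thesis
    unfolding linf_simps by (rule cSUP_upper[OF assms(2) bdd_aboveI2[of _ _ K]]) (use K in simp)
qed

lemma linf_nrm_le:
  assumes "N \<noteq> {}" "\<And>x. x \<in> N \<Longrightarrow> cmod (f x) \<le> K"
  shows "nrm (linf N) f \<le> K"
  unfolding linf_simps by (rule cSUP_least) (use assms in auto)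

lemma linf_carrier_add:
  assumes "f \<in> carrier (linf N)" "h \<in> carrier (linf N)"
  shows "(\<lambda>x. f x + h x) \<in> carrier (linf N)"
proof -
  obtain K L where "\<forall>x\<in>N. cmod (f x) \<le> K" "\<forall>x\<in>N. cmod (h x) \<le> L"
    using assms by (auto simp: linf_carrier)
  then have "\<forall>x\<in>N. cmod (f x + h x) \<le> K + L" by (meson add_mono norm_triangle_le)
  then show ?thesis using assms unfolding linf_carrier by auto
qed

lemma linf_carrier_mult:
  assumes "f \<in> carrier (linf N)" "h \<in> carrier (linf N)"
  shows "(\<lambda>x. f x * h x) \<in> carrier (linf N)"
proof -
  obtain K where K: "\<forall>x\<in>N. cmod (f x) \<le> K" using assms(1) by (auto simp: linf_carrier)
  obtain L where L: "\<forall>x\<in>N. cmod (h x) \<le> L" using assms(2) by (auto simp: linf_carrier)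
  have "cmod (f x * h x) \<le> K * L" if "x \<in> N" for x
    unfolding norm_mult using K L that order_trans[OF norm_ge_zero] by (intro mult_mono) auto
  then show ?thesis using assms unfolding linf_carrier by auto
qed

lemma linf_carrier_scale:
  assumes "f \<in> carrier (linf N)"
  shows "(\<lambda>x. c * f x) \<in> carrier (linf N)"
proof -
  obtain K where K: "\<And>x. x \<in> N \<Longrightarrow> cmod (f x) \<le> K" using assms by (auto simp: linf_carrier)
  have "cmod (c * f x) \<le> cmod c * K" if "x \<in> N" for x
    unfolding norm_mult using K[OF that] by (intro mult_left_mono) auto
  then show ?thesis using assms unfolding linf_carrier by auto
qed

lemma linf_module: "Module.module complex_ring (linf N)"
proof (rule moduleI[OF cring_complex_ring])
  show "abelian_group (linf N)"
  proof (rule abelian_groupI)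
    fix f assume f: "f \<in> carrier (linf N)"
    show "\<exists>h\<in>carrier (linf N). h \<oplus>\<^bsub>linf N\<^esub> f = \<zero>\<^bsub>linf N\<^esub>"
      by (intro bexI[of _ "\<lambda>x. -1 * f x"] linf_carrier_scale f) simp
  qed (auto simp: linf_carrier_add, auto simp: linf_carrier)
qed (auto simp: linf_carrier_scale fun_eq_iff algebra_simps)

lemma linf_cstar:
  assumes N: "N \<noteq> {}"
  shows "cstar_algebra (linf N)"
proof -
  interpret cs: cspace "linf N" unfolding cspace_def by (rule linf_module)
  note minus = cs.minus_eq_scale
  have star_carrier: "(\<lambda>x. cnj (f x)) \<in> carrier (linf N)" if "f \<in> carrier (linf N)" for f
    using that by (auto simp: linf_carrier)
  have nonneg: "0 \<le> nrm (linf N) f" if "f \<in> carrier (linf N)" for f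
    using N linf_nrm_ge[OF that] norm_ge_zero order_trans by blast
  have n: "normed_cspace (linf N) (nrm (linf N))"
  proof
    fix f assume f: "f \<in> carrier (linf N)"
    show "0 \<le> nrm (linf N) f" by (rule nonneg[OF f])
    show "nrm (linf N) f = 0 \<longleftrightarrow> f = \<zero>\<^bsub>linf N\<^esub>"
    proof
      assume "nrm (linf N) f = 0"
      then have "f x = 0" if "x \<in> N" for x using linf_nrm_ge[OF f that] by simp
      then show "f = \<zero>\<^bsub>linf N\<^esub>" using f by (auto simp: linf_carrier fun_eq_iff)
    next
      assume "f = \<zero>\<^bsub>linf N\<^esub>"
      then have "nrm (linf N) f \<le> 0" by (intro linf_nrm_le[OF N]) simp
      then show "nrm (linf N) f = 0" using nonneg[OF f] by simp
    qed
    have le: "nrm (linf N) (c \<odot>\<^bsub>linf N\<^esub> h) \<le> cmod c * nrm (linf N) h" if h: "h \<in> carrier (linf N)" for c h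
      using linf_nrm_ge[OF h] by (intro linf_nrm_le[OF N]) (simp add: norm_mult mult_left_mono del: linf_simps(6))
    show "nrm (linf N) (c \<odot>\<^bsub>linf N\<^esub> f) = cmod c * nrm (linf N) f" for c
    proof (cases "c = 0")
      case True
      then show ?thesis using N by simp
    next
      case False
      have "inverse c \<odot>\<^bsub>linf N\<^esub> (c \<odot>\<^bsub>linf N\<^esub> f) = f" using False by (simp add: fun_eq_iff)
      then have "nrm (linf N) f \<le> cmod (inverse c) * nrm (linf N) (c \<odot>\<^bsub>linf N\<^esub> f)"
        using le[of "c \<odot>\<^bsub>linf N\<^esub> f" "inverse c"] linf_carrier_scale[OF f] by (simp del: linf_simps(6))
      then have "cmod c * nrm (linf N) f \<le> nrm (linf N) (c \<odot>\<^bsub>linf N\<^esub> f)"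
        using False by (simp add: norm_inverse norm_divide field_simps del: linf_simps)
      then show ?thesis using le[OF f, of c] by simp
    qed
    fix h assume h: "h \<in> carrier (linf N)"
    show "nrm (linf N) (f \<oplus>\<^bsub>linf N\<^esub> h) \<le> nrm (linf N) f + nrm (linf N) h"
      using linf_nrm_ge[OF f] linf_nrm_ge[OF h]
      by (intro linf_nrm_le[OF N]) (auto intro!: norm_triangle_le add_mono simp del: linf_simps(6))
  qed
  then interpret n: normed_cspace "linf N" "nrm (linf N)" .
  have complete: "norm_complete (linf N) (nrm (linf N))"
    unfolding n.norm_complete_iff
  proof (intro allI impI)
    fix s :: "nat \<Rightarrow> 'a \<Rightarrow> complex"
    assume "(\<forall>n. s n \<in> carrier (linf N)) \<and>
      (\<forall>e>0. \<exists>n0. \<forall>m\<ge>n0. \<forall>n\<ge>n0. nrm (linf N) (s m \<ominus>\<^bsub>linf N\<^esub> s n) < e)"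
    then have s: "\<And>n. s n \<in> carrier (linf N)"
      and cauchy: "\<And>e. e > 0 \<Longrightarrow> \<exists>n0. \<forall>m\<ge>n0. \<forall>n\<ge>n0. nrm (linf N) (s m \<ominus>\<^bsub>linf N\<^esub> s n) < e" by auto
    have diff: "s m \<ominus>\<^bsub>linf N\<^esub> s n = (\<lambda>x. s m x - s n x)" for m n using s by (simp add: minus)
    have pt: "cmod (s m x - s n x) \<le> nrm (linf N) (s m \<ominus>\<^bsub>linf N\<^esub> s n)" if "x \<in> N" for m n x
      using linf_nrm_ge[OF cs.M.minus_closed[OF s s] that, of m n] by (simp add: diff)
    define g where "g x = (if x \<in> N then lim (\<lambda>n. s n x) else 0)" for x
    have lim: "(\<lambda>n. s n x) \<longlonglongrightarrow> g x" if "x \<in> N" for x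
    proof -
      have "Cauchy (\<lambda>n. s n x)"
        unfolding Cauchy_def dist_norm using cauchy pt[OF that] by (meson le_less_trans)
      then show ?thesis using that by (simp add: g_def Cauchy_convergent_iff convergent_LIMSEQ_iff)
    qed
    have unif: "\<exists>n0. \<forall>n\<ge>n0. \<forall>x\<in>N. cmod (s n x - g x) \<le> e" if e: "e > 0" for e
    proof -
      obtain n0 where n0: "\<forall>m\<ge>n0. \<forall>n\<ge>n0. nrm (linf N) (s m \<ominus>\<^bsub>linf N\<^esub> s n) < e" using cauchy[OF e] by blast
      have "cmod (s n x - g x) \<le> e" if "n \<ge> n0" "x \<in> N" for n x
      proof (rule LIMSEQ_le_const2)
        show "(\<lambda>m. cmod (s n x - s m x)) \<longlonglongrightarrow> cmod (s n x - g x)"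
          by (intro tendsto_intros lim that)
        show "\<exists>n1. \<forall>m\<ge>n1. cmod (s n x - s m x) \<le> e"
          using n0 that pt[OF that(2), of n] by (intro exI[of _ n0]) (meson less_imp_le order_trans)
      qed
      then show ?thesis by blast
    qed
    have g: "g \<in> carrier (linf N)"
    proof -
      obtain n0 where n0: "\<forall>n\<ge>n0. \<forall>x\<in>N. cmod (s n x - g x) \<le> 1" using unif[of 1] by auto
      have "cmod (g x) \<le> nrm (linf N) (s n0) + 1" if "x \<in> N" for x
        using linf_nrm_ge[OF s[of n0] that] n0[rule_format, of n0 x] that
          norm_triangle_sub[of "g x" "s n0 x"] norm_minus_commute[of "g x" "s n0 x"] by (simp del: linf_simps)
      then show ?thesis unfolding linf_carrier by (auto simp: g_def)
    qed
    have "(\<lambda>n. nrm (linf N) (s n \<ominus>\<^bsub>linf N\<^esub> g)) \<longlonglongrightarrow> 0"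
    proof (rule LIMSEQ_I)
      fix r :: real assume "r > 0"
      then obtain n0 where n0: "\<forall>n\<ge>n0. \<forall>x\<in>N. cmod (s n x - g x) \<le> r / 2" using unif[of "r/2"] by auto
      have "norm (nrm (linf N) (s n \<ominus>\<^bsub>linf N\<^esub> g) - 0) < r" if "n \<ge> n0" for n
      proof -
        have "nrm (linf N) (s n \<ominus>\<^bsub>linf N\<^esub> g) \<le> r / 2"
          using n0 that s g by (intro linf_nrm_le[OF N]) (simp add: minus)
        moreover have "0 \<le> nrm (linf N) (s n \<ominus>\<^bsub>linf N\<^esub> g)" using s g by (intro nonneg cs.M.minus_closed)
        ultimately show ?thesis using \<open>r > 0\<close> by simp
      qed
      then show "\<exists>no. \<forall>n\<ge>no. norm (nrm (linf N) (s n \<ominus>\<^bsub>linf N\<^esub> g) - 0) < r" by blast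
    qed
    then show "\<exists>v. converges (linf N) (nrm (linf N)) s v" using s g by (auto simp: converges_def)
  qed
  show ?thesis
  proof
    fix f assume f: "f \<in> carrier (linf N)"
    show "0 \<le> nrm (linf N) f" "(nrm (linf N) f = 0) = (f = \<zero>\<^bsub>linf N\<^esub>)"
      using n.nm_nonneg[OF f] n.nm_eq_0[OF f] by auto
    show "nrm (linf N) (c \<odot>\<^bsub>linf N\<^esub> f) = cmod c * nrm (linf N) f" for c by (rule n.nm_scale[OF f])
    show "star (linf N) f \<in> carrier (linf N)" using star_carrier[OF f] by simp
    show "nrm (linf N) (star (linf N) f \<otimes>\<^bsub>linf N\<^esub> f) = (nrm (linf N) f)\<^sup>2"
    proof (rule antisym)
      have sq: "cmod ((star (linf N) f \<otimes>\<^bsub>linf N\<^esub> f) x) = (cmod (f x))\<^sup>2" for x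
        by (simp add: norm_mult power2_eq_square)
      have ff: "star (linf N) f \<otimes>\<^bsub>linf N\<^esub> f \<in> carrier (linf N)"
        using linf_carrier_mult[OF star_carrier[OF f] f] by simp
      show "nrm (linf N) (star (linf N) f \<otimes>\<^bsub>linf N\<^esub> f) \<le> (nrm (linf N) f)\<^sup>2"
        by (rule linf_nrm_le[OF N]) (use linf_nrm_ge[OF f] in \<open>simp only: sq power_mono norm_ge_zero\<close>)
      have "nrm (linf N) f \<le> sqrt (nrm (linf N) (star (linf N) f \<otimes>\<^bsub>linf N\<^esub> f))"
        by (rule linf_nrm_le[OF N]) (use linf_nrm_ge[OF ff] in \<open>simp only: sq real_le_rsqrt\<close>)
      then show "(nrm (linf N) f)\<^sup>2 \<le> nrm (linf N) (star (linf N) f \<otimes>\<^bsub>linf N\<^esub> f)"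
        using nonneg[OF f] nonneg[OF ff] by (metis power_mono real_sqrt_pow2)
    qed
    fix h assume h: "h \<in> carrier (linf N)"
    show "f \<otimes>\<^bsub>linf N\<^esub> h \<in> carrier (linf N)" using linf_carrier_mult[OF f h] by simp
    show "nrm (linf N) (f \<oplus>\<^bsub>linf N\<^esub> h) \<le> nrm (linf N) f + nrm (linf N) h" by (rule n.nm_triangle[OF f h])
    show "nrm (linf N) (f \<otimes>\<^bsub>linf N\<^esub> h) \<le> nrm (linf N) f * nrm (linf N) h"
      using linf_nrm_ge[OF f] linf_nrm_ge[OF h] nonneg[OF f]
      by (intro linf_nrm_le[OF N]) (auto simp: norm_mult simp del: linf_simps(6) intro!: mult_mono)
  qed (use complete in \<open>simp_all add: fun_eq_iff algebra_simps\<close>)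
qed

context cstar_algebra
begin

lemma cstar_subalgebra:
  assumes S: "star_subalgebra S A" and closed: "norm_closure A (nrm A) S = S"
  shows "cstar_algebra (A\<lparr>carrier := S\<rparr>)"
proof -
  have sm: "submodule S complex_ring A" using S by (simp add: star_subalgebra_def)
  then have Sc: "S \<subseteq> carrier A" by (simp add: submodule_iff)
  then have Sc' [simp]: "x \<in> S \<Longrightarrow> x \<in> carrier A" for x by blast
  have mod: "Module.module complex_ring (A\<lparr>carrier := S\<rparr>)"
    by (rule submodule.submodule_is_module[OF sm module_axioms])
  interpret n: normed_cspace "A\<lparr>carrier := S\<rparr>" "nrm A"
    unfolding normed_cspace_def cspace_def normed_cspace_axioms_def
    using mod by (auto simp: nrm_nonneg nrm_eq_0 nrm_triangle nrm_smult)
  have minus: "x \<ominus>\<^bsub>A\<lparr>carrier := S\<rparr>\<^esub> y = x \<ominus> y" if "x \<in> S" "y \<in> S" for x y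
    using that by (simp add: minus_eq_scale n.minus_eq_scale)
  have "norm_complete (A\<lparr>carrier := S\<rparr>) (nrm A)"
    unfolding n.norm_complete_iff
  proof (intro allI impI)
    fix s :: "nat \<Rightarrow> 'a"
    assume "(\<forall>n. s n \<in> carrier (A\<lparr>carrier := S\<rparr>)) \<and>
      (\<forall>e>0. \<exists>n0. \<forall>m\<ge>n0. \<forall>n\<ge>n0. nrm A (s m \<ominus>\<^bsub>A\<lparr>carrier := S\<rparr>\<^esub> s n) < e)"
    then have s: "\<forall>n. s n \<in> S" and "\<forall>e>0. \<exists>n0. \<forall>m\<ge>n0. \<forall>n\<ge>n0. nrm A (s m \<ominus> s n) < e"
      by (auto simp: minus)
    then obtain v where v: "converges A (nrm A) s v"
      using complete[unfolded norm_complete_iff, rule_format, of s] by auto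
    then have "v \<in> S" using norm_closure_seq[OF Sc] s closed by blast
    then show "\<exists>v. converges (A\<lparr>carrier := S\<rparr>) (nrm A) s v"
      using v s by (intro exI[of _ v]) (simp add: converges_def minus)
  qed
  then show ?thesis
    using S mod
    by unfold_locales (auto simp: star_subalgebra_def mult_assoc distrib_left distrib_right smult_mult_left
        smult_mult_right star_add star_smult star_mult nrm_nonneg nrm_eq_0 nrm_triangle nrm_smult nrm_mult
        nrm_star_mult intro!: Module.module.axioms)
qed

lemma star_subalgebra_norm_closure:
  assumes S: "star_subalgebra S A"
  shows "star_subalgebra (norm_closure A (nrm A) S) A"
proof -
  have sm: "submodule S complex_ring A" and mult: "\<And>x y. x \<in> S \<Longrightarrow> y \<in> S \<Longrightarrow> x \<otimes> y \<in> S"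
    and star: "\<And>x. x \<in> S \<Longrightarrow> star A x \<in> S" using S by (simp_all add: star_subalgebra_def)
  then have Sc: "S \<subseteq> carrier A" by (simp add: submodule_iff)
  note seq = norm_closure_seq[OF Sc]
  show ?thesis
    unfolding star_subalgebra_def
  proof (intro conjI ballI submodule_norm_closure[OF sm])
    fix x assume "x \<in> norm_closure A (nrm A) S"
    then obtain s where s: "\<And>n. s n \<in> S" "converges A (nrm A) s x" using seq by blast
    show "star A x \<in> norm_closure A (nrm A) S"
      unfolding seq using converges_star[OF s(2)] s(1) star by (intro exI[of _ "\<lambda>n. star A (s n)"]) simp
    fix y assume "y \<in> norm_closure A (nrm A) S"
    then obtain t where t: "\<And>n. t n \<in> S" "converges A (nrm A) t y" using seq by blast
    show "x \<otimes> y \<in> norm_closure A (nrm A) S"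
      unfolding seq using converges_mult[OF s(2) t(2)] s(1) t(1) mult
      by (intro exI[of _ "\<lambda>n. s n \<otimes> t n"]) simp
  qed
qed

lemma cstar_generated_closed:
  assumes "P \<subseteq> carrier A"
  shows "star_subalgebra (cstar_generated A P) A"
    and "norm_closure A (nrm A) (cstar_generated A P) = cstar_generated A P"
proof -
  define \<S> where "\<S> = {S. star_subalgebra S A \<and> norm_closure A (nrm A) S = S \<and> P \<subseteq> S}"
  have C: "carrier A \<in> \<S>"
    using assms norm_closure_increasing[of "carrier A"] norm_closure_subset
    by (auto simp: \<S>_def star_subalgebra_def submodule_iff)
  have g: "cstar_generated A P = \<Inter>\<S>" by (simp add: cstar_generated_def \<S>_def)
  have sub: "\<Inter>\<S> \<subseteq> carrier A" using C by blast
  show "star_subalgebra (cstar_generated A P) A"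
    unfolding g star_subalgebra_def submodule_iff using sub by (auto simp: \<S>_def star_subalgebra_def submodule_iff)
  have "norm_closure A (nrm A) (\<Inter>\<S>) \<subseteq> S" if "S \<in> \<S>" for S
    using norm_closure_mono[of "\<Inter>\<S>" S] that by (auto simp: \<S>_def)
  then show "norm_closure A (nrm A) (cstar_generated A P) = cstar_generated A P"
    unfolding g using norm_closure_increasing[OF sub] by blast
qed

lemma cstar_generated_eq_closure:
  assumes S: "star_subalgebra (cspan A P) A" and P: "P \<subseteq> carrier A"
  shows "norm_closure A (nrm A) (cspan A P) = cstar_generated A P"
proof
  have c: "cspan A P \<subseteq> carrier A" by (rule cspan_submodule(3)[OF P])
  show "cstar_generated A P \<subseteq> norm_closure A (nrm A) (cspan A P)"
    unfolding cstar_generated_def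
    using star_subalgebra_norm_closure[OF S] norm_closure_closure cspan_submodule(2)[OF P]
      norm_closure_increasing[OF c] by blast
  have "cspan A P \<subseteq> cstar_generated A P"
    by (rule cspan_minimal) (use cstar_generated_closed[OF P] in \<open>auto simp: star_subalgebra_def cstar_generated_def\<close>)
  then show "norm_closure A (nrm A) (cspan A P) \<subseteq> cstar_generated A P"
    using norm_closure_mono cstar_generated_closed(2)[OF P] by blast
qed

end

section \<open>Step functions on the normal subgroup\<close>

locale coset_system = group G for G :: "('g, 'm) monoid_scheme" (structure) +
  fixes N H M :: "'g set"
  assumes N_normal: "N \<lhd> G" and H_subgroup: "subgroup H G"
    and NH_inter: "N \<inter> H = {\<one>}" and NH_prod: "N <#> H = carrier G"
    and M_normal: "M \<lhd> G\<lparr>carrier := N\<rparr>"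
    and filter_base: "\<And>U V. \<lbrakk>U \<in> conjugates G H M; V \<in> conjugates G H M\<rbrakk> \<Longrightarrow>
      \<exists>W\<in>conjugates G H M. W \<subseteq> U \<inter> V"
    and finite_quotients: "\<And>U V. \<lbrakk>U \<in> conjugates G H M; V \<in> conjugates G H M; V \<subseteq> U\<rbrakk> \<Longrightarrow>
      finite {x <# V |x. x \<in> U}"
begin

abbreviation "\<U> \<equiv> conjugates G H M"

abbreviation "DA \<equiv> D_algebra G N H M"

lemma N_subgroup: "subgroup N G"
  using N_normal by (rule normal_imp_subgroup)

lemma carrier_subsets [simp]:
  "x \<in> N \<Longrightarrow> x \<in> carrier G" "a \<in> H \<Longrightarrow> a \<in> carrier G"
  using subgroup.mem_carrier[OF N_subgroup] subgroup.mem_carrier[OF H_subgroup] by auto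

lemma inv_cancel [simp]:
  "\<lbrakk>x \<in> carrier G; y \<in> carrier G\<rbrakk> \<Longrightarrow> x \<otimes> (inv x \<otimes> y) = y"
  "\<lbrakk>x \<in> carrier G; y \<in> carrier G\<rbrakk> \<Longrightarrow> inv x \<otimes> (x \<otimes> y) = y"
  by (simp_all add: m_assoc[symmetric])

lemma N_closed [simp]:
  "\<one> \<in> N" "\<lbrakk>x \<in> N; y \<in> N\<rbrakk> \<Longrightarrow> x \<otimes> y \<in> N" "x \<in> N \<Longrightarrow> inv x \<in> N"
  using subgroup.one_closed[OF N_subgroup] subgroup.m_closed[OF N_subgroup]
    subgroup.m_inv_closed[OF N_subgroup] by auto

lemma H_closed [simp]:
  "\<one> \<in> H" "\<lbrakk>x \<in> H; y \<in> H\<rbrakk> \<Longrightarrow> x \<otimes> y \<in> H" "x \<in> H \<Longrightarrow> inv x \<in> H"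
  using subgroup.one_closed[OF H_subgroup] subgroup.m_closed[OF H_subgroup]
    subgroup.m_inv_closed[OF H_subgroup] by auto

lemma N_conj: "\<lbrakk>g \<in> carrier G; x \<in> N\<rbrakk> \<Longrightarrow> g \<otimes> x \<otimes> inv g \<in> N"
  using N_normal by (simp add: normal.inv_op_closed2)

lemma decomposition: "g \<in> carrier G \<Longrightarrow> \<exists>x\<in>N. \<exists>a\<in>H. g = x \<otimes> a"
  unfolding NH_prod[symmetric] set_mult_def by auto

lemma decomposition_unique:
  assumes "x \<in> N" "a \<in> H" "y \<in> N" "b \<in> H" and eq: "x \<otimes> a = y \<otimes> b"
  shows "x = y" "a = b"
proof -
  have "inv y \<otimes> x = b \<otimes> inv a"
  proof -
    have "inv y \<otimes> (x \<otimes> a) \<otimes> inv a = inv y \<otimes> (y \<otimes> b) \<otimes> inv a" by (simp add: eq)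
    then show ?thesis using assms(1-4) by (simp add: m_assoc)
  qed
  moreover have "inv y \<otimes> x \<in> N" "b \<otimes> inv a \<in> H" using assms by auto
  ultimately have "inv y \<otimes> x = \<one>" using NH_inter by auto
  then have "y \<otimes> (inv y \<otimes> x) = y" using assms by simp
  then show "x = y" using assms by simp
  then show "a = b" using eq assms by simp
qed

lemma parts:
  assumes "x \<in> N" "a \<in> H"
  shows "N_part G N H (x \<otimes> a) = x" "H_part G N H (x \<otimes> a) = a"
  unfolding N_part_def H_part_def
  by (rule the_equality; use assms decomposition_unique in blast)+

lemma beta_eq:
  assumes "x \<in> N" "a \<in> H"
  shows "beta G N H (x \<otimes> a) y = x \<otimes> a \<otimes> y \<otimes> inv a"
  using assms by (simp add: beta_def parts)

lemma inv_decomposition: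
  assumes "x \<in> N" "a \<in> H"
  shows "inv (x \<otimes> a) = (inv a \<otimes> inv x \<otimes> a) \<otimes> inv a" "inv a \<otimes> inv x \<otimes> a \<in> N"
  using assms N_conj[of "inv a" "inv x"] by (simp_all add: inv_mult_group m_assoc)

lemma beta_closed: "\<lbrakk>g \<in> carrier G; y \<in> N\<rbrakk> \<Longrightarrow> beta G N H g y \<in> N"
  using decomposition[of g] N_conj[of _ y]
  by (auto simp: beta_eq m_assoc[of _ _ y] m_assoc[of _ "_ \<otimes> y"])

lemma beta_inv:
  assumes "g \<in> carrier G" "y \<in> N"
  shows "beta G N H g (beta G N H (inv g) y) = y" "beta G N H (inv g) (beta G N H g y) = y"
proof -
  obtain x a where g: "x \<in> N" "a \<in> H" "g = x \<otimes> a" using decomposition[OF assms(1)] by blast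
  note i = inv_decomposition[OF g(1,2)]
  have "beta G N H (inv g) z = inv a \<otimes> inv x \<otimes> z \<otimes> a" if "z \<in> N" for z
    unfolding g(3) i(1) using beta_eq[OF i(2) H_closed(3)[OF g(2)], of z] g that by (simp add: m_assoc)
  then show "beta G N H g (beta G N H (inv g) y) = y" "beta G N H (inv g) (beta G N H g y) = y"
    using g assms beta_closed[OF assms] by (simp_all add: beta_eq m_assoc)
qed

lemma conjugates_iff: "U \<in> \<U> \<longleftrightarrow> (\<exists>a\<in>H. U = (\<lambda>m. a \<otimes> m \<otimes> inv a) ` M)"
proof -
  have "a <# M #> inv a = (\<lambda>m. a \<otimes> m \<otimes> inv a) ` M" for a by (auto simp: l_coset_def r_coset_def)
  then show ?thesis by (auto simp: conjugates_def)
qed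

lemma M_subgroup: "subgroup M G"
  using incl_subgroup[OF N_subgroup normal_imp_subgroup[OF M_normal]] .

lemma M_subset_N: "M \<subseteq> N"
  using subgroup.subset[OF normal_imp_subgroup[OF M_normal]] by simp

lemma conjugate_subgroup:
  assumes "U \<in> \<U>"
  shows "subgroup U G" "U \<subseteq> N"
proof -
  obtain a where a: "a \<in> H" and U: "U = (\<lambda>m. a \<otimes> m \<otimes> inv a) ` M" using assms conjugates_iff by blast
  note MG [simp] = subgroup.mem_carrier[OF M_subgroup]
  show "U \<subseteq> N" using a M_subset_N N_conj by (auto simp: U)
  then show "subgroup U G"
  proof (intro subgroup.intro)
    show "\<one> \<in> U" unfolding U using a subgroup.one_closed[OF M_subgroup] by (intro image_eqI[of _ _ \<one>]) auto
    show "u \<otimes> v \<in> U" if uv: "u \<in> U" "v \<in> U" for u v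
    proof -
      obtain m n where mn: "m \<in> M" "u = a \<otimes> m \<otimes> inv a" "n \<in> M" "v = a \<otimes> n \<otimes> inv a"
        using uv U by blast
      then show ?thesis unfolding U using a subgroup.m_closed[OF M_subgroup mn(1,3)]
        by (intro image_eqI[of _ _ "m \<otimes> n"]) (simp_all add: m_assoc)
    qed
    show "inv u \<in> U" if u: "u \<in> U" for u
    proof -
      obtain m where m: "m \<in> M" "u = a \<otimes> m \<otimes> inv a" using u U by blast
      then show ?thesis unfolding U using a subgroup.m_inv_closed[OF M_subgroup m(1)]
        by (intro image_eqI[of _ _ "inv m"]) (simp_all add: m_assoc inv_mult_group)
    qed
  qed auto
qed

lemma conjugate_mem [simp]:
  assumes "U \<in> \<U>"
  shows "u \<in> U \<Longrightarrow> u \<in> N" "u \<in> U \<Longrightarrow> u \<in> carrier G" "\<one> \<in> U" "\<lbrakk>u \<in> U; v \<in> U\<rbrakk> \<Longrightarrow> u \<otimes> v \<in> U"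
    "u \<in> U \<Longrightarrow> inv u \<in> U"
  using conjugate_subgroup[OF assms] subgroup.one_closed subgroup.m_closed subgroup.m_inv_closed
    subgroup.mem_carrier by auto

lemma conjugate_conjugate:
  assumes "U \<in> \<U>" "a \<in> H"
  shows "(\<lambda>u. a \<otimes> u \<otimes> inv a) ` U \<in> \<U>"
proof -
  obtain b where b: "b \<in> H" and U: "U = (\<lambda>m. b \<otimes> m \<otimes> inv b) ` M" using assms conjugates_iff by blast
  have "(\<lambda>u. a \<otimes> u \<otimes> inv a) ` U = (\<lambda>m. (a \<otimes> b) \<otimes> m \<otimes> inv (a \<otimes> b)) ` M"
    unfolding U image_image using assms b subgroup.mem_carrier[OF M_subgroup]
    by (intro image_cong) (simp_all add: m_assoc inv_mult_group)
  then show ?thesis using assms b unfolding conjugates_iff by (intro bexI[of _ "a \<otimes> b"]) auto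
qed

lemma mem_coset: "y \<in> x <# U \<longleftrightarrow> (\<exists>u\<in>U. y = x \<otimes> u)"
  by (auto simp: l_coset_def)

lemma coset_eq: "\<lbrakk>U \<in> \<U>; x \<in> N; y \<in> x <# U\<rbrakk> \<Longrightarrow> y <# U = x <# U"
  using l_repr_independence[of y x U] conjugate_subgroup(1)[of U] by simp

lemma self_mem_coset: "\<lbrakk>U \<in> \<U>; x \<in> N\<rbrakk> \<Longrightarrow> x \<in> x <# U"
  unfolding mem_coset by (rule bexI[of _ \<one>]) auto

lemma coset_subset: "\<lbrakk>U \<in> \<U>; x \<in> N\<rbrakk> \<Longrightarrow> x <# U \<subseteq> N"
  by (auto simp: mem_coset)

text \<open>
  These are the locally constant functions of compact support when the cosets of the members of the
  filter base are taken as a base of open sets.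
\<close>

definition step_functions :: "('g \<Rightarrow> complex) set"
  where "step_functions = {f. (\<forall>x. x \<notin> N \<longrightarrow> f x = 0) \<and> (\<exists>U\<in>\<U>.
    (\<forall>x\<in>N. \<forall>u\<in>U. f (x \<otimes> u) = f x) \<and> finite {x <# U |x. x \<in> N \<and> f x \<noteq> 0})}"

text \<open>
  By finiteness of the quotients, a coset of \<open>U\<close> is a union of finitely many cosets of \<open>W\<close>.
\<close>

lemma finite_cosets_refine:
  fixes S :: "'g set"
  assumes "U \<in> \<U>" "W \<in> \<U>" "W \<subseteq> U" "S \<subseteq> N" and fin: "finite {x <# U |x. x \<in> S}"
  shows "finite {x <# W |x. x \<in> S}"
proof -
  have sub: "{x <# W |x. x \<in> S} \<subseteq> (\<Union>C\<in>{x <# U |x. x \<in> S}. {y <# W |y. y \<in> C})"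
    using self_mem_coset[OF assms(1)] assms(4) by blast
  have "finite {y <# W |y. y \<in> x <# U}" if "x \<in> S" for x
  proof -
    have x: "x \<in> N" using assms(4) that by blast
    have "{y <# W |y. y \<in> x <# U} \<subseteq> (\<lambda>C. x <# C) ` {u <# W |u. u \<in> U}"
    proof
      fix C assume "C \<in> {y <# W |y. y \<in> x <# U}"
      then obtain u where u: "u \<in> U" "C = (x \<otimes> u) <# W" by (auto simp: mem_coset)
      have "(x \<otimes> u) <# W = x <# (u <# W)"
        using u x assms(1,2) conjugate_subgroup(1)[OF assms(2)]
        by (intro lcos_m_assoc[symmetric]) (auto dest: subgroup.subset)
      then show "C \<in> (\<lambda>C. x <# C) ` {u <# W |u. u \<in> U}" using u by blast
    qed
    then show ?thesis using finite_quotients[OF assms(1,2,3)] finite_surj by blast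
  qed
  then show ?thesis using finite_subset[OF sub] fin by auto
qed

text \<open>
  One member of the filter base contained in two given ones serves both functions. Closure of
  the step functions under products, conjugation, supports and square roots is a case of this.
\<close>

lemma step_functions_combine:
  assumes f: "f \<in> step_functions" and g: "g \<in> step_functions" and h: "h 0 0 = 0"
  shows "(\<lambda>x. h (f x) (g x)) \<in> step_functions"
proof -
  obtain U where U: "U \<in> \<U>" "\<forall>x\<in>N. \<forall>u\<in>U. f (x \<otimes> u) = f x" "finite {x <# U |x. x \<in> {x \<in> N. f x \<noteq> 0}}"
    using f by (auto simp: step_functions_def)
  obtain V where V: "V \<in> \<U>" "\<forall>x\<in>N. \<forall>u\<in>V. g (x \<otimes> u) = g x" "finite {x <# V |x. x \<in> {x \<in> N. g x \<noteq> 0}}"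
    using g by (auto simp: step_functions_def)
  obtain W where W: "W \<in> \<U>" "W \<subseteq> U" "W \<subseteq> V" using filter_base[OF U(1) V(1)] by blast
  have "finite {x <# W |x. x \<in> {x \<in> N. f x \<noteq> 0}}" "finite {x <# W |x. x \<in> {x \<in> N. g x \<noteq> 0}}"
    using finite_cosets_refine[OF U(1) W(1,2) _ U(3)] finite_cosets_refine[OF V(1) W(1,3) _ V(3)] by auto
  then have "finite ({x <# W |x. x \<in> {x \<in> N. f x \<noteq> 0}} \<union> {x <# W |x. x \<in> {x \<in> N. g x \<noteq> 0}})" by simp
  moreover have "{x <# W |x. x \<in> N \<and> h (f x) (g x) \<noteq> 0} \<subseteq>
      {x <# W |x. x \<in> {x \<in> N. f x \<noteq> 0}} \<union> {x <# W |x. x \<in> {x \<in> N. g x \<noteq> 0}}"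
  proof
    fix C assume "C \<in> {x <# W |x. x \<in> N \<and> h (f x) (g x) \<noteq> 0}"
    then obtain x where x: "C = x <# W" "x \<in> N" "h (f x) (g x) \<noteq> 0" by blast
    then have "f x \<noteq> 0 \<or> g x \<noteq> 0" using h by auto
    then show "C \<in> {x <# W |x. x \<in> {x \<in> N. f x \<noteq> 0}} \<union> {x <# W |x. x \<in> {x \<in> N. g x \<noteq> 0}}"
      using x(1,2) by blast
  qed
  ultimately have "finite {x <# W |x. x \<in> N \<and> h (f x) (g x) \<noteq> 0}" by (rule rev_finite_subset)
  moreover have "\<forall>x\<in>N. \<forall>u\<in>W. h (f (x \<otimes> u)) (g (x \<otimes> u)) = h (f x) (g x)"
    using U(2) V(2) W(2,3) by (metis subsetD)
  ultimately show ?thesis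
    using W(1) f g h unfolding step_functions_def by auto
qed

lemma step_functions_map:
  assumes f: "f \<in> step_functions" and h: "h 0 = 0"
  shows "(\<lambda>x. h (f x)) \<in> step_functions"
  using step_functions_combine[OF f f, of "\<lambda>a b. h a"] h by simp

lemma step_function_bounded:
  assumes f: "f \<in> step_functions"
  shows "f \<in> carrier (linf N)"
proof -
  obtain U where U: "U \<in> \<U>" "\<forall>x\<in>N. \<forall>u\<in>U. f (x \<otimes> u) = f x" "finite {x <# U |x. x \<in> N \<and> f x \<noteq> 0}"
    using f by (auto simp: step_functions_def)
  define v where "v C = f (SOME y. y \<in> C)" for C
  have v: "v (x <# U) = f x" if "x \<in> N" for x
  proof -
    have "(SOME y. y \<in> x <# U) \<in> x <# U" using self_mem_coset[OF U(1) that] by (rule someI)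
    then show ?thesis using U(2) that by (auto simp: mem_coset v_def)
  qed
  have "(\<lambda>x. cmod (f x)) ` N \<subseteq> insert 0 ((\<lambda>C. cmod (v C)) ` {x <# U |x. x \<in> N \<and> f x \<noteq> 0})"
  proof
    fix r assume "r \<in> (\<lambda>x. cmod (f x)) ` N"
    then obtain x where x: "x \<in> N" "r = cmod (f x)" by blast
    show "r \<in> insert 0 ((\<lambda>C. cmod (v C)) ` {x <# U |x. x \<in> N \<and> f x \<noteq> 0})"
    proof (cases "f x = 0")
      case False
      then show ?thesis using x v[OF x(1)] by (intro insertI2 image_eqI[of _ _ "x <# U"]) auto
    qed (use x in simp)
  qed
  then have "finite ((\<lambda>x. cmod (f x)) ` N)" using U(3) by (meson finite_imageI finite_insert finite_subset)
  then have "\<exists>K. \<forall>x\<in>N. cmod (f x) \<le> K" using bdd_above_finite by (fastforce simp: bdd_above_def)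
  then show ?thesis using f by (auto simp: linf_carrier step_functions_def)
qed

lemma indicator_step_function:
  assumes x: "x \<in> N" and U: "U \<in> \<U>"
  shows "indicator (x <# U) \<in> step_functions"
proof -
  have mem: "y \<otimes> u \<in> x <# U \<longleftrightarrow> y \<in> x <# U" if y: "y \<in> N" and u: "u \<in> U" for y u
  proof
    assume "y \<in> x <# U"
    then obtain w where "w \<in> U" "y = x \<otimes> w" by (auto simp: mem_coset)
    then show "y \<otimes> u \<in> x <# U" unfolding mem_coset using u U x
      by (intro bexI[of _ "w \<otimes> u"]) (auto simp: m_assoc)
  next
    assume "y \<otimes> u \<in> x <# U"
    then obtain w where w: "w \<in> U" "y \<otimes> u = x \<otimes> w" by (auto simp: mem_coset)
    have "y = (y \<otimes> u) \<otimes> inv u" using y u U by (simp add: m_assoc)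
    also have "\<dots> = x \<otimes> (w \<otimes> inv u)" unfolding w(2) using w(1) u U x by (simp add: m_assoc)
    finally show "y \<in> x <# U" unfolding mem_coset using w(1) u U by (intro bexI[of _ "w \<otimes> inv u"]) auto
  qed
  have "{y <# U |y. y \<in> N \<and> (indicator (x <# U) y :: complex) \<noteq> 0} \<subseteq> {x <# U}"
    using coset_eq[OF U x] by (auto simp: indicator_def split: if_splits)
  then have "finite {y <# U |y. y \<in> N \<and> (indicator (x <# U) y :: complex) \<noteq> 0}"
    by (rule finite_subset) simp
  moreover have "\<forall>y\<in>N. \<forall>u\<in>U. (indicator (x <# U) (y \<otimes> u) :: complex) = indicator (x <# U) y"
    using mem by (auto simp: indicator_def)
  moreover have "\<forall>y. y \<notin> N \<longrightarrow> (indicator (x <# U) y :: complex) = 0"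
    using coset_subset[OF U x] by (auto simp: indicator_def)
  ultimately show ?thesis using U unfolding step_functions_def by blast
qed

lemma linf_N_cstar: "cstar_algebra (linf N)"
  by (rule linf_cstar) (use N_closed(1) in blast)

lemma coset_projections_carrier: "coset_projections G N H M \<subseteq> carrier (linf N)"
  using step_function_bounded indicator_step_function by (auto simp: coset_projections_def)

lemma step_functions_submodule: "submodule step_functions complex_ring (linf N)"
proof -
  interpret cstar_algebra "linf N" by (rule linf_N_cstar)
  have "\<U> \<noteq> {}" using H_closed(1) conjugates_iff by blast
  then have "(\<lambda>x. 0) \<in> step_functions" by (auto simp: step_functions_def)
  moreover have "(\<lambda>x. f x + g x) \<in> step_functions" if "f \<in> step_functions" "g \<in> step_functions" for f g
    using step_functions_combine[OF that, of "(+)"] by simp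
  moreover have "(\<lambda>x. c * f x) \<in> step_functions" if "f \<in> step_functions" for c f
    using step_functions_map[OF that, of "(*) c"] by simp
  ultimately show ?thesis using step_function_bounded by (simp add: submodule_iff subset_iff)
qed

lemma step_functions_star_subalgebra: "star_subalgebra step_functions (linf N)"
  unfolding star_subalgebra_def linf_simps
  using step_functions_submodule step_functions_combine[of _ _ "(*)"] step_functions_map[of _ cnj] by simp

text \<open>
  A step function is the sum, over the finitely many cosets in its support, of its value there times
  the indicator of the coset.
\<close>

lemma D0_eq_step_functions: "D0_set G N H M = step_functions"
proof
  interpret cstar_algebra "linf N" by (rule linf_N_cstar)
  show "D0_set G N H M \<subseteq> step_functions"
    unfolding D0_set_def
    by (rule cspan_minimal[OF step_functions_submodule])
      (use indicator_step_function in \<open>auto simp: coset_projections_def\<close>)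
  define S where "S = cspan (linf N) (coset_projections G N H M)"
  have "submodule S complex_ring (linf N)" and gen: "\<And>f. f \<in> coset_projections G N H M \<Longrightarrow> f \<in> S"
    using cspan_submodule[OF coset_projections_carrier] by (auto simp: S_def)
  then have S_zero: "(\<lambda>x. 0) \<in> S"
    and S_add: "\<And>f h. \<lbrakk>f \<in> S; h \<in> S\<rbrakk> \<Longrightarrow> (\<lambda>x. f x + h x) \<in> S"
    and S_scale: "\<And>c f. f \<in> S \<Longrightarrow> (\<lambda>x. c * f x) \<in> S"
    by (simp_all add: submodule_iff)
  show "step_functions \<subseteq> D0_set G N H M"
  proof
    fix f assume f: "f \<in> step_functions"
    obtain U where U: "U \<in> \<U>" "\<forall>x\<in>N. \<forall>u\<in>U. f (x \<otimes> u) = f x" "finite {x <# U |x. x \<in> N \<and> f x \<noteq> 0}"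
      using f by (auto simp: step_functions_def)
    define F where "F = {x <# U |x. x \<in> N \<and> f x \<noteq> 0}"
    define v where "v C = f (SOME y. y \<in> C)" for C
    have v: "v (x <# U) = f x" if "x \<in> N" for x
    proof -
      have "(SOME y. y \<in> x <# U) \<in> x <# U" using self_mem_coset[OF U(1) that] by (rule someI)
      then show ?thesis using U(2) that by (auto simp: mem_coset v_def)
    qed
    have "(\<lambda>y. \<Sum>C\<in>E. v C * indicator C y) \<in> S" if "E \<subseteq> F" for E
    proof -
      have "finite E" using finite_subset[OF that] U(3) by (simp add: F_def)
      then show ?thesis using that
      proof (induction rule: finite_induct)
        case empty
        then show ?case using S_zero by simp
      next
        case (insert C E)
        then have "indicator C \<in> coset_projections G N H M" using U(1) by (auto simp: F_def coset_projections_def)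
        then have "(\<lambda>y. v C * indicator C y) \<in> S" by (intro S_scale gen)
        moreover have "(\<lambda>y. \<Sum>C\<in>E. v C * indicator C y) \<in> S" using insert by simp
        ultimately have "(\<lambda>y. v C * indicator C y + (\<Sum>C\<in>E. v C * indicator C y)) \<in> S" by (rule S_add)
        then show ?case by (simp only: sum.insert[OF insert.hyps(1,2)])
      qed
    qed
    from this[of F] have "(\<lambda>y. \<Sum>C\<in>F. v C * indicator C y) \<in> S" by simp
    moreover have "f = (\<lambda>y. \<Sum>C\<in>F. v C * indicator C y)"
    proof
      fix y
      have other: "v C * indicator C y = 0" if "C \<in> F" "C \<noteq> y <# U" for C
        using that coset_eq[OF U(1)] by (auto simp: F_def indicator_def)
      show "f y = (\<Sum>C\<in>F. v C * indicator C y)"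
      proof (cases "y \<in> N \<and> f y \<noteq> 0")
        case True
        then have yF: "y <# U \<in> F" by (auto simp: F_def)
        have "(\<Sum>C\<in>F. v C * indicator C y) = v (y <# U) * indicator (y <# U) y"
        proof -
          have finF: "finite F" using U(3) by (simp add: F_def)
          have "(\<Sum>C\<in>F - {y <# U}. v C * indicator C y) = 0" by (rule sum.neutral) (use other in blast)
          then show ?thesis by (simp only: sum.remove[OF finF yF] add_0_right)
        qed
        then show ?thesis using v True self_mem_coset[OF U(1)] by simp
      next
        case False
        have "v C * indicator C y = 0" if "C \<in> F" for C
        proof (cases "C = y <# U")
          case True
          then obtain x where x: "x \<in> N" "f x \<noteq> 0" "C = x <# U" using \<open>C \<in> F\<close> by (auto simp: F_def)
          have "y \<notin> C"
          proof
            assume "y \<in> C"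
            then obtain u where "u \<in> U" "y = x \<otimes> u" using x by (auto simp: mem_coset)
            then show False using False x U(1,2) by auto
          qed
          then show ?thesis by simp
        qed (use that other in blast)
        then have "(\<Sum>C\<in>F. v C * indicator C y) = 0" by (simp add: sum.neutral)
        then show ?thesis using False f by (auto simp: step_functions_def)
      qed
    qed
    ultimately show "f \<in> D0_set G N H M" unfolding D0_set_def S_def by simp
  qed
qed

lemma D_carrier: "carrier DA = norm_closure (linf N) (nrm (linf N)) step_functions"
proof -
  interpret cstar_algebra "linf N" by (rule linf_N_cstar)
  show ?thesis
    using cstar_generated_eq_closure[OF _ coset_projections_carrier] step_functions_star_subalgebra
    by (simp add: D_algebra_def D0_eq_step_functions[symmetric] D0_set_def)
qed

lemma D_simps:
  "f \<otimes>\<^bsub>DA\<^esub> h = (\<lambda>x. f x * h x)" "f \<oplus>\<^bsub>DA\<^esub> h = (\<lambda>x. f x + h x)" "\<zero>\<^bsub>DA\<^esub> = (\<lambda>x. 0)"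
  "c \<odot>\<^bsub>DA\<^esub> f = (\<lambda>x. c * f x)" "star DA f = (\<lambda>x. cnj (f x))" "nrm DA = nrm (linf N)"
  by (simp_all add: D_algebra_def linf_def)

lemma D_carrier_linf: "carrier DA \<subseteq> carrier (linf N)"
proof -
  interpret cstar_algebra "linf N" by (rule linf_N_cstar)
  show ?thesis unfolding D_carrier by (rule norm_closure_subset)
qed

lemma step_functions_D: "step_functions \<subseteq> carrier DA"
proof -
  interpret cstar_algebra "linf N" by (rule linf_N_cstar)
  show ?thesis unfolding D_carrier using step_function_bounded by (intro norm_closure_increasing) blast
qed

lemma D_cstar: "cstar_algebra DA"
proof -
  interpret cstar_algebra "linf N" by (rule linf_N_cstar)
  have "DA = linf N\<lparr>carrier := cstar_generated (linf N) (coset_projections G N H M)\<rparr>"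
    by (simp add: D_algebra_def)
  then show ?thesis using cstar_subalgebra[OF cstar_generated_closed[OF coset_projections_carrier]] by simp
qed

lemma D_minus:
  assumes "f \<in> carrier DA" "h \<in> carrier DA"
  shows "f \<ominus>\<^bsub>DA\<^esub> h = (\<lambda>x. f x - h x)" "f \<ominus>\<^bsub>linf N\<^esub> h = (\<lambda>x. f x - h x)"
proof -
  interpret D: cstar_algebra DA by (rule D_cstar)
  interpret l: cstar_algebra "linf N" by (rule linf_N_cstar)
  show "f \<ominus>\<^bsub>DA\<^esub> h = (\<lambda>x. f x - h x)" using assms by (simp add: D.minus_eq_scale D_simps)
  show "f \<ominus>\<^bsub>linf N\<^esub> h = (\<lambda>x. f x - h x)"
    using assms D_carrier_linf by (subst l.minus_eq_scale) auto
qed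

lemma step_functions_submodule_D: "submodule step_functions complex_ring DA"
proof -
  interpret D: cstar_algebra DA by (rule D_cstar)
  interpret l: cstar_algebra "linf N" by (rule linf_N_cstar)
  show ?thesis using step_functions_submodule step_functions_D
    by (simp add: D.submodule_iff l.submodule_iff D_simps)
qed

lemma step_functions_star_subalgebra_D: "star_subalgebra step_functions DA"
  using step_functions_submodule_D step_functions_star_subalgebra by (simp add: star_subalgebra_def D_simps)

lemma step_functions_dense: "norm_closure DA (nrm DA) step_functions = carrier DA"
proof -
  interpret D: cstar_algebra DA by (rule D_cstar)
  interpret l: cstar_algebra "linf N" by (rule linf_N_cstar)
  have "f \<in> norm_closure DA (nrm DA) step_functions" if f: "f \<in> carrier DA" for f
  proof -
    have "\<forall>e>0. \<exists>h\<in>step_functions. nrm (linf N) (h \<ominus>\<^bsub>linf N\<^esub> f) < e"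
      using f step_function_bounded unfolding D_carrier by (subst (asm) l.norm_closure_iff) blast+
    moreover have "h \<ominus>\<^bsub>DA\<^esub> f = h \<ominus>\<^bsub>linf N\<^esub> f" if "h \<in> step_functions" for h
      using D_minus[of h f] step_functions_D that f by auto
    ultimately show ?thesis
      unfolding D.norm_closure_iff[OF step_functions_D] using f by (simp add: D_simps(6) del: linf_simps)
  qed
  then show ?thesis using D.norm_closure_subset by blast
qed

lemma generated_by_projections:
  assumes "submodule W complex_ring DA" "coset_projections G N H M \<subseteq> W"
  shows "step_functions \<subseteq> W"
proof -
  interpret D: cstar_algebra DA by (rule D_cstar)
  interpret l: cstar_algebra "linf N" by (rule linf_N_cstar)
  have "submodule W complex_ring (linf N)"
    using assms(1) D_carrier_linf by (auto simp: l.submodule_iff D.submodule_iff D_simps)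
  then show ?thesis
    unfolding D0_eq_step_functions[symmetric] D0_set_def using assms(2) by (rule l.cspan_minimal)
qed

subsection \<open>The action\<close>

abbreviation "act \<equiv> alpha G N H"

text \<open>
  If \<open>g\<^sup>-\<^sup>1 = x a\<close>, then \<open>\<beta>(y w) = \<beta>(y) (a w a\<^sup>-\<^sup>1)\<close> for \<open>\<beta> = beta G N H (inv g)\<close>, so \<open>\<beta>\<close> takes cosets of \<open>a\<^sup>-\<^sup>1 U a\<close> to
  cosets of \<open>U\<close>.
\<close>

lemma act_step_function:
  assumes g: "g \<in> carrier G" and f: "f \<in> step_functions"
  shows "act g f \<in> step_functions"
proof -
  obtain U where U: "U \<in> \<U>" "\<forall>x\<in>N. \<forall>u\<in>U. f (x \<otimes> u) = f x" "finite {x <# U |x. x \<in> N \<and> f x \<noteq> 0}"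
    using f by (auto simp: step_functions_def)
  define b where "b = beta G N H (inv g)"
  have b: "b y \<in> N" if "y \<in> N" for y using that g by (simp add: b_def beta_closed)
  obtain x a where xa: "x \<in> N" "a \<in> H" "inv g = x \<otimes> a" using decomposition[of "inv g"] g by auto
  have b_eq: "b y = x \<otimes> a \<otimes> y \<otimes> inv a" for y using xa by (simp add: b_def beta_eq)
  \<comment> \<open>\<open>W = a\<^sup>-\<^sup>1 U a\<close>, so that \<open>b\<close> takes cosets of \<open>W\<close> to cosets of \<open>U\<close>\<close>
  define W where "W = (\<lambda>u. inv a \<otimes> u \<otimes> inv (inv a)) ` U"
  have W: "W \<in> \<U>" unfolding W_def using U(1) xa by (intro conjugate_conjugate) auto
  have bW: "\<exists>u\<in>U. b (y \<otimes> w) = b y \<otimes> u" if "y \<in> N" "w \<in> W" for y w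
  proof -
    obtain u where "u \<in> U" "w = inv a \<otimes> u \<otimes> a" using \<open>w \<in> W\<close> xa by (auto simp: W_def)
    then show ?thesis using that xa U(1) by (intro bexI[of _ u]) (auto simp: b_eq m_assoc)
  qed
  have bU: "\<exists>w\<in>W. b y \<otimes> u = b (y \<otimes> w)" if "y \<in> N" "u \<in> U" for y u
    unfolding W_def using that xa U(1) by (intro bexI[of _ "inv a \<otimes> u \<otimes> a"]) (auto simp: b_eq m_assoc)
  have img: "b ` (y <# W) = b y <# U" if "y \<in> N" for y
  proof
    show "b ` (y <# W) \<subseteq> b y <# U" using bW[OF that] by (auto simp: mem_coset)
    show "b y <# U \<subseteq> b ` (y <# W)" using bU[OF that] by (force simp: mem_coset)
  qed
  have inj: "inj_on b N" using beta_inv(1)[OF g] by (intro inj_on_inverseI[of _ "beta G N H g"]) (simp add: b_def)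
  have "(\<lambda>C. b ` C) ` {y <# W |y. y \<in> N \<and> f (b y) \<noteq> 0} \<subseteq> {z <# U |z. z \<in> N \<and> f z \<noteq> 0}"
  proof clarify
    fix y assume "y \<in> N" "f (b y) \<noteq> 0"
    then show "\<exists>z. b ` (y <# W) = z <# U \<and> z \<in> N \<and> f z \<noteq> 0"
      using img b by (intro exI[of _ "b y"]) simp
  qed
  then have "finite ((\<lambda>C. b ` C) ` {y <# W |y. y \<in> N \<and> f (b y) \<noteq> 0})" using U(3) by (rule finite_subset)
  moreover have "inj_on (\<lambda>C. b ` C) {y <# W |y. y \<in> N \<and> f (b y) \<noteq> 0}"
    by (rule inj_on_subset[OF inj_on_image_Pow[OF inj]]) (use coset_subset[OF W] in blast)
  ultimately have fin: "finite {y <# W |y. y \<in> N \<and> f (b y) \<noteq> 0}" by (rule finite_imageD)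
  have "{y <# W |y. y \<in> N \<and> act g f y \<noteq> 0} = {y <# W |y. y \<in> N \<and> f (b y) \<noteq> 0}"
    by (auto simp: alpha_def b_def)
  then have "finite {y <# W |y. y \<in> N \<and> act g f y \<noteq> 0}" using fin by simp
  moreover have "\<forall>y. y \<notin> N \<longrightarrow> act g f y = 0" by (simp add: alpha_def)
  moreover have "\<forall>y\<in>N. \<forall>w\<in>W. act g f (y \<otimes> w) = act g f y"
  proof (intro ballI)
    fix y w assume yw: "y \<in> N" "w \<in> W"
    then obtain u where "u \<in> U" "b (y \<otimes> w) = b y \<otimes> u" using bW by blast
    then have "f (b (y \<otimes> w)) = f (b y)" using U(2) b yw by simp
    then show "act g f (y \<otimes> w) = act g f y" using yw W by (simp add: alpha_def b_def)
  qed
  ultimately show ?thesis using W unfolding step_functions_def by blast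
qed

lemma act_norm:
  assumes "g \<in> carrier G" "f \<in> carrier (linf N)"
  shows "nrm (linf N) (act g f) \<le> nrm (linf N) f"
proof (rule linf_nrm_le)
  show "N \<noteq> {}" using N_closed(1) by blast
qed (use assms linf_nrm_ge[OF assms(2)] beta_closed[of "inv g"] in \<open>simp add: alpha_def del: linf_simps\<close>)

lemma act_closed:
  assumes g: "g \<in> carrier G" and f: "f \<in> carrier DA"
  shows "act g f \<in> carrier DA"
proof -
  interpret l: cstar_algebra "linf N" by (rule linf_N_cstar)
  have sub: "step_functions \<subseteq> carrier (linf N)" using step_function_bounded by blast
  have fl: "f \<in> carrier (linf N)" using D_carrier_linf f by blast
  obtain K where K: "\<forall>x\<in>N. cmod (f x) \<le> K" using fl by (auto simp: linf_carrier)
  have cl: "act g f \<in> carrier (linf N)"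
    unfolding linf_carrier using K g by (auto simp: alpha_def beta_closed intro!: exI[of _ K])
  have "\<exists>h\<in>step_functions. nrm (linf N) (h \<ominus>\<^bsub>linf N\<^esub> act g f) < e" if "e > 0" for e
  proof -
    obtain h where h: "h \<in> step_functions" "nrm (linf N) (h \<ominus>\<^bsub>linf N\<^esub> f) < e"
      using f \<open>e > 0\<close> unfolding D_carrier l.norm_closure_iff[OF sub] by blast
    have hl: "h \<in> carrier (linf N)" "act g h \<in> carrier (linf N)"
      using h(1) sub act_step_function[OF g] by auto
    have "act g h \<ominus>\<^bsub>linf N\<^esub> act g f = act g (h \<ominus>\<^bsub>linf N\<^esub> f)"
      using hl fl cl by (simp add: l.minus_eq_scale) (auto simp: alpha_def)
    then have "nrm (linf N) (act g h \<ominus>\<^bsub>linf N\<^esub> act g f) < e"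
      using act_norm[OF g l.M.minus_closed[OF hl(1) fl]] h(2) by (simp del: linf_simps)
    then show ?thesis using act_step_function[OF g h(1)] by blast
  qed
  then show ?thesis unfolding D_carrier l.norm_closure_iff[OF sub] using cl by blast
qed

lemma act_linear:
  "act g (f \<oplus>\<^bsub>DA\<^esub> h) = act g f \<oplus>\<^bsub>DA\<^esub> act g h" "act g (c \<odot>\<^bsub>DA\<^esub> f) = c \<odot>\<^bsub>DA\<^esub> act g f"
  by (auto simp: alpha_def D_simps)

lemma act_inv:
  assumes "g \<in> carrier G" "f \<in> carrier DA"
  shows "act g (act (inv g) f) = f"
proof
  fix y
  have "f y = 0" if "y \<notin> N" using assms(2) D_carrier_linf that by (auto simp: linf_carrier)
  then show "act g (act (inv g) f) y = f y"
    using assms by (auto simp: alpha_def beta_closed beta_inv)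
qed

text \<open>
  The unit is the indicator function of the union of the two supports.
\<close>

lemma local_units:
  assumes "f1 \<in> step_functions" "f2 \<in> step_functions"
  shows "\<exists>p\<in>step_functions. star DA p = p \<and> p \<otimes>\<^bsub>DA\<^esub> p = p \<and> p \<otimes>\<^bsub>DA\<^esub> f1 = f1 \<and> p \<otimes>\<^bsub>DA\<^esub> f2 = f2 \<and>
    f1 \<otimes>\<^bsub>DA\<^esub> p = f1 \<and> f2 \<otimes>\<^bsub>DA\<^esub> p = f2"
  by (rule bexI[OF _ step_functions_combine[OF assms, of "\<lambda>a b. if a = 0 \<and> b = 0 then 0 else 1"]])
    (auto simp: D_simps fun_eq_iff)

text \<open>
  Take \<open>q = sqrt (1 - |f|\<^sup>2)\<close> on the support of \<open>f\<close>, and for \<open>p\<close> the indicator function of that support.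
\<close>

lemma sqrt_complement:
  assumes f: "f \<in> step_functions" and f1: "nrm DA f \<le> 1"
  shows "\<exists>p\<in>step_functions. \<exists>q\<in>step_functions. star DA p = p \<and> p \<otimes>\<^bsub>DA\<^esub> p = p \<and>
    star DA f \<otimes>\<^bsub>DA\<^esub> f \<oplus>\<^bsub>DA\<^esub> star DA q \<otimes>\<^bsub>DA\<^esub> q = p"
proof -
  define p where "p x = (if f x = 0 then 0 else 1 :: complex)" for x
  define q where "q x = (if f x = 0 then 0 else complex_of_real (sqrt (1 - (cmod (f x))\<^sup>2)))" for x
  have "p \<in> step_functions" "q \<in> step_functions"
    unfolding p_def q_def
    using step_functions_map[OF f, of "\<lambda>z. if z = 0 then 0 else 1"]
      step_functions_map[OF f, of "\<lambda>z. if z = 0 then 0 else complex_of_real (sqrt (1 - (cmod z)\<^sup>2))"] by simp_all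
  moreover have "cnj (f x) * f x + cnj (q x) * q x = p x" for x
  proof (cases "f x = 0")
    case False
    then have "x \<in> N" using f by (auto simp: step_functions_def)
    then have "cmod (f x) \<le> 1"
      using linf_nrm_ge[OF step_function_bounded[OF f], of x] f1 by (simp add: D_simps del: linf_simps)
    then have "0 \<le> 1 - (cmod (f x))\<^sup>2" by (simp add: power_le_one)
    then have "cnj (q x) * q x = of_real (1 - (cmod (f x))\<^sup>2)"
      using False by (simp add: q_def of_real_mult[symmetric] del: of_real_mult of_real_diff of_real_power)
    moreover have "cnj (f x) * f x = of_real ((cmod (f x))\<^sup>2)"
      by (simp only: complex_norm_square mult.commute)
    ultimately show ?thesis using False by (simp add: p_def)
  qed (simp add: p_def q_def)
  ultimately show ?thesis
    by (intro bexI[of _ p] bexI[of _ q]) (auto simp: D_simps fun_eq_iff p_def)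
qed

text \<open>
  As every element of \<open>G\<close> is \<open>x a\<close> for exactly one \<open>x\<close> in \<open>N\<close> and one \<open>a\<close> in \<open>H\<close>, the coset projections can
  be indexed by the elements of \<open>G\<close>.
\<close>

definition projection :: "'g \<Rightarrow> 'g \<Rightarrow> complex"
  where "projection h = indicator (N_part G N H h <# (H_part G N H h <# M #> inv (H_part G N H h)))"

lemma projection_range: "projection ` carrier G = coset_projections G N H M"
proof
  show "projection ` carrier G \<subseteq> coset_projections G N H M"
    using decomposition by (force simp: projection_def parts coset_projections_def conjugates_def)
  show "coset_projections G N H M \<subseteq> projection ` carrier G"
  proof
    fix f assume "f \<in> coset_projections G N H M"
    then obtain x a where xa: "x \<in> N" "a \<in> H" "f = indicator (x <# (a <# M #> inv a))"
      by (auto simp: coset_projections_def conjugates_def)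
    then show "f \<in> projection ` carrier G"
      by (intro image_eqI[of _ _ "x \<otimes> a"]) (simp_all add: projection_def parts)
  qed
qed

end

section \<open>Extending and transporting representations\<close>

lemma (in hilbert_space) converges_bops:
  assumes T: "T \<in> bops" and w: "converges X len w v"
  shows "converges X len (\<lambda>n. T (w n)) (T v)"
proof -
  obtain K where K: "bounded_linear_on X len X len (carrier X) K T"
    using T by (auto simp: bounded_operators_iff)
  have "submodule (carrier X) complex_ring X" by (simp add: submodule_iff)
  from converges_bounded_linear_on[OF normed_cspace_axioms normed_cspace_axioms this K convergesD(1,2)[OF w] w]
  show ?thesis .
qed

lemma converges_star_hom:
  assumes A: "cstar_algebra A" and X: "hilbert_space X" and \<phi>: "star_hom A (operator_algebra X) \<phi>"
    and s: "converges A (nrm A) s a" and x: "x \<in> carrier X"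
  shows "converges X (ip_norm X) (\<lambda>n. \<phi> (s n) x) (\<phi> a x)"
proof -
  interpret A: cstar_algebra A by fact
  interpret X: hilbert_space X by fact
  note hom = X.star_hom_operatorD[OF \<phi>]
  have "submodule (carrier A) complex_ring A" by (simp add: A.submodule_iff)
  moreover have "bounded_linear_on A (nrm A) X (ip_norm X) (carrier A) (ip_norm X x) (\<lambda>a. \<phi> a x)"
    using x X.bopsD(1)[OF hom(1)] hom(2,3) star_hom_contractive[OF A X \<phi>]
    by (auto simp: bounded_linear_on_def X.len_nonneg mult.commute)
  ultimately show ?thesis
    by (rule converges_bounded_linear_on[OF A.normed_cspace_axioms X.normed_cspace_axioms _ _
          convergesD(1,2)[OF s] s])
qed

text \<open>
  For each vector \<open>x\<close> the map \<open>a \<mapsto> \<pi>(a) x\<close> is bounded and linear, hence extends to the closure; the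
  algebraic identities pass to the limit, one variable at a time.
\<close>

lemma star_hom_extend:
  assumes A: "cstar_algebra A" and X: "hilbert_space X"
    and S: "star_subalgebra S A" and dense: "norm_closure A (nrm A) S = carrier A"
    and \<pi>: "star_hom (A\<lparr>carrier := S\<rparr>) (operator_algebra X) \<pi>"
    and contr: "\<And>a x. \<lbrakk>a \<in> S; x \<in> carrier X\<rbrakk> \<Longrightarrow> ip_norm X (\<pi> a x) \<le> nrm A a * ip_norm X x"
  shows "\<exists>\<rho>. star_hom A (operator_algebra X) \<rho> \<and> (\<forall>a\<in>S. \<rho> a = \<pi> a)"
proof -
  interpret A: cstar_algebra A by fact
  interpret X: hilbert_space X by fact
  have Sm: "submodule S complex_ring A" using S by (simp add: star_subalgebra_def)
  then have Sc: "S \<subseteq> carrier A" by (simp add: A.submodule_iff)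
  have Am: "submodule (carrier A) complex_ring A" by (simp add: A.submodule_iff)
  have S_closed: "a \<oplus>\<^bsub>A\<^esub> b \<in> S" "c \<odot>\<^bsub>A\<^esub> a \<in> S" "a \<otimes>\<^bsub>A\<^esub> b \<in> S" "star A a \<in> S"
    if "a \<in> S" "b \<in> S" for a b c using S that by (auto simp: star_subalgebra_def A.submodule_iff)
  note hom = X.star_hom_operatorD[OF \<pi>, simplified]
  have cl [simp]: "\<pi> a x \<in> carrier X" if "a \<in> S" "x \<in> carrier X" for a x
    using X.bopsD(1)[OF hom(1)] that by blast
  have "\<exists>T. bounded_linear_on A (nrm A) X (ip_norm X) (carrier A) (ip_norm X x) T \<and> (\<forall>a\<in>S. T a = \<pi> a x)"
    if x: "x \<in> carrier X" for x
  proof -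
    have "bounded_linear_on A (nrm A) X (ip_norm X) S (ip_norm X x) (\<lambda>a. \<pi> a x)"
      using x hom contr by (auto simp: bounded_linear_on_def X.len_nonneg mult.commute)
    from bounded_linear_on_extend[OF A.normed_cspace_axioms X.normed_cspace_axioms X.complete Sm this]
    show ?thesis unfolding dense by blast
  qed
  then obtain T where T: "\<And>x. x \<in> carrier X \<Longrightarrow>
      bounded_linear_on A (nrm A) X (ip_norm X) (carrier A) (ip_norm X x) (T x)"
    and T\<pi>: "\<And>x a. x \<in> carrier X \<Longrightarrow> a \<in> S \<Longrightarrow> T x a = \<pi> a x" by metis
  define \<rho> where "\<rho> a = (\<lambda>x\<in>carrier X. T x a)" for a
  have \<rho>c [simp]: "\<rho> a x \<in> carrier X" if "a \<in> carrier A" "x \<in> carrier X" for a x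
    using bounded_linear_onD(1)[OF T] that by (simp add: \<rho>_def)
  have \<rho>\<pi>: "\<rho> a x = \<pi> a x" if "a \<in> S" "x \<in> carrier X" for a x using T\<pi> that by (simp add: \<rho>_def)
  have conv: "converges X (ip_norm X) (\<lambda>n. \<rho> (s n) x) (\<rho> a x)"
    if "converges A (nrm A) s a" "x \<in> carrier X" for s a x
    using converges_bounded_linear_on[OF A.normed_cspace_axioms X.normed_cspace_axioms Am T[OF that(2)]
        convergesD(1,2)[OF that(1)] that(1)] that(2) by (simp add: \<rho>_def)
  have seq: "\<exists>s. (\<forall>n. s n \<in> S) \<and> converges A (nrm A) s a" if "a \<in> carrier A" for a
    using that A.norm_closure_seq[OF Sc] dense by simp
  have bound: "ip_norm X (\<rho> a x) \<le> nrm A a * ip_norm X x" if "a \<in> carrier A" "x \<in> carrier X" for a x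
    using bounded_linear_onD(5)[OF T] that by (simp add: \<rho>_def mult.commute)
  have \<rho>_add: "\<rho> a (x \<oplus>\<^bsub>X\<^esub> y) = \<rho> a x \<oplus>\<^bsub>X\<^esub> \<rho> a y"
    and \<rho>_scale: "\<rho> a (c \<odot>\<^bsub>X\<^esub> x) = c \<odot>\<^bsub>X\<^esub> \<rho> a x"
    if a: "a \<in> carrier A" and xy: "x \<in> carrier X" "y \<in> carrier X" for a x y c
  proof -
    obtain s where s: "\<forall>n. s n \<in> S" "converges A (nrm A) s a" using seq[OF a] by blast
    have "\<rho> (s n) (x \<oplus>\<^bsub>X\<^esub> y) = \<rho> (s n) x \<oplus>\<^bsub>X\<^esub> \<rho> (s n) y"
      "\<rho> (s n) (c \<odot>\<^bsub>X\<^esub> x) = c \<odot>\<^bsub>X\<^esub> \<rho> (s n) x" for n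
      using s(1) xy X.bopsD[OF hom(1)] by (simp_all add: \<rho>\<pi>)
    moreover have "converges X (ip_norm X) (\<lambda>n. \<rho> (s n) (x \<oplus>\<^bsub>X\<^esub> y)) (\<rho> a (x \<oplus>\<^bsub>X\<^esub> y))"
      "converges X (ip_norm X) (\<lambda>n. \<rho> (s n) (c \<odot>\<^bsub>X\<^esub> x)) (\<rho> a (c \<odot>\<^bsub>X\<^esub> x))"
      using conv[OF s(2)] xy by simp_all
    moreover have "converges X (ip_norm X) (\<lambda>n. \<rho> (s n) x \<oplus>\<^bsub>X\<^esub> \<rho> (s n) y) (\<rho> a x \<oplus>\<^bsub>X\<^esub> \<rho> a y)"
      "converges X (ip_norm X) (\<lambda>n. c \<odot>\<^bsub>X\<^esub> \<rho> (s n) x) (c \<odot>\<^bsub>X\<^esub> \<rho> a x)"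
      using conv[OF s(2)] xy by (simp_all add: X.converges_add X.converges_scale)
    ultimately show "\<rho> a (x \<oplus>\<^bsub>X\<^esub> y) = \<rho> a x \<oplus>\<^bsub>X\<^esub> \<rho> a y" "\<rho> a (c \<odot>\<^bsub>X\<^esub> x) = c \<odot>\<^bsub>X\<^esub> \<rho> a x"
      by (simp_all add: X.converges_unique)
  qed
  have \<rho>b: "\<rho> a \<in> bounded_operators X (ip_norm X)" if "a \<in> carrier A" for a
  proof (rule X.bopsI)
    show "\<rho> a \<in> carrier X \<rightarrow>\<^sub>E carrier X" using \<rho>c[OF that] by (auto simp: \<rho>_def)
  qed (use that \<rho>_add \<rho>_scale bound in auto)
  have \<rho>_cont: "converges X (ip_norm X) (\<lambda>n. \<rho> a (w n)) (\<rho> a v)"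
    if "a \<in> carrier A" "converges X (ip_norm X) w v" for a w v
    by (rule X.converges_bops[OF \<rho>b[OF that(1)] that(2)])
  have mult1: "\<rho> (a \<otimes>\<^bsub>A\<^esub> b) x = \<rho> a (\<rho> b x)" if a: "a \<in> carrier A" and b: "b \<in> S" and x: "x \<in> carrier X" for a b x
  proof -
    have bA: "b \<in> carrier A" using b Sc by blast
    obtain s where s: "\<forall>n. s n \<in> S" "converges A (nrm A) s a" using seq[OF a] by blast
    have "\<rho> (s n \<otimes>\<^bsub>A\<^esub> b) x = \<rho> (s n) (\<rho> b x)" for n
      using s(1) b x S_closed(3) by (simp add: \<rho>\<pi> hom(4))
    then show ?thesis
      using X.converges_unique[OF conv[OF A.converges_mult[OF s(2) A.converges_const[OF bA]] x]]
        conv[OF s(2), of "\<rho> b x"] bA x by simp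
  qed
  have mult: "\<rho> (a \<otimes>\<^bsub>A\<^esub> b) x = \<rho> a (\<rho> b x)"
    if a: "a \<in> carrier A" and b: "b \<in> carrier A" and x: "x \<in> carrier X" for a b x
  proof -
    obtain s where s: "\<forall>n. s n \<in> S" "converges A (nrm A) s b" using seq[OF b] by blast
    show ?thesis
      using X.converges_unique[OF conv[OF A.converges_mult[OF A.converges_const[OF a] s(2)] x]]
        \<rho>_cont[OF a conv[OF s(2) x]] mult1[OF a _ x] s(1) by simp
  qed
  have adj: "ip X (\<rho> a x) y = ip X x (\<rho> (star A a) y)"
    if a: "a \<in> carrier A" and x: "x \<in> carrier X" and y: "y \<in> carrier X" for a x y
  proof -
    obtain s where s: "\<forall>n. s n \<in> S" "converges A (nrm A) s a" using seq[OF a] by blast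
    have "ip X (\<rho> (s n) x) y = ip X x (\<rho> (star A (s n)) y)" for n
      using s(1) x y hom(5) S by (simp add: \<rho>\<pi> star_subalgebra_def)
    then show ?thesis
      using LIMSEQ_unique[OF X.converges_ip_left[OF conv[OF s(2) x] y]]
        X.converges_ip_right[OF conv[OF A.converges_star[OF s(2)] y] x] by simp
  qed
  have "star_hom A (operator_algebra X) \<rho>"
  proof (rule X.star_hom_operatorI)
    show "\<rho> (a \<oplus>\<^bsub>A\<^esub> b) x = \<rho> a x \<oplus>\<^bsub>X\<^esub> \<rho> b x" if "a \<in> carrier A" "b \<in> carrier A" "x \<in> carrier X" for a b x
      using bounded_linear_onD(3)[OF T[OF that(3)]] that by (simp add: \<rho>_def)
    show "\<rho> (c \<odot>\<^bsub>A\<^esub> a) x = c \<odot>\<^bsub>X\<^esub> \<rho> a x" if "a \<in> carrier A" "x \<in> carrier X" for c a x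
      using bounded_linear_onD(4)[OF T[OF that(2)]] that by (simp add: \<rho>_def)
  qed (use \<rho>b mult adj in auto)
  moreover have "\<rho> a = \<pi> a" if "a \<in> S" for a
    using that Sc by (intro X.bops_eqI[OF \<rho>b hom(1)]) (auto simp: \<rho>\<pi>)
  ultimately show ?thesis by blast
qed

lemma star_hom_unique:
  assumes A: "cstar_algebra A" and X: "hilbert_space X"
    and S: "S \<subseteq> carrier A" and dense: "norm_closure A (nrm A) S = carrier A"
    and \<phi>: "star_hom A (operator_algebra X) \<phi>" and \<psi>: "star_hom A (operator_algebra X) \<psi>"
    and eq: "\<And>a. a \<in> S \<Longrightarrow> \<phi> a = \<psi> a" and a: "a \<in> carrier A"
  shows "\<phi> a = \<psi> a"
proof -
  interpret A: cstar_algebra A by fact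
  interpret X: hilbert_space X by fact
  obtain s where s: "\<forall>n. s n \<in> S" "converges A (nrm A) s a"
    using a A.norm_closure_seq[OF S] dense by auto
  note conv = converges_star_hom[OF A X _ s(2)]
  show ?thesis
  proof (rule X.bops_eqI[OF X.star_hom_operatorD(1)[OF \<phi> a] X.star_hom_operatorD(1)[OF \<psi> a]])
    fix x assume x: "x \<in> carrier X"
    show "\<phi> a x = \<psi> a x"
      using X.converges_unique[OF conv[OF \<phi> x]] conv[OF \<psi> x] eq s(1) by simp
  qed
qed

text \<open>
  The closed subspace \<open>W\<close>, moved along an injection \<open>s\<close> into another type.
\<close>

definition transported_space ::
    "'x inner_product_space \<Rightarrow> 'x set \<Rightarrow> ('x \<Rightarrow> 'y) \<Rightarrow> 'y inner_product_space"
  where "transported_space X W s = \<lparr>carrier = s ` W, monoid.mult = (\<lambda>y z. y), one = s \<zero>\<^bsub>X\<^esub>,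
    ring.zero = s \<zero>\<^bsub>X\<^esub>,
    ring.add = (\<lambda>y z. s (inv_into W s y \<oplus>\<^bsub>X\<^esub> inv_into W s z)),
    module.smult = (\<lambda>c y. s (c \<odot>\<^bsub>X\<^esub> inv_into W s y)),
    ip = (\<lambda>y z. ip X (inv_into W s y) (inv_into W s z))\<rparr>"

locale transported = hilbert_space X for X :: "'x inner_product_space" (structure) +
  fixes W :: "'x set" and s :: "'x \<Rightarrow> 'y"
  assumes W_submodule: "submodule W complex_ring X"
    and W_closed: "norm_closure X (ip_norm X) W = W"
    and s_inj: "inj_on s W"
begin

abbreviation "Y \<equiv> transported_space X W s"

lemma W_mem [simp]:
  "w \<in> W \<Longrightarrow> w \<in> carrier X" "\<zero> \<in> W" "\<lbrakk>v \<in> W; w \<in> W\<rbrakk> \<Longrightarrow> v \<oplus> w \<in> W" "w \<in> W \<Longrightarrow> c \<odot> w \<in> W"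
  using W_submodule by (auto simp: submodule_iff)

lemma Y_simps [simp]:
  "carrier Y = s ` W" "\<zero>\<^bsub>Y\<^esub> = s \<zero>"
  "\<lbrakk>v \<in> W; w \<in> W\<rbrakk> \<Longrightarrow> s v \<oplus>\<^bsub>Y\<^esub> s w = s (v \<oplus> w)"
  "w \<in> W \<Longrightarrow> c \<odot>\<^bsub>Y\<^esub> s w = s (c \<odot> w)"
  "\<lbrakk>v \<in> W; w \<in> W\<rbrakk> \<Longrightarrow> ip Y (s v) (s w) = ip X v w"
  "w \<in> W \<Longrightarrow> ip_norm Y (s w) = len w"
  using s_inj by (simp_all add: transported_space_def ip_norm_def inv_into_f_f)

lemma s_eq_iff [simp]: "\<lbrakk>v \<in> W; w \<in> W\<rbrakk> \<Longrightarrow> s v = s w \<longleftrightarrow> v = w"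
  using s_inj by (auto dest: inj_onD)

lemma Y_module: "Module.module complex_ring Y"
proof (rule moduleI[OF cring_complex_ring])
  show "abelian_group Y"
  proof (rule abelian_groupI)
    fix x assume "x \<in> carrier Y"
    then obtain w where w: "w \<in> W" "x = s w" by auto
    have "((-1) \<odot> w) \<oplus> w = \<zero>" using w by (simp add: uminus_eq_scale[symmetric] M.l_neg)
    then show "\<exists>y\<in>carrier Y. y \<oplus>\<^bsub>Y\<^esub> x = \<zero>\<^bsub>Y\<^esub>"
      using w by (intro bexI[of _ "s ((-1) \<odot> w)"]) auto
  qed (auto simp: M.a_ac)
qed (auto simp: scale_add_left scale_add_right scale_scale)

lemma Y_hilbert: "hilbert_space Y"
proof -
  interpret Y: cspace Y unfolding cspace_def by (rule Y_module)
  have minus: "s v \<ominus>\<^bsub>Y\<^esub> s w = s (v \<ominus> w)" if "v \<in> W" "w \<in> W" for v w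
    using that by (simp add: Y.minus_eq_scale minus_eq_scale)
  have minusW: "v \<ominus> w \<in> W" if "v \<in> W" "w \<in> W" for v w using that by (simp add: minus_eq_scale)
  have n: "normed_cspace Y (ip_norm Y)"
    by unfold_locales (auto simp: len_nonneg len_eq_0 nm_triangle len_scale)
  then interpret Y: normed_cspace Y "ip_norm Y" .
  have "norm_complete Y (ip_norm Y)"
    unfolding Y.norm_complete_iff
  proof (intro allI impI)
    fix t :: "nat \<Rightarrow> 'y"
    assume t: "(\<forall>n. t n \<in> carrier Y) \<and>
      (\<forall>e>0. \<exists>n0. \<forall>m\<ge>n0. \<forall>n\<ge>n0. ip_norm Y (t m \<ominus>\<^bsub>Y\<^esub> t n) < e)"
    then have "\<forall>n. \<exists>w\<in>W. t n = s w" by auto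
    then obtain w where w: "\<And>n. w n \<in> W" "\<And>n. t n = s (w n)" by metis
    have "\<forall>e>0. \<exists>n0. \<forall>m\<ge>n0. \<forall>n\<ge>n0. len (w m \<ominus> w n) < e"
      using t w by (simp add: minus minusW)
    then obtain v where v: "converges X len w v"
      using complete[unfolded norm_complete_iff, rule_format, of w] w by auto
    have W: "W \<subseteq> carrier X" by auto
    have "v \<in> W" using norm_closure_seq[OF W, of v] W_closed w v by auto
    then have "converges Y (ip_norm Y) t (s v)"
      using v w by (simp add: converges_def minus minusW)
    then show "\<exists>v. converges Y (ip_norm Y) t v" by blast
  qed
  then show ?thesis
    unfolding hilbert_space_def hilbert_space_axioms_def
    using Y_module by (auto simp: ip_add ip_smult ip_pos) (rule ip_cnj; simp)
qed

text \<open>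
  The operator on the transported space that corresponds to an operator preserving \<open>W\<close>.
\<close>

definition lift :: "('x \<Rightarrow> 'x) \<Rightarrow> 'y \<Rightarrow> 'y"
  where "lift T = (\<lambda>y\<in>s ` W. s (T (inv_into W s y)))"

lemma lift_apply [simp]: "w \<in> W \<Longrightarrow> lift T (s w) = s (T w)"
  using s_inj by (simp add: lift_def inv_into_f_f)

lemma lift_bounded:
  assumes "\<And>w. w \<in> W \<Longrightarrow> T w \<in> W"
    and "\<And>v w. \<lbrakk>v \<in> W; w \<in> W\<rbrakk> \<Longrightarrow> T (v \<oplus> w) = T v \<oplus> T w"
    and "\<And>c w. w \<in> W \<Longrightarrow> T (c \<odot> w) = c \<odot> T w"
    and "\<And>w. w \<in> W \<Longrightarrow> len (T w) \<le> K * len w"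
  shows "lift T \<in> bounded_operators Y (ip_norm Y)"
proof (rule hilbert_space.bopsI[OF Y_hilbert, where K = K])
  have "lift T y \<in> s ` W" if "y \<in> s ` W" for y using that assms(1) by auto
  moreover have "lift T \<in> extensional (s ` W)" by (simp add: lift_def)
  ultimately show "lift T \<in> carrier Y \<rightarrow>\<^sub>E carrier Y" by (simp add: PiE_def Pi_def)
qed (use assms in auto)

end

section \<open>Crossed products of algebras with a dense algebra of projections\<close>

lemma (in cstar_algebra) emb_minus:
  assumes "b \<in> carrier A" "c \<in> carrier A"
  shows "emb (b \<ominus> c) = emb b \<ominus>\<^bsub>mult_alg\<^esub> emb c"
proof -
  interpret m: normed_cspace mult_alg "nrm mult_alg" by (rule multiplier_normed_cspace)
  show ?thesis using assms by (simp add: minus_eq_scale m.minus_eq_scale emb_closed emb_add emb_scale)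
qed

text \<open>
  What the argument needs to know about \<open>D\<^sub>0 \<subseteq> D\<close> and the action: \<open>A0\<close> is dense and invariant, has local
  units, has enough square roots to make its representations contractive (assumption \<open>complement\<close>),
  and is spanned by elements \<open>\<kappa> h\<close> indexed by the group.
\<close>

locale crossed_product_with_projections =
  B: full_crossed_product G A act B iA iG + A: cstar_algebra A + G: group G
  for G :: "('g, 'm) monoid_scheme" (structure) and A :: "('g \<Rightarrow> complex) star_alg"
    and act :: "'g \<Rightarrow> ('g \<Rightarrow> complex) \<Rightarrow> 'g \<Rightarrow> complex" and B :: "'b star_alg"
    and iA :: "('g \<Rightarrow> complex) \<Rightarrow> ('b \<Rightarrow> 'b) \<times> ('b \<Rightarrow> 'b)"
    and iG :: "'g \<Rightarrow> ('b \<Rightarrow> 'b) \<times> ('b \<Rightarrow> 'b)" +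
  fixes A0 :: "('g \<Rightarrow> complex) set" and \<kappa> :: "'g \<Rightarrow> 'g \<Rightarrow> complex"
  assumes A0_star_subalgebra: "star_subalgebra A0 A"
    and A0_dense: "norm_closure A (nrm A) A0 = carrier A"
    and act_closed: "\<lbrakk>g \<in> carrier G; a \<in> carrier A\<rbrakk> \<Longrightarrow> act g a \<in> carrier A"
    and act_A0: "\<lbrakk>g \<in> carrier G; a \<in> A0\<rbrakk> \<Longrightarrow> act g a \<in> A0"
    and act_add: "\<lbrakk>g \<in> carrier G; a \<in> carrier A; b \<in> carrier A\<rbrakk> \<Longrightarrow>
      act g (a \<oplus>\<^bsub>A\<^esub> b) = act g a \<oplus>\<^bsub>A\<^esub> act g b"
    and act_scale: "\<lbrakk>g \<in> carrier G; a \<in> carrier A\<rbrakk> \<Longrightarrow> act g (c \<odot>\<^bsub>A\<^esub> a) = c \<odot>\<^bsub>A\<^esub> act g a"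
    and act_contractive: "\<lbrakk>g \<in> carrier G; a \<in> carrier A\<rbrakk> \<Longrightarrow> nrm A (act g a) \<le> nrm A a"
    and act_inv: "\<lbrakk>g \<in> carrier G; a \<in> carrier A\<rbrakk> \<Longrightarrow> act g (act (inv g) a) = a"
    and local_unit: "\<lbrakk>a \<in> A0; b \<in> A0\<rbrakk> \<Longrightarrow> \<exists>p\<in>A0. star A p = p \<and> p \<otimes>\<^bsub>A\<^esub> p = p \<and>
      p \<otimes>\<^bsub>A\<^esub> a = a \<and> p \<otimes>\<^bsub>A\<^esub> b = b \<and> a \<otimes>\<^bsub>A\<^esub> p = a \<and> b \<otimes>\<^bsub>A\<^esub> p = b"
    and complement: "\<lbrakk>a \<in> A0; nrm A a \<le> 1\<rbrakk> \<Longrightarrow> \<exists>p\<in>A0. \<exists>q\<in>A0. star A p = p \<and> p \<otimes>\<^bsub>A\<^esub> p = p \<and>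
      star A a \<otimes>\<^bsub>A\<^esub> a \<oplus>\<^bsub>A\<^esub> star A q \<otimes>\<^bsub>A\<^esub> q = p"
    and generated: "\<lbrakk>submodule V complex_ring A; \<kappa> ` carrier G \<subseteq> V\<rbrakk> \<Longrightarrow> A0 \<subseteq> V"
    and \<kappa>_A0: "\<kappa> ` carrier G \<subseteq> A0"
begin

abbreviation "MB \<equiv> multiplier_algebra B"

definition "lA a = fst (iA a)"

definition "uG g = fst (iG g)"

lemma A0_closed [simp]:
  "a \<in> A0 \<Longrightarrow> a \<in> carrier A" "\<lbrakk>a \<in> A0; b \<in> A0\<rbrakk> \<Longrightarrow> a \<oplus>\<^bsub>A\<^esub> b \<in> A0" "a \<in> A0 \<Longrightarrow> c \<odot>\<^bsub>A\<^esub> a \<in> A0"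
  "\<lbrakk>a \<in> A0; b \<in> A0\<rbrakk> \<Longrightarrow> a \<otimes>\<^bsub>A\<^esub> b \<in> A0" "a \<in> A0 \<Longrightarrow> star A a \<in> A0" "\<zero>\<^bsub>A\<^esub> \<in> A0"
  using A0_star_subalgebra by (auto simp: star_subalgebra_def A.submodule_iff)

lemma iA_multiplier: "a \<in> carrier A \<Longrightarrow> iA a \<in> carrier MB"
  using B.iA_hom by (auto simp: star_hom_def)

lemma iG_multiplier:
  "g \<in> carrier G \<Longrightarrow> iG g \<in> carrier MB"
  "g \<in> carrier G \<Longrightarrow> star MB (iG g) \<otimes>\<^bsub>MB\<^esub> iG g = \<one>\<^bsub>MB\<^esub>"
  "\<lbrakk>g \<in> carrier G; h \<in> carrier G\<rbrakk> \<Longrightarrow> iG (g \<otimes> h) = iG g \<otimes>\<^bsub>MB\<^esub> iG h"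
  using B.iG_hom by (auto simp: hom_def unitary_group_def)

text \<open>
  By \<open>multiplier_eqI\<close> it is enough to work with the left parts \<open>lA a\<close> and \<open>uG g\<close> of the canonical
  multipliers, which are operators on \<open>B\<close>.
\<close>

lemma lA_simps [simp]:
  assumes a: "a \<in> carrier A" and b: "b \<in> carrier B"
  shows "lA a b \<in> carrier B"
    "c \<in> carrier B \<Longrightarrow> lA a (b \<oplus>\<^bsub>B\<^esub> c) = lA a b \<oplus>\<^bsub>B\<^esub> lA a c"
    "lA a (k \<odot>\<^bsub>B\<^esub> b) = k \<odot>\<^bsub>B\<^esub> lA a b"
    "c \<in> carrier B \<Longrightarrow> lA a b \<otimes>\<^bsub>B\<^esub> c = lA a (b \<otimes>\<^bsub>B\<^esub> c)"
  using B.multD[OF iA_multiplier[OF a]] b by (simp_all add: lA_def)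

lemma lA_hom:
  assumes "a \<in> carrier A" "b \<in> carrier B"
  shows "a' \<in> carrier A \<Longrightarrow> lA (a \<oplus>\<^bsub>A\<^esub> a') b = lA a b \<oplus>\<^bsub>B\<^esub> lA a' b"
    "lA (k \<odot>\<^bsub>A\<^esub> a) b = k \<odot>\<^bsub>B\<^esub> lA a b"
    "a' \<in> carrier A \<Longrightarrow> lA (a \<otimes>\<^bsub>A\<^esub> a') b = lA a (lA a' b)"
    "c \<in> carrier B \<Longrightarrow> star B (lA a b) \<otimes>\<^bsub>B\<^esub> c = star B b \<otimes>\<^bsub>B\<^esub> lA (star A a) c"
  using B.iA_hom assms B.multiplier_star_adjoint[OF iA_multiplier[OF assms(1)] assms(2)]
  by (simp_all add: star_hom_def lA_def B.multiplier_simps compose_def)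

lemma lA_contractive: "\<lbrakk>a \<in> carrier A; b \<in> carrier B\<rbrakk> \<Longrightarrow> nrm B (lA a b) \<le> nrm A a * nrm B b"
  by (rule star_action_contractive[OF A.cstar_algebra_axioms B.cstar_algebra_axioms])
    (auto simp: lA_hom B.minus_eq_scale)

lemma uG_simps [simp]:
  assumes g: "g \<in> carrier G" and b: "b \<in> carrier B"
  shows "uG g b \<in> carrier B"
    "c \<in> carrier B \<Longrightarrow> uG g (b \<oplus>\<^bsub>B\<^esub> c) = uG g b \<oplus>\<^bsub>B\<^esub> uG g c"
    "uG g (k \<odot>\<^bsub>B\<^esub> b) = k \<odot>\<^bsub>B\<^esub> uG g b"
    "c \<in> carrier B \<Longrightarrow> uG g b \<otimes>\<^bsub>B\<^esub> c = uG g (b \<otimes>\<^bsub>B\<^esub> c)"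
  using B.multD[OF iG_multiplier(1)[OF g]] b by (simp_all add: uG_def)

lemma uG_star_inverse:
  assumes "g \<in> carrier G" "b \<in> carrier B"
  shows "fst (star MB (iG g)) (uG g b) = b"
proof -
  have "fst (star MB (iG g) \<otimes>\<^bsub>MB\<^esub> iG g) b = fst \<one>\<^bsub>MB\<^esub> b" using iG_multiplier(2)[OF assms(1)] by simp
  then show ?thesis using assms by (simp add: B.multiplier_simps compose_def uG_def)
qed

lemma uG_mult: "\<lbrakk>g \<in> carrier G; h \<in> carrier G; b \<in> carrier B\<rbrakk> \<Longrightarrow> uG (g \<otimes> h) b = uG g (uG h b)"
  by (simp add: uG_def iG_multiplier(3) B.multiplier_simps compose_def)

text \<open>
  \<open>u\<^sub>1\<close> is idempotent and has a left inverse.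
\<close>

lemma uG_one [simp]: "b \<in> carrier B \<Longrightarrow> uG \<one> b = b"
  using uG_mult[of "\<one>" "\<one>" b] uG_star_inverse[of "\<one>" b]
    uG_star_inverse[of "\<one>" "uG \<one> b"] by simp

lemma uG_inv [simp]:
  "\<lbrakk>g \<in> carrier G; b \<in> carrier B\<rbrakk> \<Longrightarrow> uG g (uG (inv g) b) = b"
  "\<lbrakk>g \<in> carrier G; b \<in> carrier B\<rbrakk> \<Longrightarrow> uG (inv g) (uG g b) = b"
  by (simp_all add: uG_mult[symmetric])

lemma uG_unitary:
  assumes "g \<in> carrier G" "b \<in> carrier B" "c \<in> carrier B"
  shows "star B (uG g b) \<otimes>\<^bsub>B\<^esub> uG g c = star B b \<otimes>\<^bsub>B\<^esub> c"
  using B.multiplier_star_adjoint[OF iG_multiplier(1)[OF assms(1)] assms(2), of "uG g c"]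
    uG_star_inverse[OF assms(1,3)] assms by (simp add: uG_def[symmetric])

lemma uG_star:
  assumes "g \<in> carrier G" "b \<in> carrier B" "c \<in> carrier B"
  shows "star B (uG g b) \<otimes>\<^bsub>B\<^esub> c = star B b \<otimes>\<^bsub>B\<^esub> uG (inv g) c"
  using uG_unitary[OF assms(1,2), of "uG (inv g) c"] assms by simp

lemma uG_isometric: "\<lbrakk>g \<in> carrier G; b \<in> carrier B\<rbrakk> \<Longrightarrow> nrm B (uG g b) = nrm B b"
  using uG_unitary[of g b b] B.nrm_star_mult[of "uG g b"] B.nrm_star_mult[of b]
  by (simp add: power2_eq_iff_nonneg B.nrm_nonneg)

lemma covariance:
  assumes "g \<in> carrier G" "a \<in> carrier A" "b \<in> carrier B"
  shows "lA (act g a) (uG g b) = uG g (lA a b)"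
  using assms B.covariant[OF assms(1,2)] uG_star_inverse[OF assms(1,3)]
  by (simp add: lA_def uG_def B.multiplier_simps compose_def B.multD iA_multiplier iG_multiplier)

lemma covariance_inv:
  assumes "g \<in> carrier G" "a \<in> carrier A" "b \<in> carrier B"
  shows "lA a (uG g b) = uG g (lA (act (inv g) a) b)"
  using covariance[of g "act (inv g) a" b] assms by (simp add: act_inv act_closed)

subsection \<open>The algebraic crossed product\<close>

text \<open>
  The product \<open>i\<^sub>G(g) i\<^sub>A(a)\<close>, as an element of \<open>B\<close>; it belongs to \<open>B\<close> by density of the span of the
  products \<open>i\<^sub>A(a) i\<^sub>G(g)\<close> and covariance.
\<close>

definition elt :: "'g \<Rightarrow> ('g \<Rightarrow> complex) \<Rightarrow> 'b"
  where "elt g a = (SOME x. x \<in> carrier B \<and> multiplier_embedding B x = iG g \<otimes>\<^bsub>MB\<^esub> iA a)"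

lemma elt_eq_multiplier:
  assumes g: "g \<in> carrier G" and a: "a \<in> carrier A"
  shows "elt g a \<in> carrier B" "multiplier_embedding B (elt g a) = iG g \<otimes>\<^bsub>MB\<^esub> iA a"
proof -
  interpret M: normed_cspace MB "nrm MB" by (rule B.multiplier_normed_cspace)
  let ?S = "{iA a \<otimes>\<^bsub>MB\<^esub> iG g |a g. a \<in> carrier A \<and> g \<in> carrier G}"
  have S: "?S \<subseteq> carrier MB" using B.multiplier_mult_closed iA_multiplier iG_multiplier(1) by blast
  have "iG g \<otimes>\<^bsub>MB\<^esub> iA a = iA (act g a) \<otimes>\<^bsub>MB\<^esub> iG g"
  proof (rule B.multiplier_eqI)
    fix b assume "b \<in> carrier B"
    then show "fst (iG g \<otimes>\<^bsub>MB\<^esub> iA a) b = fst (iA (act g a) \<otimes>\<^bsub>MB\<^esub> iG g) b"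
      using covariance[OF g a] by (simp add: B.multiplier_simps compose_def lA_def uG_def)
  qed (use g a in \<open>auto intro!: B.multiplier_mult_closed iA_multiplier iG_multiplier act_closed\<close>)
  then have "iG g \<otimes>\<^bsub>MB\<^esub> iA a \<in> ?S" using act_closed[OF g a] g by auto
  then have "iG g \<otimes>\<^bsub>MB\<^esub> iA a \<in> norm_closure MB (nrm MB) (cspan MB ?S)"
    using M.norm_closure_increasing[OF M.cspan_submodule(3)[OF S]] M.cspan_submodule(2)[OF S] by blast
  then have "\<exists>x. x \<in> carrier B \<and> multiplier_embedding B x = iG g \<otimes>\<^bsub>MB\<^esub> iA a"
    unfolding B.dense by auto
  then have "elt g a \<in> carrier B \<and> multiplier_embedding B (elt g a) = iG g \<otimes>\<^bsub>MB\<^esub> iA a"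
    unfolding elt_def by (rule someI_ex)
  then show "elt g a \<in> carrier B" "multiplier_embedding B (elt g a) = iG g \<otimes>\<^bsub>MB\<^esub> iA a" by auto
qed

lemma elt_closed [simp]: "\<lbrakk>g \<in> carrier G; a \<in> carrier A\<rbrakk> \<Longrightarrow> elt g a \<in> carrier B"
  by (rule elt_eq_multiplier)

lemma elt_mult [simp]:
  assumes "g \<in> carrier G" "a \<in> carrier A" "b \<in> carrier B"
  shows "elt g a \<otimes>\<^bsub>B\<^esub> b = uG g (lA a b)"
  using B.emb_simps[OF assms(3), of "elt g a"] elt_eq_multiplier(2)[OF assms(1,2)] assms
  by (simp add: B.multiplier_simps compose_def lA_def uG_def)

lemma elt_eqI:
  assumes "x \<in> carrier B" "g \<in> carrier G" "a \<in> carrier A"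
    and "\<And>b. b \<in> carrier B \<Longrightarrow> x \<otimes>\<^bsub>B\<^esub> b = uG g (lA a b)"
  shows "x = elt g a"
  by (rule B.left_mult_inj) (use assms in auto)

lemma elt_add:
  "\<lbrakk>g \<in> carrier G; a \<in> carrier A; a' \<in> carrier A\<rbrakk> \<Longrightarrow> elt g (a \<oplus>\<^bsub>A\<^esub> a') = elt g a \<oplus>\<^bsub>B\<^esub> elt g a'"
  by (rule elt_eqI[symmetric]) (auto simp: B.distrib_right lA_hom)

lemma elt_scale: "\<lbrakk>g \<in> carrier G; a \<in> carrier A\<rbrakk> \<Longrightarrow> elt g (c \<odot>\<^bsub>A\<^esub> a) = c \<odot>\<^bsub>B\<^esub> elt g a"
  by (rule elt_eqI[symmetric]) (auto simp: B.smult_mult_left lA_hom)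

lemma elt_minus:
  "\<lbrakk>g \<in> carrier G; a \<in> carrier A; a' \<in> carrier A\<rbrakk> \<Longrightarrow> elt g (a \<ominus>\<^bsub>A\<^esub> a') = elt g a \<ominus>\<^bsub>B\<^esub> elt g a'"
  by (simp add: A.minus_eq_scale B.minus_eq_scale elt_add elt_scale)

lemma uG_elt: "\<lbrakk>g \<in> carrier G; h \<in> carrier G; a \<in> carrier A\<rbrakk> \<Longrightarrow> uG g (elt h a) = elt (g \<otimes> h) a"
  by (rule elt_eqI) (auto simp: uG_mult)

lemma lA_elt:
  "\<lbrakk>a \<in> carrier A; h \<in> carrier G; a' \<in> carrier A\<rbrakk> \<Longrightarrow>
    lA a (elt h a') = elt h (act (inv h) a \<otimes>\<^bsub>A\<^esub> a')"
  by (rule elt_eqI) (auto simp: covariance_inv lA_hom act_closed)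

lemma elt_star:
  assumes "g \<in> carrier G" "a \<in> carrier A"
  shows "star B (elt g a) = elt (inv g) (act g (star A a))"
proof (rule elt_eqI)
  fix b assume b: "b \<in> carrier B"
  have "star B (elt g a) \<otimes>\<^bsub>B\<^esub> b = lA (star A a) (uG (inv g) b)"
  proof (rule B.star_mult_inj)
    fix z assume z: "z \<in> carrier B"
    have "star B z \<otimes>\<^bsub>B\<^esub> (star B (elt g a) \<otimes>\<^bsub>B\<^esub> b) = star B (elt g a \<otimes>\<^bsub>B\<^esub> z) \<otimes>\<^bsub>B\<^esub> b"
      using assms z b by (simp add: B.star_mult B.mult_assoc del: elt_mult)
    then show "star B z \<otimes>\<^bsub>B\<^esub> (star B (elt g a) \<otimes>\<^bsub>B\<^esub> b) = star B z \<otimes>\<^bsub>B\<^esub> lA (star A a) (uG (inv g) b)"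
      using assms z b by (simp add: uG_star lA_hom)
  qed (use assms b in auto)
  also have "\<dots> = uG (inv g) (lA (act g (star A a)) b)"
    using covariance_inv[of "inv g" "act g (star A a)" b] covariance[of g "star A a" "uG (inv g) b"] assms b
      uG_inv(2)[of g "lA (star A a) (uG (inv g) b)"] by simp
  finally show "star B (elt g a) \<otimes>\<^bsub>B\<^esub> b = uG (inv g) (lA (act g (star A a)) b)" .
qed (use assms in \<open>auto simp: act_closed\<close>)

lemma elt_one_star:
  assumes "a \<in> carrier A"
  shows "star B (elt \<one> a) = elt \<one> (star A a)"
proof (rule elt_eqI)
  fix b assume b: "b \<in> carrier B"
  have "star B (elt \<one> a) \<otimes>\<^bsub>B\<^esub> b = lA (star A a) b"
  proof (rule B.star_mult_inj)
    fix z assume z: "z \<in> carrier B"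
    have "star B z \<otimes>\<^bsub>B\<^esub> (star B (elt \<one> a) \<otimes>\<^bsub>B\<^esub> b) = star B (elt \<one> a \<otimes>\<^bsub>B\<^esub> z) \<otimes>\<^bsub>B\<^esub> b"
      using assms z b by (simp add: B.star_mult B.mult_assoc del: elt_mult)
    then show "star B z \<otimes>\<^bsub>B\<^esub> (star B (elt \<one> a) \<otimes>\<^bsub>B\<^esub> b) = star B z \<otimes>\<^bsub>B\<^esub> lA (star A a) b"
      using assms z b by (simp add: lA_hom)
  qed (use assms b in auto)
  then show "star B (elt \<one> a) \<otimes>\<^bsub>B\<^esub> b = uG \<one> (lA (star A a) b)" using assms b by simp
qed (use assms in auto)

definition "elts = {elt g a |g a. g \<in> carrier G \<and> a \<in> A0}"

abbreviation "B0 \<equiv> algebraic_crossed_product G A0 B iA iG"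

lemma elts_carrier: "elts \<subseteq> carrier B"
  by (auto simp: elts_def)

lemma B0_eq: "B0 = cspan B elts"
proof -
  have "{iG g \<otimes>\<^bsub>MB\<^esub> iA a |g a. g \<in> carrier G \<and> a \<in> A0} = multiplier_embedding B ` elts"
  proof
    show "{iG g \<otimes>\<^bsub>MB\<^esub> iA a |g a. g \<in> carrier G \<and> a \<in> A0} \<subseteq> multiplier_embedding B ` elts"
      unfolding elts_def by (force simp: elt_eq_multiplier(2))
    show "multiplier_embedding B ` elts \<subseteq> {iG g \<otimes>\<^bsub>MB\<^esub> iA a |g a. g \<in> carrier G \<and> a \<in> A0}"
      unfolding elts_def by (force simp: elt_eq_multiplier(2))
  qed
  then show ?thesis
    unfolding algebraic_crossed_product_def
    using B.cspan_emb[OF elts_carrier] B.cspan_submodule(3)[OF elts_carrier] by auto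
qed

lemma B0_submodule: "submodule B0 complex_ring B"
  unfolding B0_eq by (rule B.cspan_submodule[OF elts_carrier])

lemma B0_closed [simp]:
  "b \<in> B0 \<Longrightarrow> b \<in> carrier B" "\<lbrakk>b \<in> B0; c \<in> B0\<rbrakk> \<Longrightarrow> b \<oplus>\<^bsub>B\<^esub> c \<in> B0" "b \<in> B0 \<Longrightarrow> k \<odot>\<^bsub>B\<^esub> b \<in> B0"
  "\<zero>\<^bsub>B\<^esub> \<in> B0"
  using B0_submodule by (auto simp: B.submodule_iff)

lemma elt_B0 [simp]: "\<lbrakk>g \<in> carrier G; a \<in> A0\<rbrakk> \<Longrightarrow> elt g a \<in> B0"
  using B.cspan_submodule(2)[OF elts_carrier] unfolding B0_eq by (auto simp: elts_def)

lemma B0_induct [consumes 1, case_names elt zero add scale]: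
  assumes "b \<in> B0"
    and "\<And>g a. \<lbrakk>g \<in> carrier G; a \<in> A0\<rbrakk> \<Longrightarrow> P (elt g a)" and "P \<zero>\<^bsub>B\<^esub>"
    and "\<And>b c. \<lbrakk>b \<in> B0; c \<in> B0; P b; P c\<rbrakk> \<Longrightarrow> P (b \<oplus>\<^bsub>B\<^esub> c)"
    and "\<And>k b. \<lbrakk>b \<in> B0; P b\<rbrakk> \<Longrightarrow> P (k \<odot>\<^bsub>B\<^esub> b)"
  shows "P b"
  using assms(1) elts_carrier unfolding B0_eq
proof (induction rule: B.cspan_induct)
  case (gen x)
  then show ?case using assms(2) by (auto simp: elts_def)
qed (use assms(3-5) B0_eq in auto)

lemma uG_B0 [simp]:
  assumes g: "g \<in> carrier G" and b: "b \<in> B0"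
  shows "uG g b \<in> B0"
  using b
proof (induction rule: B0_induct)
  case zero
  then show ?case using uG_simps(3)[OF g, of "\<zero>\<^bsub>B\<^esub>" 0] g by simp
qed (simp_all add: uG_elt g)

lemma lA_B0 [simp]:
  assumes a: "a \<in> A0" and b: "b \<in> B0"
  shows "lA a b \<in> B0"
  using b
proof (induction rule: B0_induct)
  case zero
  then show ?case using lA_simps(3)[of a "\<zero>\<^bsub>B\<^esub>" 0] a by simp
qed (simp_all add: lA_elt act_A0 a)

lemma B0_mult [simp]:
  assumes "b \<in> B0" "c \<in> B0"
  shows "b \<otimes>\<^bsub>B\<^esub> c \<in> B0"
  using assms(1)
  by (induction rule: B0_induct) (use assms(2) in \<open>auto simp: B.distrib_right B.smult_mult_left\<close>)

lemma B0_star [simp]: "b \<in> B0 \<Longrightarrow> star B b \<in> B0"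
  by (induction rule: B0_induct) (auto simp: elt_star act_A0 B.star_add B.star_smult)

lemma B0_star_subalgebra: "star_subalgebra B0 B"
  using B0_submodule by (simp add: star_subalgebra_def)

text \<open>
  The products \<open>i\<^sub>G(g) i\<^sub>A(a)\<close> have a dense span, and \<open>i\<^sub>A\<close> is contractive, so \<open>a\<close> may be replaced by
  an element of \<open>A0\<close> close to it.
\<close>

lemma B0_dense: "norm_closure B (nrm B) B0 = carrier B"
proof -
  interpret M: normed_cspace MB "nrm MB" by (rule B.multiplier_normed_cspace)
  have B0c: "B0 \<subseteq> carrier B" by auto
  let ?S = "{iA a \<otimes>\<^bsub>MB\<^esub> iG g |a g. a \<in> carrier A \<and> g \<in> carrier G}"
  let ?E = "multiplier_embedding B ` B0"
  have Ec: "?E \<subseteq> carrier MB" using B.emb_closed by auto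
  have E: "submodule ?E complex_ring MB"
    unfolding M.submodule_iff
  proof (intro conjI ballI allI)
    show "\<zero>\<^bsub>MB\<^esub> \<in> ?E" unfolding B.emb_zero[symmetric] by (intro imageI) simp
    show "?E \<subseteq> carrier MB" by (rule Ec)
    fix x assume "x \<in> ?E"
    then obtain x' where x: "x = multiplier_embedding B x'" "x' \<in> B0" by blast
    show "k \<odot>\<^bsub>MB\<^esub> x \<in> ?E" for k
      unfolding x(1) B.emb_scale[OF B0_closed(1)[OF x(2)], symmetric] using x(2) by (intro imageI) simp
    fix y assume "y \<in> ?E"
    then obtain y' where y: "y = multiplier_embedding B y'" "y' \<in> B0" by blast
    show "x \<oplus>\<^bsub>MB\<^esub> y \<in> ?E"
      unfolding x(1) y(1) B.emb_add[OF B0_closed(1)[OF x(2)] B0_closed(1)[OF y(2)], symmetric]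
      using x(2) y(2) by (intro imageI) simp
  qed
  have "x \<in> norm_closure MB (nrm MB) ?E" if xS: "x \<in> ?S" for x
  proof -
    obtain a g where ag: "a \<in> carrier A" "g \<in> carrier G" "x = iA a \<otimes>\<^bsub>MB\<^esub> iG g" using xS by blast
    \<comment> \<open>covariance brings the product into the form \<open>i\<^sub>G(g) i\<^sub>A(a')\<close>\<close>
    define a' where "a' = act (inv g) a"
    have a': "a' \<in> carrier A" using ag by (simp add: a'_def act_closed)
    have x: "x \<in> carrier MB" using ag by (simp add: B.multiplier_mult_closed iA_multiplier iG_multiplier)
    have x_eq: "x = multiplier_embedding B (elt g a')"
    proof (rule B.emb_eqI[OF x])
      fix b assume b: "b \<in> carrier B"
      show "fst x b = elt g a' \<otimes>\<^bsub>B\<^esub> b"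
        using ag a' b covariance_inv[OF ag(2,1) b]
        by (simp add: a'_def[symmetric] B.multiplier_simps compose_def lA_def uG_def)
    qed (use ag a' in simp)
    have "\<exists>y\<in>?E. nrm MB (y \<ominus>\<^bsub>MB\<^esub> x) < e" if e: "e > 0" for e
    proof -
      obtain f where f: "f \<in> A0" "nrm A (f \<ominus>\<^bsub>A\<^esub> a') < e"
        using A.norm_closure_iff[of A0 a'] A0_dense a' e by (auto simp: subset_iff)
      define d where "d = f \<ominus>\<^bsub>A\<^esub> a'"
      have d: "d \<in> carrier A" using f a' by (simp add: d_def)
      have "multiplier_embedding B (elt g f) \<ominus>\<^bsub>MB\<^esub> x = multiplier_embedding B (elt g d)"
        unfolding x_eq d_def using f a' ag by (simp add: elt_minus B.emb_minus)
      also have "nrm MB (multiplier_embedding B (elt g d)) \<le> nrm A d"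
      proof (rule B.multiplier_norm_le)
        show "nrm B (fst (multiplier_embedding B (elt g d)) b) \<le> nrm A d * nrm B b" if "b \<in> carrier B" for b
          using that ag d by (simp add: B.emb_simps uG_isometric lA_contractive)
      qed (use ag d in \<open>simp_all add: B.emb_closed A.nrm_nonneg\<close>)
      finally have "nrm MB (multiplier_embedding B (elt g f) \<ominus>\<^bsub>MB\<^esub> x) < e" using f by (simp add: d_def)
      moreover have "multiplier_embedding B (elt g f) \<in> ?E" using f ag by (intro imageI) simp
      ultimately show ?thesis by (rule rev_bexI[rotated])
    qed
    then show ?thesis unfolding M.norm_closure_iff[OF Ec] using x by (intro conjI allI impI)
  qed
  then have "cspan MB ?S \<subseteq> norm_closure MB (nrm MB) ?E"
    by (intro M.cspan_minimal M.submodule_norm_closure[OF E] subsetI)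
  then have "norm_closure MB (nrm MB) (cspan MB ?S) \<subseteq> norm_closure MB (nrm MB) ?E"
    using M.norm_closure_mono[of "cspan MB ?S" "norm_closure MB (nrm MB) ?E"] by (simp only: M.norm_closure_closure)
  then have sub: "multiplier_embedding B ` carrier B \<subseteq> norm_closure MB (nrm MB) ?E" unfolding B.dense .
  have "b \<in> norm_closure B (nrm B) B0" if b: "b \<in> carrier B" for b
    unfolding B.norm_closure_iff[OF B0c]
  proof (intro conjI b allI impI)
    fix e :: real assume "e > 0"
    then obtain c where c: "c \<in> B0" "nrm MB (multiplier_embedding B c \<ominus>\<^bsub>MB\<^esub> multiplier_embedding B b) < e"
      using subsetD[OF sub imageI[OF b]] unfolding M.norm_closure_iff[OF Ec] by blast
    have "multiplier_embedding B c \<ominus>\<^bsub>MB\<^esub> multiplier_embedding B b = multiplier_embedding B (c \<ominus>\<^bsub>B\<^esub> b)"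
      using b c by (simp add: B.emb_minus)
    then show "\<exists>c\<in>B0. nrm B (c \<ominus>\<^bsub>B\<^esub> b) < e" using b c by (intro bexI[of _ c]) (simp_all add: B.emb_norm)
  qed
  then show ?thesis using B.norm_closure_subset by blast
qed

text \<open>
  A local unit for \<open>a\<close> is one for \<open>elt g a\<close>; for a sum, take a common local unit of the units of the
  summands.
\<close>

lemma right_local_unit:
  assumes "b \<in> B0"
  shows "\<exists>p\<in>A0. star A p = p \<and> p \<otimes>\<^bsub>A\<^esub> p = p \<and> b \<otimes>\<^bsub>B\<^esub> elt \<one> p = b"
  using assms
proof (induction rule: B0_induct)
  case (elt g a)
  then obtain p where p: "p \<in> A0" "star A p = p" "p \<otimes>\<^bsub>A\<^esub> p = p" "a \<otimes>\<^bsub>A\<^esub> p = a"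
    using local_unit[of a a] by blast
  have "elt g a \<otimes>\<^bsub>B\<^esub> elt \<one> p = elt g a"
  proof (rule elt_eqI)
    fix b assume "b \<in> carrier B"
    then show "elt g a \<otimes>\<^bsub>B\<^esub> elt \<one> p \<otimes>\<^bsub>B\<^esub> b = uG g (lA a b)"
      using elt p lA_hom(3)[of a b p] by simp
  qed (use elt p in auto)
  then show ?case using p by blast
next
  case zero
  then show ?case using local_unit[of "\<zero>\<^bsub>A\<^esub>" "\<zero>\<^bsub>A\<^esub>"] by auto
next
  case (add b c)
  then obtain p q where p: "p \<in> A0" "b \<otimes>\<^bsub>B\<^esub> elt \<one> p = b" and q: "q \<in> A0" "c \<otimes>\<^bsub>B\<^esub> elt \<one> q = c" by blast
  obtain r where r: "r \<in> A0" "star A r = r" "r \<otimes>\<^bsub>A\<^esub> r = r" "p \<otimes>\<^bsub>A\<^esub> r = p" "q \<otimes>\<^bsub>A\<^esub> r = q"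
    using local_unit[OF p(1) q(1)] by blast
  have one: "elt \<one> s \<otimes>\<^bsub>B\<^esub> elt \<one> r = elt \<one> s" if s: "s \<in> A0" "s \<otimes>\<^bsub>A\<^esub> r = s" for s
  proof (rule elt_eqI)
    fix b assume "b \<in> carrier B"
    then show "elt \<one> s \<otimes>\<^bsub>B\<^esub> elt \<one> r \<otimes>\<^bsub>B\<^esub> b = uG \<one> (lA s b)"
      using s r lA_hom(3)[of s b r] by simp
  qed (use s r in auto)
  have "b \<otimes>\<^bsub>B\<^esub> elt \<one> r = b" 
    using B.mult_assoc[of b "elt \<one> p" "elt \<one> r"] p add.hyps r(1) one[OF p(1) r(4)] by simp
  moreover have "c \<otimes>\<^bsub>B\<^esub> elt \<one> r = c"
    using B.mult_assoc[of c "elt \<one> q" "elt \<one> r"] q add.hyps r(1) one[OF q(1) r(5)] by simp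
  ultimately have "(b \<oplus>\<^bsub>B\<^esub> c) \<otimes>\<^bsub>B\<^esub> elt \<one> r = b \<oplus>\<^bsub>B\<^esub> c"
    using add.hyps r(1) by (simp add: B.distrib_right)
  then show ?case using r by blast
next
  case (scale k b)
  then obtain p where "p \<in> A0" "star A p = p" "p \<otimes>\<^bsub>A\<^esub> p = p" "b \<otimes>\<^bsub>B\<^esub> elt \<one> p = b" by blast
  then show ?case using scale(1) by (intro bexI[of _ p]) (simp_all add: B.smult_mult_left)
qed

lemma left_local_unit:
  assumes "b \<in> B0"
  shows "\<exists>p\<in>A0. elt \<one> p \<otimes>\<^bsub>B\<^esub> b = b"
proof -
  obtain p where p: "p \<in> A0" "star A p = p" "star B b \<otimes>\<^bsub>B\<^esub> elt \<one> p = star B b"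
    using right_local_unit[of "star B b"] assms by auto
  have "star B (star B b \<otimes>\<^bsub>B\<^esub> elt \<one> p) = elt \<one> p \<otimes>\<^bsub>B\<^esub> b"
    using p(1,2) assms B.star_mult[of "star B b" "elt \<one> p"] by (simp add: elt_one_star del: elt_mult)
  then show ?thesis using p assms by (intro bexI[of _ p]) auto
qed

end

section \<open>Representations of the algebraic crossed product\<close>

locale crossed_product_representation =
  crossed_product_with_projections G A act B iA iG A0 \<kappa> + X: hilbert_space X
  for G :: "('g, 'm) monoid_scheme" (structure) and A :: "('g \<Rightarrow> complex) star_alg"
    and act :: "'g \<Rightarrow> ('g \<Rightarrow> complex) \<Rightarrow> 'g \<Rightarrow> complex" and B :: "'b star_alg"
    and iA :: "('g \<Rightarrow> complex) \<Rightarrow> ('b \<Rightarrow> 'b) \<times> ('b \<Rightarrow> 'b)"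
    and iG :: "'g \<Rightarrow> ('b \<Rightarrow> 'b) \<times> ('b \<Rightarrow> 'b)"
    and A0 :: "('g \<Rightarrow> complex) set" and \<kappa> :: "'g \<Rightarrow> 'g \<Rightarrow> complex"
    and X :: "'x inner_product_space" +
  fixes \<pi> :: "'b \<Rightarrow> 'x \<Rightarrow> 'x"
  assumes \<pi>_hom: "star_hom (B\<lparr>carrier := algebraic_crossed_product G A0 B iA iG\<rparr>) (operator_algebra X) \<pi>"
begin

lemma \<pi>_bops: "b \<in> B0 \<Longrightarrow> \<pi> b \<in> X.bops"
  using X.star_hom_operatorD(1)[OF \<pi>_hom, of b] by simp

lemma \<pi>_closed [simp]: "\<lbrakk>b \<in> B0; x \<in> carrier X\<rbrakk> \<Longrightarrow> \<pi> b x \<in> carrier X"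
  using X.bopsD(1)[OF \<pi>_bops] .

lemma \<pi>_hom_simps:
  assumes b: "b \<in> B0" and x: "x \<in> carrier X"
  shows "c \<in> B0 \<Longrightarrow> \<pi> (b \<oplus>\<^bsub>B\<^esub> c) x = \<pi> b x \<oplus>\<^bsub>X\<^esub> \<pi> c x"
    "\<pi> (k \<odot>\<^bsub>B\<^esub> b) x = k \<odot>\<^bsub>X\<^esub> \<pi> b x"
    "c \<in> B0 \<Longrightarrow> \<pi> (b \<otimes>\<^bsub>B\<^esub> c) x = \<pi> b (\<pi> c x)"
    "y \<in> carrier X \<Longrightarrow> ip X (\<pi> b x) y = ip X x (\<pi> (star B b) y)"
  using X.star_hom_operatorD(2-5)[OF \<pi>_hom, of b] b x by simp_all

lemma \<pi>_elt_mult: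
  assumes "g \<in> carrier G" "a \<in> A0" "b \<in> B0" "x \<in> carrier X"
  shows "\<pi> (elt g a) (\<pi> b x) = \<pi> (uG g (lA a b)) x"
  using \<pi>_hom_simps(3)[of "elt g a" x b] assms by simp

lemma \<pi>_one_mult:
  assumes "a \<in> A0" "b \<in> A0" "x \<in> carrier X"
  shows "\<pi> (elt \<one> a) (\<pi> (elt \<one> b) x) = \<pi> (elt \<one> (a \<otimes>\<^bsub>A\<^esub> b)) x"
proof -
  have "lA a (elt \<one> b) = elt \<one> (a \<otimes>\<^bsub>A\<^esub> b)"
    by (rule elt_eqI) (use assms in \<open>auto simp: lA_hom\<close>)
  then show ?thesis using \<pi>_elt_mult[of "\<one>" a "elt \<one> b" x] assms by simp
qed

lemma \<pi>_one_adjoint: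
  assumes "a \<in> A0" "x \<in> carrier X" "y \<in> carrier X"
  shows "ip X (\<pi> (elt \<one> a) x) y = ip X x (\<pi> (elt \<one> (star A a)) y)"
  using \<pi>_hom_simps(4)[of "elt \<one> a" x y] assms by (simp add: elt_one_star)

lemma \<pi>_one_len_sq:
  assumes "a \<in> A0" "x \<in> carrier X"
  shows "(X.len (\<pi> (elt \<one> a) x))\<^sup>2 = Re (ip X x (\<pi> (elt \<one> (star A a \<otimes>\<^bsub>A\<^esub> a)) x))"
  using assms \<pi>_one_adjoint[of a x "\<pi> (elt \<one> a) x"] by (simp add: X.len_sq \<pi>_one_mult)

lemma \<pi>_projection_contractive:
  assumes p: "p \<in> A0" "star A p = p" "p \<otimes>\<^bsub>A\<^esub> p = p" and x: "x \<in> carrier X"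
  shows "X.len (\<pi> (elt \<one> p) x) \<le> X.len x"
proof -
  define y where "y = \<pi> (elt \<one> p) x"
  have y: "y \<in> carrier X" using p x by (simp add: y_def)
  have "(X.len y)\<^sup>2 = Re (ip X x y)" using \<pi>_one_len_sq[OF p(1) x] p by (simp add: y_def)
  also have "\<dots> \<le> X.len x * X.len y"
    using X.Cauchy_Schwarz[OF x y] complex_Re_le_cmod order_trans by blast
  finally have "X.len y * X.len y \<le> X.len x * X.len y" by (simp add: power2_eq_square)
  then show ?thesis
    using X.len_nonneg[OF y] X.len_nonneg[OF x] unfolding y_def[symmetric] by (cases "X.len y = 0") auto
qed

text \<open>
  If \<open>a\<^sup>* a + q\<^sup>* q = p\<close>, then \<open>\<parallel>\<pi>(a) x\<parallel>\<^sup>2 + \<parallel>\<pi>(q) x\<parallel>\<^sup>2 = \<parallel>\<pi>(p) x\<parallel>\<^sup>2 \<le> \<parallel>x\<parallel>\<^sup>2\<close>.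
\<close>

lemma \<pi>_A0_contractive:
  assumes a: "a \<in> A0" and x: "x \<in> carrier X"
  shows "X.len (\<pi> (elt \<one> a) x) \<le> nrm A a * X.len x"
proof -
  have unit: "X.len (\<pi> (elt \<one> b) x) \<le> X.len x" if b: "b \<in> A0" "nrm A b \<le> 1" for b
  proof -
    obtain p q where pq: "p \<in> A0" "q \<in> A0" "star A p = p" "p \<otimes>\<^bsub>A\<^esub> p = p"
      "star A b \<otimes>\<^bsub>A\<^esub> b \<oplus>\<^bsub>A\<^esub> star A q \<otimes>\<^bsub>A\<^esub> q = p"
      using complement[OF b] by blast
    let ?bb = "star A b \<otimes>\<^bsub>A\<^esub> b" and ?qq = "star A q \<otimes>\<^bsub>A\<^esub> q"
    have "elt \<one> p = elt \<one> ?bb \<oplus>\<^bsub>B\<^esub> elt \<one> ?qq"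
      unfolding pq(5)[symmetric] using b pq(2) by (intro elt_add) auto
    then have "\<pi> (elt \<one> p) x = \<pi> (elt \<one> ?bb) x \<oplus>\<^bsub>X\<^esub> \<pi> (elt \<one> ?qq) x"
      using b pq(2) x by (simp add: \<pi>_hom_simps)
    then have "Re (ip X x (\<pi> (elt \<one> p) x)) =
        Re (ip X x (\<pi> (elt \<one> ?bb) x)) + Re (ip X x (\<pi> (elt \<one> ?qq) x))"
      using b pq(2) x by (simp add: X.ip_add_right)
    moreover have "Re (ip X x (\<pi> (elt \<one> p) x)) = (X.len (\<pi> (elt \<one> p) x))\<^sup>2"
      using \<pi>_one_len_sq[OF pq(1) x] pq(3,4) by simp
    ultimately have "(X.len (\<pi> (elt \<one> b) x))\<^sup>2 \<le> (X.len (\<pi> (elt \<one> p) x))\<^sup>2"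
      using \<pi>_one_len_sq[OF b(1) x] \<pi>_one_len_sq[OF pq(2) x]
        zero_le_power2[of "X.len (\<pi> (elt \<one> q) x)"] by linarith
    also have "\<dots> \<le> (X.len x)\<^sup>2"
      using \<pi>_projection_contractive[OF pq(1,3,4) x] X.len_nonneg pq(1) x by (intro power_mono) auto
    finally show ?thesis by (rule power2_le_imp_le) (simp add: X.len_nonneg x)
  qed
  show ?thesis
  proof (cases "nrm A a = 0")
    case True
    then have "a = 0 \<odot>\<^bsub>A\<^esub> a" using a by (simp add: A.nrm_eq_0)
    then have "elt \<one> a = 0 \<odot>\<^bsub>B\<^esub> elt \<one> a" using elt_scale[of "\<one>" a 0] a by simp
    then have "\<pi> (elt \<one> a) x = 0 \<odot>\<^bsub>X\<^esub> \<pi> (elt \<one> a) x"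
      using \<pi>_hom_simps(2)[of "elt \<one> a" x 0] a x by simp
    then show ?thesis using True a x by simp
  next
    case False
    then have r: "nrm A a > 0" using A.nrm_nonneg[of a] a by simp
    define b where "b = complex_of_real (1 / nrm A a) \<odot>\<^bsub>A\<^esub> a"
    have b: "b \<in> A0" "nrm A b \<le> 1" using a r by (simp_all add: b_def A.nrm_smult norm_divide)
    have "X.len (\<pi> (elt \<one> b) x) = X.len (\<pi> (elt \<one> a) x) / nrm A a"
      using a x r by (simp add: b_def elt_scale \<pi>_hom_simps X.len_scale norm_divide)
    then show ?thesis using mult_right_mono[OF unit[OF b], of "nrm A a"] r by (simp add: field_simps)
  qed
qed

text \<open>
  The representation of \<open>A\<close> that extends the restriction of \<open>\<pi>\<close> to \<open>A0\<close>.
\<close>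

definition "\<rho> = (SOME \<rho>. star_hom A (operator_algebra X) \<rho> \<and> (\<forall>a\<in>A0. \<rho> a = \<pi> (elt \<one> a)))"

lemma \<rho>_hom: "star_hom A (operator_algebra X) \<rho>"
  and \<rho>_A0: "a \<in> A0 \<Longrightarrow> \<rho> a = \<pi> (elt \<one> a)"
proof -
  have "star_hom (A\<lparr>carrier := A0\<rparr>) (operator_algebra X) (\<lambda>a. \<pi> (elt \<one> a))"
    by (rule X.star_hom_operatorI)
      (auto simp: \<pi>_bops elt_add elt_scale \<pi>_hom_simps(1,2) \<pi>_one_mult \<pi>_one_adjoint)
  from star_hom_extend[OF A.cstar_algebra_axioms X.hilbert_space_axioms A0_star_subalgebra A0_dense this
      \<pi>_A0_contractive]
  have ex: "\<exists>\<rho>. star_hom A (operator_algebra X) \<rho> \<and> (\<forall>a\<in>A0. \<rho> a = \<pi> (elt \<one> a))" .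
  from someI_ex[OF ex] show "star_hom A (operator_algebra X) \<rho>" "a \<in> A0 \<Longrightarrow> \<rho> a = \<pi> (elt \<one> a)"
    by (auto simp: \<rho>_def)
qed

lemma \<rho>_bops: "a \<in> carrier A \<Longrightarrow> \<rho> a \<in> X.bops"
  by (rule X.star_hom_operatorD(1)[OF \<rho>_hom])

lemma \<rho>_closed [simp]: "\<lbrakk>a \<in> carrier A; x \<in> carrier X\<rbrakk> \<Longrightarrow> \<rho> a x \<in> carrier X"
  using X.bopsD(1)[OF \<rho>_bops] .

lemmas \<rho>_hom_simps = X.star_hom_operatorD(2-5)[OF \<rho>_hom]

lemma A0_seq: "a \<in> carrier A \<Longrightarrow> \<exists>f. (\<forall>n. f n \<in> A0) \<and> converges A (nrm A) f a"
  using A.norm_closure_seq[of A0 a] A0_dense by (simp add: subset_iff)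

end

locale cyclic_representation =
  crossed_product_representation G A act B iA iG A0 \<kappa> X \<pi>
  for G :: "('g, 'm) monoid_scheme" (structure) and A :: "('g \<Rightarrow> complex) star_alg"
    and act :: "'g \<Rightarrow> ('g \<Rightarrow> complex) \<Rightarrow> 'g \<Rightarrow> complex" and B :: "'b star_alg"
    and iA :: "('g \<Rightarrow> complex) \<Rightarrow> ('b \<Rightarrow> 'b) \<times> ('b \<Rightarrow> 'b)"
    and iG :: "'g \<Rightarrow> ('b \<Rightarrow> 'b) \<times> ('b \<Rightarrow> 'b)"
    and A0 :: "('g \<Rightarrow> complex) set" and \<kappa> :: "'g \<Rightarrow> 'g \<Rightarrow> complex"
    and X :: "'x inner_product_space" and \<pi> :: "'b \<Rightarrow> 'x \<Rightarrow> 'x" +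
  fixes \<xi> :: 'x
  assumes \<xi> [simp]: "\<xi> \<in> carrier X"
begin

definition "V0 = (\<lambda>b. \<pi> b \<xi>) ` B0"

definition "W = norm_closure X (ip_norm X) V0"

lemma V0_carrier: "V0 \<subseteq> carrier X"
  by (auto simp: V0_def)

lemma V0_mem [simp]: "b \<in> B0 \<Longrightarrow> \<pi> b \<xi> \<in> V0"
  by (auto simp: V0_def)

lemma V0_submodule: "submodule V0 complex_ring X"
  unfolding X.submodule_iff
proof (intro conjI ballI allI V0_carrier)
  have "\<pi> (0 \<odot>\<^bsub>B\<^esub> \<zero>\<^bsub>B\<^esub>) \<xi> = 0 \<odot>\<^bsub>X\<^esub> \<pi> \<zero>\<^bsub>B\<^esub> \<xi>" by (rule \<pi>_hom_simps) auto
  then have "\<pi> \<zero>\<^bsub>B\<^esub> \<xi> = \<zero>\<^bsub>X\<^esub>" by simp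
  then show "\<zero>\<^bsub>X\<^esub> \<in> V0" using V0_mem[of "\<zero>\<^bsub>B\<^esub>"] by simp
  fix v assume "v \<in> V0"
  then obtain b where b: "b \<in> B0" "v = \<pi> b \<xi>" by (auto simp: V0_def)
  show "c \<odot>\<^bsub>X\<^esub> v \<in> V0" for c using b V0_mem[of "c \<odot>\<^bsub>B\<^esub> b"] by (simp add: \<pi>_hom_simps)
  fix w assume "w \<in> V0"
  then obtain c where c: "c \<in> B0" "w = \<pi> c \<xi>" by (auto simp: V0_def)
  show "v \<oplus>\<^bsub>X\<^esub> w \<in> V0" using b c V0_mem[of "b \<oplus>\<^bsub>B\<^esub> c"] by (simp add: \<pi>_hom_simps)
qed

lemma W_submodule: "submodule W complex_ring X"
  unfolding W_def by (rule X.submodule_norm_closure[OF V0_submodule])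

lemma W_closed: "norm_closure X (ip_norm X) W = W"
  unfolding W_def by (rule X.norm_closure_closure)

lemma V0_W: "V0 \<subseteq> W"
  unfolding W_def by (rule X.norm_closure_increasing[OF V0_carrier])

lemma W_mem [simp]: "w \<in> W \<Longrightarrow> w \<in> carrier X" "b \<in> B0 \<Longrightarrow> \<pi> b \<xi> \<in> W"
  using X.norm_closure_subset V0_W V0_mem unfolding W_def by blast+

lemma W_seq: "w \<in> W \<Longrightarrow> \<exists>b. (\<forall>n. b n \<in> B0) \<and> converges X (ip_norm X) (\<lambda>n. \<pi> (b n) \<xi>) w"
proof -
  assume "w \<in> W"
  then obtain v where v: "\<forall>n. v n \<in> V0" "converges X (ip_norm X) v w"
    using X.norm_closure_seq[OF V0_carrier] unfolding W_def by blast
  then have "\<forall>n. \<exists>b. b \<in> B0 \<and> v n = \<pi> b \<xi>" by (auto simp: V0_def)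
  then obtain b where "\<And>n. b n \<in> B0 \<and> v n = \<pi> (b n) \<xi>" by metis
  then have "\<forall>n. b n \<in> B0" "v = (\<lambda>n. \<pi> (b n) \<xi>)" by auto
  then show ?thesis using v(2) by blast
qed

lemma W_limit: "\<lbrakk>\<And>n. w n \<in> W; converges X (ip_norm X) w v\<rbrakk> \<Longrightarrow> v \<in> W"
proof -
  assume "\<And>n. w n \<in> W" "converges X (ip_norm X) w v"
  then have "v \<in> norm_closure X (ip_norm X) W"
    using X.norm_closure_seq[of W v] W_mem(1) by blast
  then show "v \<in> W" by (simp add: W_closed)
qed

text \<open>
  Since \<open>(u\<^sub>g b)\<^sup>* (u\<^sub>g c) = b\<^sup>* c\<close>, both sides are the inner product of \<open>\<xi>\<close> with \<open>\<pi>(b\<^sup>* c) \<xi>\<close>.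
\<close>

lemma translate_ip:
  assumes "g \<in> carrier G" "b \<in> B0" "c \<in> B0"
  shows "ip X (\<pi> (uG g b) \<xi>) (\<pi> (uG g c) \<xi>) = ip X (\<pi> b \<xi>) (\<pi> c \<xi>)"
proof -
  have "ip X (\<pi> (uG g b) \<xi>) (\<pi> (uG g c) \<xi>) = ip X \<xi> (\<pi> (star B (uG g b) \<otimes>\<^bsub>B\<^esub> uG g c) \<xi>)"
    using assms by (simp add: \<pi>_hom_simps(3,4))
  also have "\<dots> = ip X (\<pi> b \<xi>) (\<pi> c \<xi>)"
    using assms by (simp add: \<pi>_hom_simps(3,4) uG_unitary)
  finally show ?thesis .
qed

lemma translate_len:
  assumes "g \<in> carrier G" "b \<in> B0"
  shows "X.len (\<pi> (uG g b) \<xi>) = X.len (\<pi> b \<xi>)"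
  using translate_ip[OF assms assms(2)] by (simp add: ip_norm_def)

lemma translate_cong:
  assumes g: "g \<in> carrier G" and b: "b \<in> B0" and c: "c \<in> B0" and eq: "\<pi> b \<xi> = \<pi> c \<xi>"
  shows "\<pi> (uG g b) \<xi> = \<pi> (uG g c) \<xi>"
proof -
  define d where "d = b \<oplus>\<^bsub>B\<^esub> (-1) \<odot>\<^bsub>B\<^esub> c"
  have d: "d \<in> B0" using b c by (simp add: d_def)
  have "\<pi> d \<xi> = \<pi> b \<xi> \<ominus>\<^bsub>X\<^esub> \<pi> c \<xi>" using b c by (simp add: d_def \<pi>_hom_simps X.minus_eq_scale)
  then have "\<pi> d \<xi> = \<zero>\<^bsub>X\<^esub>" using eq c by (simp add: X.minus_eq_zero_iff)
  then have "X.len (\<pi> (uG g d) \<xi>) = 0" using translate_len[OF g d] by simp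
  then have "\<pi> (uG g d) \<xi> = \<zero>\<^bsub>X\<^esub>" using g d by (simp add: X.len_eq_0)
  moreover have "\<pi> (uG g d) \<xi> = \<pi> (uG g b) \<xi> \<ominus>\<^bsub>X\<^esub> \<pi> (uG g c) \<xi>"
    using g b c by (simp add: d_def \<pi>_hom_simps X.minus_eq_scale)
  ultimately show ?thesis using g b c by (simp add: X.minus_eq_zero_iff)
qed

text \<open>
  The unitary operator of \<open>g\<close> on \<open>W\<close>: the extension by continuity of \<open>\<pi>(b) \<xi> \<mapsto> \<pi>(u\<^sub>g b) \<xi>\<close>, which is
  well defined by \<open>translate_cong\<close>.
\<close>

definition U :: "'g \<Rightarrow> 'x \<Rightarrow> 'x"
  where "U g = (SOME T. bounded_linear_on X (ip_norm X) X (ip_norm X) W 1 T \<and>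
    (\<forall>b\<in>B0. T (\<pi> b \<xi>) = \<pi> (uG g b) \<xi>))"

lemma U_spec:
  assumes g: "g \<in> carrier G"
  shows "bounded_linear_on X (ip_norm X) X (ip_norm X) W 1 (U g)"
    and "b \<in> B0 \<Longrightarrow> U g (\<pi> b \<xi>) = \<pi> (uG g b) \<xi>"
proof -
  \<comment> \<open>\<open>T\<close> picks a representative \<open>b\<close> of \<open>v = \<pi>(b) \<xi>\<close>; the choice is immaterial by \<open>translate_cong\<close>\<close>
  define rep where "rep v = (SOME b. b \<in> B0 \<and> \<pi> b \<xi> = v)" for v
  have rep: "rep (\<pi> b \<xi>) \<in> B0 \<and> \<pi> (rep (\<pi> b \<xi>)) \<xi> = \<pi> b \<xi>" if "b \<in> B0" for b
    unfolding rep_def by (rule someI[of _ b]) (use that in simp)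
  define T where "T v = \<pi> (uG g (rep v)) \<xi>" for v
  have T: "T (\<pi> b \<xi>) = \<pi> (uG g b) \<xi>" if "b \<in> B0" for b
    unfolding T_def using rep[OF that] that g by (intro translate_cong) auto
  have "bounded_linear_on X (ip_norm X) X (ip_norm X) V0 1 T"
    unfolding bounded_linear_on_def
  proof (intro conjI ballI allI funcsetI)
    fix v assume "v \<in> V0"
    then obtain b where b: "b \<in> B0" "v = \<pi> b \<xi>" by (auto simp: V0_def)
    show "T v \<in> carrier X" using b g by (simp add: T)
    show "X.len (T v) \<le> 1 * X.len v" using b g by (simp add: T translate_len)
    show "T (k \<odot>\<^bsub>X\<^esub> v) = k \<odot>\<^bsub>X\<^esub> T v" for k
      using T[of "k \<odot>\<^bsub>B\<^esub> b"] b g by (simp add: T \<pi>_hom_simps)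
    fix w assume "w \<in> V0"
    then obtain c where c: "c \<in> B0" "w = \<pi> c \<xi>" by (auto simp: V0_def)
    show "T (v \<oplus>\<^bsub>X\<^esub> w) = T v \<oplus>\<^bsub>X\<^esub> T w"
      using T[of "b \<oplus>\<^bsub>B\<^esub> c"] b c g by (simp add: T \<pi>_hom_simps)
  qed simp
  from bounded_linear_on_extend[OF X.normed_cspace_axioms X.normed_cspace_axioms X.complete V0_submodule this]
  obtain T' where T': "bounded_linear_on X (ip_norm X) X (ip_norm X) W 1 T'" "\<forall>v\<in>V0. T' v = T v"
    unfolding W_def by blast
  then have "\<exists>T. bounded_linear_on X (ip_norm X) X (ip_norm X) W 1 T \<and>
    (\<forall>b\<in>B0. T (\<pi> b \<xi>) = \<pi> (uG g b) \<xi>)" using T by auto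
  from someI_ex[OF this] show "bounded_linear_on X (ip_norm X) X (ip_norm X) W 1 (U g)"
    and "b \<in> B0 \<Longrightarrow> U g (\<pi> b \<xi>) = \<pi> (uG g b) \<xi>" unfolding U_def by auto
qed

lemma U_converges:
  assumes "g \<in> carrier G" "\<And>n. w n \<in> W" "converges X (ip_norm X) w v"
  shows "converges X (ip_norm X) (\<lambda>n. U g (w n)) (U g v)"
  by (rule converges_bounded_linear_on[OF X.normed_cspace_axioms X.normed_cspace_axioms W_submodule
        U_spec(1)[OF assms(1)] assms(2) W_limit[OF assms(2,3)] assms(3)])

lemma U_closed [simp]:
  assumes g: "g \<in> carrier G" and w: "w \<in> W"
  shows "U g w \<in> W"
proof -
  obtain b where b: "\<forall>n. b n \<in> B0" "converges X (ip_norm X) (\<lambda>n. \<pi> (b n) \<xi>) w" using W_seq[OF w] by blast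
  have "converges X (ip_norm X) (\<lambda>n. U g (\<pi> (b n) \<xi>)) (U g w)" using b g by (intro U_converges) auto
  moreover have "U g (\<pi> (b n) \<xi>) \<in> W" for n using b(1) g by (simp add: U_spec(2))
  ultimately show ?thesis by (rule W_limit[rotated])
qed

lemma \<pi>_W [simp]:
  assumes b: "b \<in> B0" and w: "w \<in> W"
  shows "\<pi> b w \<in> W"
proof -
  obtain c where c: "\<forall>n. c n \<in> B0" "converges X (ip_norm X) (\<lambda>n. \<pi> (c n) \<xi>) w" using W_seq[OF w] by blast
  have "\<pi> b (\<pi> (c n) \<xi>) \<in> W" for n
    using b c(1) W_mem(2)[of "b \<otimes>\<^bsub>B\<^esub> c n"] by (simp add: \<pi>_hom_simps)
  then show ?thesis by (rule W_limit[OF _ X.converges_bops[OF \<pi>_bops[OF b] c(2)]])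
qed

lemma \<rho>_W [simp]:
  assumes a: "a \<in> carrier A" and w: "w \<in> W"
  shows "\<rho> a w \<in> W"
proof -
  obtain f where f: "\<forall>n. f n \<in> A0" "converges A (nrm A) f a" using A0_seq[OF a] by blast
  have "\<rho> (f n) w \<in> W" for n using f(1) w by (simp add: \<rho>_A0)
  then show ?thesis
    by (rule W_limit[OF _ converges_star_hom[OF A.cstar_algebra_axioms X.hilbert_space_axioms \<rho>_hom f(2) W_mem(1)[OF w]]])
qed

lemma U_eq_on_dense:
  assumes S: "\<And>w v. \<lbrakk>\<And>n. w n \<in> W; converges X (ip_norm X) w v\<rbrakk> \<Longrightarrow> converges X (ip_norm X) (\<lambda>n. S (w n)) (S v)"
    and T: "\<And>w v. \<lbrakk>\<And>n. w n \<in> W; converges X (ip_norm X) w v\<rbrakk> \<Longrightarrow> converges X (ip_norm X) (\<lambda>n. T (w n)) (T v)"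
    and eq: "\<And>b. b \<in> B0 \<Longrightarrow> S (\<pi> b \<xi>) = T (\<pi> b \<xi>)" and w: "w \<in> W"
  shows "S w = T w"
proof -
  obtain b where b: "\<forall>n. b n \<in> B0" "converges X (ip_norm X) (\<lambda>n. \<pi> (b n) \<xi>) w" using W_seq[OF w] by blast
  have "converges X (ip_norm X) (\<lambda>n. S (\<pi> (b n) \<xi>)) (S w)" using b by (intro S) auto
  moreover have "converges X (ip_norm X) (\<lambda>n. T (\<pi> (b n) \<xi>)) (T w)" using b by (intro T) auto
  ultimately show ?thesis using b(1) eq X.converges_unique by simp
qed

lemma U_mult:
  assumes g: "g \<in> carrier G" and h: "h \<in> carrier G" and w: "w \<in> W"
  shows "U (g \<otimes> h) w = U g (U h w)"
proof (rule U_eq_on_dense[OF _ _ _ w])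
  fix b assume "b \<in> B0"
  then show "U (g \<otimes> h) (\<pi> b \<xi>) = U g (U h (\<pi> b \<xi>))" using g h by (simp add: U_spec(2) uG_mult)
qed (use g h in \<open>auto intro!: U_converges\<close>)

lemma U_one: "w \<in> W \<Longrightarrow> U \<one> w = w"
proof (rule U_eq_on_dense)
  fix b assume "b \<in> B0"
  then show "U \<one> (\<pi> b \<xi>) = \<pi> b \<xi>" by (simp add: U_spec(2))
qed (auto intro!: U_converges)

lemma U_ip:
  assumes g: "g \<in> carrier G" and v: "v \<in> W" and w: "w \<in> W"
  shows "ip X (U g v) (U g w) = ip X v w"
proof -
  have one: "ip X (U g (\<pi> b \<xi>)) (U g w) = ip X (\<pi> b \<xi>) w" if b: "b \<in> B0" for b
  proof -
    obtain c where c: "\<forall>n. c n \<in> B0" "converges X (ip_norm X) (\<lambda>n. \<pi> (c n) \<xi>) w" using W_seq[OF w] by blast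
    have Uc: "converges X (ip_norm X) (\<lambda>n. U g (\<pi> (c n) \<xi>)) (U g w)" using c g by (intro U_converges) auto
    have "(\<lambda>n. ip X (U g (\<pi> b \<xi>)) (U g (\<pi> (c n) \<xi>))) \<longlonglongrightarrow> ip X (U g (\<pi> b \<xi>)) (U g w)"
      using X.converges_ip_right[OF Uc] g b by simp
    moreover have "(\<lambda>n. ip X (\<pi> b \<xi>) (\<pi> (c n) \<xi>)) \<longlonglongrightarrow> ip X (\<pi> b \<xi>) w"
      using X.converges_ip_right[OF c(2)] b by simp
    ultimately show ?thesis using c(1) b g by (simp add: U_spec(2) translate_ip LIMSEQ_unique)
  qed
  obtain b where b: "\<forall>n. b n \<in> B0" "converges X (ip_norm X) (\<lambda>n. \<pi> (b n) \<xi>) v" using W_seq[OF v] by blast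
  have Ub: "converges X (ip_norm X) (\<lambda>n. U g (\<pi> (b n) \<xi>)) (U g v)" using b g by (intro U_converges) auto
  have "(\<lambda>n. ip X (U g (\<pi> (b n) \<xi>)) (U g w)) \<longlonglongrightarrow> ip X (U g v) (U g w)"
    using X.converges_ip_left[OF Ub] g w by simp
  moreover have "(\<lambda>n. ip X (\<pi> (b n) \<xi>) w) \<longlonglongrightarrow> ip X v w"
    using X.converges_ip_left[OF b(2)] w by simp
  ultimately show ?thesis using b(1) one by (simp add: LIMSEQ_unique)
qed

lemma U_inv:
  assumes g: "g \<in> carrier G" and w: "w \<in> W"
  shows "U g (U (inv g) w) = w" "U (inv g) (U g w) = w"
  using g w by (simp_all add: U_mult[symmetric] U_one)

lemma U_adjoint:
  assumes "g \<in> carrier G" "v \<in> W" "w \<in> W"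
  shows "ip X (U g v) w = ip X v (U (inv g) w)"
  using U_ip[OF assms(1,2), of "U (inv g) w"] assms by (simp add: U_inv)

lemma act_converges:
  assumes g: "g \<in> carrier G" and f: "converges A (nrm A) f a"
  shows "converges A (nrm A) (\<lambda>n. act g (f n)) (act g a)"
proof (rule converges_bounded_linear_on[OF A.normed_cspace_axioms A.normed_cspace_axioms _ _
      convergesD(1,2)[OF f] f])
  show "submodule (carrier A) complex_ring A" by (simp add: A.submodule_iff)
  show "bounded_linear_on A (nrm A) A (nrm A) (carrier A) 1 (act g)"
    using g by (auto simp: bounded_linear_on_def act_closed act_add act_scale act_contractive)
qed

text \<open>
  On the orbit of \<open>\<xi>\<close> and for \<open>a\<close> in \<open>A0\<close> this is the covariance of \<open>lA\<close> and \<open>uG\<close>; both sides are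
  continuous in \<open>w\<close> and in \<open>a\<close>.
\<close>

lemma covariant_on_W:
  assumes g: "g \<in> carrier G" and a: "a \<in> carrier A" and w: "w \<in> W"
  shows "\<rho> (act g a) (U g w) = U g (\<rho> a w)"
proof -
  have A0_case: "\<rho> (act g f) (U g w) = U g (\<rho> f w)" if f: "f \<in> A0" for f
  proof (rule U_eq_on_dense[OF _ _ _ w])
    fix b assume b: "b \<in> B0"
    have "\<rho> (act g f) (U g (\<pi> b \<xi>)) = \<pi> (lA (act g f) (uG g b)) \<xi>"
      using f b g by (simp add: \<rho>_A0 act_A0 U_spec(2) \<pi>_elt_mult)
    also have "\<dots> = U g (\<pi> (lA f b) \<xi>)" using f b g by (simp add: covariance U_spec(2))
    also have "\<dots> = U g (\<rho> f (\<pi> b \<xi>))" using f b by (simp add: \<rho>_A0 \<pi>_elt_mult)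
    finally show "\<rho> (act g f) (U g (\<pi> b \<xi>)) = U g (\<rho> f (\<pi> b \<xi>))" .
  next
    fix w v assume wv: "\<And>n. w n \<in> W" "converges X (ip_norm X) w v"
    show "converges X (ip_norm X) (\<lambda>n. \<rho> (act g f) (U g (w n))) (\<rho> (act g f) (U g v))"
      by (rule X.converges_bops[OF \<rho>_bops[OF act_closed[OF g]] U_converges[OF g wv]]) (use f in simp)
    show "converges X (ip_norm X) (\<lambda>n. U g (\<rho> f (w n))) (U g (\<rho> f v))"
      by (rule U_converges[OF g _ X.converges_bops[OF \<rho>_bops wv(2)]]) (use f wv in auto)
  qed
  obtain f where f: "\<forall>n. f n \<in> A0" "converges A (nrm A) f a" using A0_seq[OF a] by blast
  note conv = converges_star_hom[OF A.cstar_algebra_axioms X.hilbert_space_axioms \<rho>_hom]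
  have "converges X (ip_norm X) (\<lambda>n. \<rho> (act g (f n)) (U g w)) (\<rho> (act g a) (U g w))"
    by (rule conv[OF act_converges[OF g f(2)]]) (use g w in simp)
  moreover have "converges X (ip_norm X) (\<lambda>n. U g (\<rho> (f n) w)) (U g (\<rho> a w))"
    by (rule U_converges[OF g _ conv[OF f(2) W_mem(1)[OF w]]]) (use w f(1) in simp)
  ultimately show ?thesis using A0_case f(1) X.converges_unique by simp
qed

lemma \<pi>_elt_W:
  assumes g: "g \<in> carrier G" and f: "f \<in> A0" and w: "w \<in> W"
  shows "U g (\<rho> f w) = \<pi> (elt g f) w"
proof (rule U_eq_on_dense[OF _ _ _ w])
  fix b assume b: "b \<in> B0"
  show "U g (\<rho> f (\<pi> b \<xi>)) = \<pi> (elt g f) (\<pi> b \<xi>)"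
    using f b g by (simp add: \<rho>_A0 \<pi>_elt_mult U_spec(2))
next
  fix w v assume wv: "\<And>n. w n \<in> W" "converges X (ip_norm X) w v"
  show "converges X (ip_norm X) (\<lambda>n. U g (\<rho> f (w n))) (U g (\<rho> f v))"
    by (rule U_converges[OF g _ X.converges_bops[OF \<rho>_bops wv(2)]]) (use f wv in auto)
  show "converges X (ip_norm X) (\<lambda>n. \<pi> (elt g f) (w n)) (\<pi> (elt g f) v)"
    by (rule X.converges_bops[OF \<pi>_bops wv(2)]) (use f g in simp)
qed

end

section \<open>The integrated form on a cyclic subspace\<close>

context transported
begin

lemma Y_minus:
  assumes "v \<in> W" "w \<in> W"
  shows "s v \<ominus>\<^bsub>Y\<^esub> s w = s (v \<ominus> w)" "v \<ominus> w \<in> W"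
proof -
  interpret Y: hilbert_space Y by (rule Y_hilbert)
  show "s v \<ominus>\<^bsub>Y\<^esub> s w = s (v \<ominus> w)" "v \<ominus> w \<in> W"
    using assms by (simp_all add: Y.minus_eq_scale minus_eq_scale)
qed

lemma Y_converges:
  assumes "\<And>n. v n \<in> W" "w \<in> W" "converges X len v w"
  shows "converges Y (ip_norm Y) (\<lambda>n. s (v n)) (s w)"
  using assms by (simp add: converges_def Y_minus)

lemma lift_cong: "(\<And>w. w \<in> W \<Longrightarrow> S w = T w) \<Longrightarrow> lift S = lift T"
  using s_inj by (auto simp: lift_def fun_eq_iff restrict_def inv_into_f_f)

lemma lift_compose:
  "(\<And>w. w \<in> W \<Longrightarrow> T w \<in> W) \<Longrightarrow> compose (carrier Y) (lift S) (lift T) = lift (\<lambda>w. S (T w))"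
  by (rule ext) (auto simp: compose_def restrict_def lift_def[of "\<lambda>w. S (T w)"] inv_into_into inv_into_f_f s_inj)

lemma lift_ident: "(\<And>w. w \<in> W \<Longrightarrow> T w = w) \<Longrightarrow> lift T = (\<lambda>y\<in>carrier Y. y)"
  by (rule ext) (auto simp: restrict_def lift_def inv_into_f_f s_inj)

end

lemma (in crossed_product_representation) \<pi>_zero: "x \<in> carrier X \<Longrightarrow> \<pi> \<zero>\<^bsub>B\<^esub> x = \<zero>\<^bsub>X\<^esub>"
proof -
  assume x: "x \<in> carrier X"
  have "\<pi> (0 \<odot>\<^bsub>B\<^esub> \<zero>\<^bsub>B\<^esub>) x = 0 \<odot>\<^bsub>X\<^esub> \<pi> \<zero>\<^bsub>B\<^esub> x" using x by (intro \<pi>_hom_simps) auto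
  then show ?thesis using x by simp
qed

context cyclic_representation
begin

text \<open>
  An injection of \<open>W\<close> into the type of vectors for which the universal property is stated: a vector of
  \<open>W\<close> is determined by its inner products with the vectors \<open>\<pi>(elt g (\<kappa> h)) \<xi>\<close>, whose span is dense.
\<close>

definition sep :: "'x \<Rightarrow> nat \<Rightarrow> 'g \<Rightarrow> 'g \<Rightarrow> complex"
  where "sep v = (\<lambda>_ g h. ip X v (\<pi> (elt g (\<kappa> h)) \<xi>))"

text \<open>
  The elements \<open>elt g (\<kappa> h)\<close> span \<open>B0\<close> because the elements \<open>\<kappa> h\<close> span \<open>A0\<close>.
\<close>

lemma orthogonal_to_V0:
  assumes d: "d \<in> carrier X"
    and orth: "\<And>g h. \<lbrakk>g \<in> carrier G; h \<in> carrier G\<rbrakk> \<Longrightarrow> ip X d (\<pi> (elt g (\<kappa> h)) \<xi>) = 0"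
    and b: "b \<in> B0"
  shows "ip X d (\<pi> b \<xi>) = 0"
  using b
proof (induction rule: B0_induct)
  case (elt g a)
  have "submodule {f \<in> A0. ip X d (\<pi> (elt g f) \<xi>) = 0} complex_ring A"
    unfolding A.submodule_iff
  proof (intro conjI)
    have "elt g (0 \<odot>\<^bsub>A\<^esub> \<zero>\<^bsub>A\<^esub>) = 0 \<odot>\<^bsub>B\<^esub> elt g \<zero>\<^bsub>A\<^esub>" using elt(1) by (intro elt_scale) auto
    then have "elt g \<zero>\<^bsub>A\<^esub> = \<zero>\<^bsub>B\<^esub>" using elt(1) by simp
    then show "\<zero>\<^bsub>A\<^esub> \<in> {f \<in> A0. ip X d (\<pi> (elt g f) \<xi>) = 0}" using d by (simp add: \<pi>_zero)
  qed (use d elt(1) in \<open>auto simp: elt_add elt_scale \<pi>_hom_simps X.ip_add_right X.ip_scale_right\<close>)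
  moreover have "\<kappa> ` carrier G \<subseteq> {f \<in> A0. ip X d (\<pi> (elt g f) \<xi>) = 0}"
    using \<kappa>_A0 orth[OF elt(1)] by auto
  ultimately show ?case using generated elt(2) by blast
qed (use d in \<open>auto simp: \<pi>_zero \<pi>_hom_simps X.ip_add_right X.ip_scale_right\<close>)

lemma sep_inj: "inj_on sep W"
proof (rule inj_onI)
  fix v w assume v: "v \<in> W" and w: "w \<in> W" and eq: "sep v = sep w"
  define d where "d = v \<ominus>\<^bsub>X\<^esub> w"
  have dW: "d \<in> W" using X.submodule_minus[OF W_submodule v w] by (simp add: d_def)
  have "ip X d (\<pi> (elt g (\<kappa> h)) \<xi>) = 0" if "g \<in> carrier G" "h \<in> carrier G" for g h
  proof -
    have "elt g (\<kappa> h) \<in> B0" using that \<kappa>_A0 by auto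
    moreover have "ip X v (\<pi> (elt g (\<kappa> h)) \<xi>) = ip X w (\<pi> (elt g (\<kappa> h)) \<xi>)"
      using fun_cong[OF fun_cong[OF fun_cong[OF eq]], of 0 g h] by (simp add: sep_def)
    ultimately show ?thesis using v w by (simp add: d_def X.ip_minus_left)
  qed
  then have orth: "ip X d (\<pi> b \<xi>) = 0" if "b \<in> B0" for b
    using orthogonal_to_V0[OF W_mem(1)[OF dW] _ that] by blast
  obtain b where b: "\<forall>n. b n \<in> B0" "converges X (ip_norm X) (\<lambda>n. \<pi> (b n) \<xi>) d" using W_seq[OF dW] by blast
  have "(\<lambda>n. ip X d (\<pi> (b n) \<xi>)) \<longlonglongrightarrow> ip X d d" using X.converges_ip_right[OF b(2)] dW by simp
  then have "ip X d d = 0" using orth b(1) by (simp add: LIMSEQ_const_iff)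
  then have "d = \<zero>\<^bsub>X\<^esub>" using X.len_eq_0[of d] dW by (simp add: ip_norm_def)
  then show "v = w" using v w by (simp add: d_def X.minus_eq_zero_iff)
qed

sublocale T: transported X W sep
  by (intro transported.intro transported_axioms.intro X.hilbert_space_axioms W_submodule W_closed sep_inj)

sublocale Y: hilbert_space T.Y
  by (rule T.Y_hilbert)

definition "rhoY a = T.lift (\<rho> a)"

definition "UY g = T.lift (U g)"

lemma rhoY_apply [simp]: "w \<in> W \<Longrightarrow> rhoY a (sep w) = sep (\<rho> a w)"
  by (simp add: rhoY_def)

lemma UY_apply [simp]: "w \<in> W \<Longrightarrow> UY g (sep w) = sep (U g w)"
  by (simp add: UY_def)

lemma rhoY_hom: "star_hom A (operator_algebra T.Y) rhoY"
proof (rule Y.star_hom_operatorI)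
  fix a assume a: "a \<in> carrier A"
  note r = X.bopsD[OF \<rho>_bops[OF a]]
  show "rhoY a \<in> Y.bops"
    unfolding rhoY_def
  proof (rule T.lift_bounded)
    show "X.len (\<rho> a w) \<le> nrm A a * X.len w" if "w \<in> W" for w
      using star_hom_contractive[OF A.cstar_algebra_axioms X.hilbert_space_axioms \<rho>_hom a] that by simp
  qed (use a r in auto)
qed (auto simp: \<rho>_hom_simps)

lemma UY_bops:
  assumes g: "g \<in> carrier G"
  shows "UY g \<in> Y.bops"
  unfolding UY_def
  by (rule T.lift_bounded[where K = 1])
    (use g bounded_linear_onD[OF U_spec(1)[OF g]] in auto)

lemma UY_star: "g \<in> carrier G \<Longrightarrow> star (operator_algebra T.Y) (UY g) = UY (inv g)"
  by (rule Y.star_operator_eqI) (auto simp: UY_bops U_adjoint)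

lemma UY_hom: "UY \<in> hom G (unitary_group (operator_algebra T.Y))"
proof -
  have "compose (carrier T.Y) (UY g) (UY h) = UY (g \<otimes> h)" if "g \<in> carrier G" "h \<in> carrier G" for g h
    unfolding UY_def using that by (subst T.lift_compose) (auto intro!: T.lift_cong simp: U_mult)
  moreover have "UY \<one> = (\<lambda>y\<in>carrier T.Y. y)"
    unfolding UY_def by (rule T.lift_ident) (simp add: U_one)
  ultimately show ?thesis
    unfolding hom_def unitary_group_def by (auto simp: UY_bops UY_star simp del: T.Y_simps)
qed

text \<open>
  A left local unit \<open>p\<close> of \<open>b\<close> fixes \<open>\<pi>(b) \<xi>\<close>, so already the ranges contain a dense set.
\<close>

lemma rhoY_nondegenerate: "nondegenerate T.Y (ip_norm T.Y) (rhoY ` carrier A)"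
proof -
  let ?S = "{T y |T y. T \<in> rhoY ` carrier A \<and> y \<in> carrier T.Y}"
  have S: "?S \<subseteq> carrier T.Y" by auto
  note span = Y.cspan_submodule[OF S]
  have V0S: "sep v \<in> ?S" if v: "v \<in> V0" for v
  proof -
    obtain b where b: "b \<in> B0" "v = \<pi> b \<xi>" using v by (auto simp: V0_def)
    obtain p where p: "p \<in> A0" "elt \<one> p \<otimes>\<^bsub>B\<^esub> b = b" using left_local_unit[OF b(1)] by blast
    have "\<rho> p v = v" using p b \<pi>_hom_simps(3)[of "elt \<one> p" \<xi> b] by (simp add: \<rho>_A0)
    then have "sep v = rhoY p (sep v)" using v V0_W by auto
    then show ?thesis using p v V0_W by (intro CollectI exI[of _ "rhoY p"] exI[of _ "sep v"]) auto
  qed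
  have "sep w \<in> norm_closure T.Y (ip_norm T.Y) (cspan T.Y ?S)" if w: "w \<in> W" for w
  proof -
    obtain b where b: "\<forall>n. b n \<in> B0" "converges X (ip_norm X) (\<lambda>n. \<pi> (b n) \<xi>) w" using W_seq[OF w] by blast
    have "converges T.Y (ip_norm T.Y) (\<lambda>n. sep (\<pi> (b n) \<xi>)) (sep w)"
      using b w by (intro T.Y_converges) auto
    moreover have "sep (\<pi> (b n) \<xi>) \<in> cspan T.Y ?S" for n using V0S b(1) span(2) by (meson V0_mem subsetD)
    ultimately show ?thesis
      unfolding Y.norm_closure_seq[OF span(3)] by (intro exI[of _ "\<lambda>n. sep (\<pi> (b n) \<xi>)"]) simp
  qed
  then show ?thesis
    unfolding nondegenerate_def using Y.norm_closure_subset by (intro antisym) auto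
qed

lemma covariant_Y: "covariant_representation G A act T.Y rhoY UY"
  unfolding covariant_representation_def
proof (intro conjI ballI rhoY_hom rhoY_nondegenerate UY_hom)
  fix g a assume g: "g \<in> carrier G" and a: "a \<in> carrier A"
  have "rhoY (act g a) = T.lift (\<lambda>w. U g (\<rho> a (U (inv g) w)))"
    unfolding rhoY_def
  proof (rule T.lift_cong)
    fix w assume w: "w \<in> W"
    show "\<rho> (act g a) w = U g (\<rho> a (U (inv g) w))"
      using covariant_on_W[OF g a, of "U (inv g) w"] g w by (simp add: U_inv)
  qed
  also have "\<dots> = compose (carrier T.Y) (compose (carrier T.Y) (UY g) (rhoY a)) (UY (inv g))"
    unfolding UY_def rhoY_def using g a by (simp add: T.lift_compose del: T.Y_simps)
  finally show "rhoY (act g a) = UY g \<otimes>\<^bsub>operator_algebra T.Y\<^esub> rhoY a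
      \<otimes>\<^bsub>operator_algebra T.Y\<^esub> star (operator_algebra T.Y) (UY g)"
    using g by (simp add: UY_star del: T.Y_simps)
qed

text \<open>
  The representation \<open>L\<close> from the universal property satisfies \<open>L(elt g f) = U\<^sub>g \<rho>(f)\<close> on the vectors
  \<open>L(b) y\<close>, hence everywhere by nondegeneracy. As \<open>U\<^sub>g \<rho>(f) = \<pi>(elt g f)\<close> on \<open>W\<close>, it agrees with \<open>\<pi>\<close> on \<open>B0\<close>,
  and it is contractive.
\<close>

lemma \<pi>_bound_on_W:
  assumes b: "b \<in> B0" and w: "w \<in> W"
  shows "X.len (\<pi> b w) \<le> nrm B b * X.len w"
proof -
  obtain L where L: "star_hom B (operator_algebra T.Y) L"
    and nd: "nondegenerate T.Y (ip_norm T.Y) (L ` carrier B)"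
    and L_rho: "\<And>a b. \<lbrakk>a \<in> carrier A; b \<in> carrier B\<rbrakk> \<Longrightarrow> compose (carrier T.Y) (rhoY a) (L b) = L (lA a b)"
    and L_U: "\<And>g b. \<lbrakk>g \<in> carrier G; b \<in> carrier B\<rbrakk> \<Longrightarrow> compose (carrier T.Y) (UY g) (L b) = L (uG g b)"
    using B.universal[OF T.Y_hilbert covariant_Y] by (auto simp: lA_def uG_def simp del: T.Y_simps)
  note hom = Y.star_hom_operatorD[OF L]
  have Lc: "L b y \<in> carrier T.Y" if "b \<in> carrier B" "y \<in> carrier T.Y" for b y
    using Y.bopsD(1)[OF hom(1)] that by blast
  have L_elt: "L (elt g f) y = UY g (rhoY f y)" if g: "g \<in> carrier G" and f: "f \<in> A0" and y: "y \<in> carrier T.Y" for g f y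
  proof -
    define Z where "Z = {y \<in> carrier T.Y. L (elt g f) y = UY g (rhoY f y)}"
    let ?S = "{T y |T y. T \<in> L ` carrier B \<and> y \<in> carrier T.Y}"
    note e = hom(1)[OF elt_closed[OF g A0_closed(1)[OF f]]]
    note u = UY_bops[OF g]
    note r = Y.star_hom_operatorD(1)[OF rhoY_hom A0_closed(1)[OF f]]
    have Zc: "Z \<subseteq> carrier T.Y" by (auto simp: Z_def)
    have Z: "submodule Z complex_ring T.Y"
      unfolding Y.submodule_iff
    proof (intro conjI ballI allI Zc)
      have z: "\<zero>\<^bsub>T.Y\<^esub> \<in> carrier T.Y" by (rule Y.M.zero_closed)
      have "T \<zero>\<^bsub>T.Y\<^esub> = \<zero>\<^bsub>T.Y\<^esub>" if "T \<in> Y.bops" for T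
        using Y.bopsD(3)[OF that z, of 0] Y.bopsD(1)[OF that z] z by (simp del: T.Y_simps)
      then show "\<zero>\<^bsub>T.Y\<^esub> \<in> Z" using e u r z by (simp add: Z_def del: T.Y_simps)
    qed (auto simp: Z_def Y.bopsD[OF e] Y.bopsD[OF u] Y.bopsD[OF r] simp del: T.Y_simps)
    have "?S \<subseteq> Z"
    proof clarify
      fix b y assume b: "b \<in> carrier B" and y: "y \<in> carrier T.Y"
      have "L (elt g f) (L b y) = L (uG g (lA f b)) y"
        using hom(4)[of "elt g f" b y] b y g f by simp
      also have "\<dots> = UY g (L (lA f b) y)" using fun_cong[OF L_U[OF g, of "lA f b"], of y] b y f by (simp add: compose_def)
      also have "L (lA f b) y = rhoY f (L b y)" using fun_cong[OF L_rho[of f b], of y] b y f by (simp add: compose_def)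
      finally show "L b y \<in> Z" using Lc b y by (simp add: Z_def del: T.Y_simps)
    qed
    then have "cspan T.Y ?S \<subseteq> Z" by (rule Y.cspan_minimal[OF Z])
    then have "norm_closure T.Y (ip_norm T.Y) Z = carrier T.Y"
      using nd Y.norm_closure_mono Y.norm_closure_subset unfolding nondegenerate_def by blast
    then obtain z where z: "\<And>n. z n \<in> Z" "converges T.Y (ip_norm T.Y) z y"
      using y Y.norm_closure_seq[OF Zc, of y] by auto
    have "converges T.Y (ip_norm T.Y) (\<lambda>n. UY g (rhoY f (z n))) (UY g (rhoY f y))"
      by (rule Y.converges_bops[OF u Y.converges_bops[OF r z(2)]])
    moreover have "converges T.Y (ip_norm T.Y) (\<lambda>n. L (elt g f) (z n)) (L (elt g f) y)"
      by (rule Y.converges_bops[OF e z(2)])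
    moreover have "L (elt g f) (z n) = UY g (rhoY f (z n))" for n using z(1)[of n] by (simp add: Z_def)
    ultimately show ?thesis using Y.converges_unique by simp
  qed
  have "L b (sep w) = sep (\<pi> b w)"
    using b
  proof (induction rule: B0_induct)
    case (elt g f)
    then show ?case using L_elt[of g f "sep w"] w by (simp add: \<pi>_elt_W)
  next
    case zero
    have "L (0 \<odot>\<^bsub>B\<^esub> \<zero>\<^bsub>B\<^esub>) (sep w) = 0 \<odot>\<^bsub>T.Y\<^esub> L \<zero>\<^bsub>B\<^esub> (sep w)" using w by (intro hom(3)) auto
    then have "L \<zero>\<^bsub>B\<^esub> (sep w) = \<zero>\<^bsub>T.Y\<^esub>"
      using Y.scale_zero_left[OF Lc[of "\<zero>\<^bsub>B\<^esub>" "sep w"]] w by simp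
    then show ?case using w by (simp add: \<pi>_zero)
  next
    case (add b c)
    then show ?case using hom(2)[of b c "sep w"] w by (simp add: \<pi>_hom_simps)
  next
    case (scale k b)
    then show ?case using hom(3)[of b "sep w" k] w by (simp add: \<pi>_hom_simps)
  qed
  then show ?thesis
    using star_hom_contractive[OF B.cstar_algebra_axioms T.Y_hilbert L B0_closed(1)[OF b], of "sep w"] b w by simp
qed

end

text \<open>
  A right local unit \<open>p\<close> of \<open>b\<close> moves the vector into the cyclic subspace: \<open>\<pi>(b) x = \<pi>(b) \<pi>(p) x\<close>, and
  \<open>\<pi>(p)\<close> is a projection.
\<close>

lemma (in crossed_product_representation) \<pi>_contractive:
  assumes b: "b \<in> B0" and x: "x \<in> carrier X"
  shows "X.len (\<pi> b x) \<le> nrm B b * X.len x"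
proof -
  interpret cyclic_representation G A act B iA iG A0 \<kappa> X \<pi> x
    by unfold_locales (rule x)
  obtain p where p: "p \<in> A0" "star A p = p" "p \<otimes>\<^bsub>A\<^esub> p = p" "b \<otimes>\<^bsub>B\<^esub> elt \<one> p = b"
    using right_local_unit[OF b] by blast
  define w where "w = \<pi> (elt \<one> p) x"
  have "\<pi> b x = \<pi> b w" using \<pi>_hom_simps(3)[OF b x, of "elt \<one> p"] p by (simp add: w_def)
  moreover have "X.len (\<pi> b w) \<le> nrm B b * X.len w" using p by (intro \<pi>_bound_on_W b) (simp add: w_def)
  moreover have "nrm B b * X.len w \<le> nrm B b * X.len x"
    using \<pi>_projection_contractive[OF p(1-3) x] b by (intro mult_left_mono) (simp_all add: w_def B.nrm_nonneg)
  ultimately show ?thesis by simp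
qed

section \<open>The enveloping C*-algebra\<close>

theorem (in crossed_product_with_projections) enveloping:
  "enveloping_cstar_algebra TYPE('x) B B0"
  unfolding enveloping_cstar_algebra_def
proof (intro conjI allI impI B.cstar_algebra_axioms B0_star_subalgebra B0_dense)
  fix X :: "'x inner_product_space" and \<pi>
  assume "hilbert_space X \<and> star_hom (B\<lparr>carrier := B0\<rparr>) (operator_algebra X) \<pi>"
  then have X: "hilbert_space X" and \<pi>: "star_hom (B\<lparr>carrier := B0\<rparr>) (operator_algebra X) \<pi>" by auto
  interpret X: hilbert_space X by (rule X)
  interpret crossed_product_representation G A act B iA iG A0 \<kappa> X \<pi>
    by unfold_locales (rule \<pi>)
  obtain L where L: "star_hom B (operator_algebra X) L" "\<forall>b\<in>B0. L b = \<pi> b"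
    using star_hom_extend[OF B.cstar_algebra_axioms X B0_star_subalgebra B0_dense \<pi> \<pi>_contractive] by blast
  show "\<exists>!L. L \<in> extensional (carrier B) \<and> star_hom B (operator_algebra X) L \<and> (\<forall>b\<in>B0. L b = \<pi> b)"
  proof (rule ex1I[of _ "restrict L (carrier B)"])
    have "star_hom B (operator_algebra X) (restrict L (carrier B))"
      using L(1) by (auto simp: star_hom_def)
    then show "restrict L (carrier B) \<in> extensional (carrier B) \<and>
        star_hom B (operator_algebra X) (restrict L (carrier B)) \<and> (\<forall>b\<in>B0. restrict L (carrier B) b = \<pi> b)"
      using L(2) by simp
    fix L' assume L': "L' \<in> extensional (carrier B) \<and> star_hom B (operator_algebra X) L' \<and> (\<forall>b\<in>B0. L' b = \<pi> b)"
    show "L' = restrict L (carrier B)"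
    proof (rule extensionalityI)
      fix b assume b: "b \<in> carrier B"
      have "L' b = L b"
      proof (rule star_hom_unique[OF B.cstar_algebra_axioms X _ B0_dense _ L(1) _ b])
        show "B0 \<subseteq> carrier B" by auto
        show "star_hom B (operator_algebra X) L'" using L' by blast
        show "L' c = L c" if "c \<in> B0" for c using L' L(2) that by simp
      qed
      then show "L' b = restrict L (carrier B) b" using b by simp
    qed (use L' in auto)
  qed
qed

theorem corollary4p6:
  fixes G :: "('g, 'm) monoid_scheme" (structure)
    and N H M :: "'g set"
    and B :: "'b star_alg"
    and iD :: "('g \<Rightarrow> complex) \<Rightarrow> ('b \<Rightarrow> 'b) \<times> ('b \<Rightarrow> 'b)"
    and iG :: "'g \<Rightarrow> ('b \<Rightarrow> 'b) \<times> ('b \<Rightarrow> 'b)"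
  assumes "group G"
    and "N \<lhd> G" and "subgroup H G" and "N \<inter> H = {\<one>}" and "N <#> H = carrier G"
    and "M \<lhd> G\<lparr>carrier := N\<rparr>" and "M \<noteq> {\<one>}"
    and filter_base: "\<And>U V. \<lbrakk>U \<in> conjugates G H M; V \<in> conjugates G H M\<rbrakk> \<Longrightarrow>
      \<exists>W\<in>conjugates G H M. W \<subseteq> U \<inter> V"
    and separating: "\<Inter>(conjugates G H M) = {\<one>}"
    and finite_quotients: "\<And>U V. \<lbrakk>U \<in> conjugates G H M; V \<in> conjugates G H M; V \<subseteq> U\<rbrakk> \<Longrightarrow>
      finite {x <# V |x. x \<in> U}"
    and effective: "\<And>a. \<lbrakk>a \<in> H; a \<noteq> \<one>\<rbrakk> \<Longrightarrow> \<exists>s\<in>M. a \<otimes> s \<otimes> inv a \<noteq> s"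
    and crossed_product: "full_crossed_product G (D_algebra G N H M) (alpha G N H) B iD iG"
  shows "enveloping_cstar_algebra TYPE('x) B
    (algebraic_crossed_product G (D0_set G N H M) B iD iG)"
proof -
  interpret G: group G by fact
  interpret c: coset_system G N H M
    by (intro coset_system.intro coset_system_axioms.intro assms)
  interpret p: crossed_product_with_projections G "D_algebra G N H M" "alpha G N H" B iD iG
    c.step_functions c.projection
  proof (intro crossed_product_with_projections.intro crossed_product_with_projections_axioms.intro)
    show "c.projection ` carrier G \<subseteq> c.step_functions"
      unfolding c.projection_range using c.indicator_step_function by (auto simp: coset_projections_def)
    show "nrm (D_algebra G N H M) (alpha G N H g a) \<le> nrm (D_algebra G N H M) a"
      if "g \<in> carrier G" "a \<in> carrier (D_algebra G N H M)" for g a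
      using c.act_norm[OF that(1)] c.D_carrier_linf that(2) unfolding c.D_simps(6) by blast
    show "\<exists>p\<in>c.step_functions. \<exists>q\<in>c.step_functions. star (D_algebra G N H M) p = p \<and>
        p \<otimes>\<^bsub>D_algebra G N H M\<^esub> p = p \<and>
        star (D_algebra G N H M) a \<otimes>\<^bsub>D_algebra G N H M\<^esub> a \<oplus>\<^bsub>D_algebra G N H M\<^esub>
          star (D_algebra G N H M) q \<otimes>\<^bsub>D_algebra G N H M\<^esub> q = p"
      if "a \<in> c.step_functions" "nrm (D_algebra G N H M) a \<le> 1" for a
      using c.sqrt_complement[OF that] .
  qed (use \<open>group G\<close> crossed_product in \<open>simp_all add: c.D_cstar c.step_functions_star_subalgebra_D c.step_functions_dense
        c.act_closed c.act_step_function c.act_linear c.act_inv c.local_units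
        c.generated_by_projections c.projection_range\<close>)
  show ?thesis unfolding c.D0_eq_step_functions by (rule p.enveloping)
qed

end
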